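(* Let $s$ be a fixed positive integer and $c>1/s$ a constant. Assume that $p=p(n)$ satisfies $\frac{c\ln n}{n}<p<\frac12$, and let $W$ be a symmetric $n\times n$ complex matrix all of whose off-diagonal entries are nonzero. Then with probability $1-O\left(\frac{1}{(\ln\ln n)^{1/4}}\right)=1-o(1)$, the random matrix $Q(W,p)$ has the property that any set of (linearly) dependent rows of $Q(W,p)$ contains a non-expanding set of size at most $s-1$. The constant implicit in the $O$ notation is independent of $W$.
   Context: Random model: $W=(w_{ij})$ is a symmetric $n\times n$ complex matrix with $w_{ij}\ne 0$ for $i\neq j$ (no restriction on the diagonal entries $w_{ii}$). Let $\xi_{ij}$, $1\le i\le j\le n$, be independent Bernoulli random variables equal to $1$ with probability $p$ and $0$ with probability $1-p$. $Q(W,p)$ is the random symmetric matrix with entries $q_{ij}=q_{ji}=w_{ij}\xi_{ij}$ for $1\le i\le j\le n$. A set $T$ of rows of a matrix $Q$ is non-expanding if at most $|T|-1$ columns of $Q$ have at least one nonzero entry in the rows of $T$. (For $s=1$ the conclusion says that $Q(W,p)$ is nonsingular.) Asymptotic notation is as $n\to\infty$. *)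

theory Defs
  imports
    "HOL-Probability.Product_PMF"
    "HOL-Library.Landau_Symbols"
    "Jordan_Normal_Form.Matrix"
begin

definition admissible_weights :: "nat \<Rightarrow> complex mat set" where
  "admissible_weights n =
     {W \<in> carrier_mat n n. transpose_mat W = W \<and>
        (\<forall>i<n. \<forall>j<n. i \<noteq> j \<longrightarrow> W $$ (i, j) \<noteq> 0)}"

text \<open>The matrix with entries \<open>q\<^sub>i\<^sub>j = q\<^sub>j\<^sub>i = w\<^sub>i\<^sub>j \<xi>\<^sub>i\<^sub>j\<close> for \<open>i \<le> j\<close>; indices start at 0, and \<open>\<xi>\<close> is only
  read at pairs \<open>(i, j)\<close> with \<open>i \<le> j\<close>.\<close>

definition masked_mat :: "complex mat \<Rightarrow> (nat \<times> nat \<Rightarrow> bool) \<Rightarrow> complex mat" where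
  "masked_mat W \<xi> =
     Matrix.mat (dim_row W) (dim_col W)
       (\<lambda>(i, j). W $$ (min i j, max i j) * of_bool (\<xi> (min i j, max i j)))"

text \<open>The distribution of \<open>Q(W,p)\<close>: \<open>Pi_pmf\<close> makes the \<open>\<xi>\<^sub>i\<^sub>j\<close> with \<open>i \<le> j\<close> independent Bernoulli
  variables (its default value \<open>False\<close> is only taken at unused index pairs).\<close>

definition Q_pmf :: "complex mat \<Rightarrow> real \<Rightarrow> complex mat pmf" where
  "Q_pmf W p =
     map_pmf (masked_mat W)
       (Pi_pmf {(i, j). i \<le> j \<and> j < dim_row W} False (\<lambda>_. bernoulli_pmf p))"

text \<open>Sets of rows are sets of row indices. Dependence is that of the indexed family of rows, so
  two equal rows at different indices are dependent.\<close>

definition dependent_rows :: "complex mat \<Rightarrow> nat set \<Rightarrow> bool" where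
  "dependent_rows Q S \<longleftrightarrow>
     S \<subseteq> {..<dim_row Q} \<and>
     (\<exists>a. (\<exists>i\<in>S. a i \<noteq> 0) \<and> (\<forall>j<dim_col Q. (\<Sum>i\<in>S. a i * Q $$ (i, j)) = 0))"

text \<open>``At most \<open>|T| - 1\<close> columns'' is written with \<open><\<close>, because subtraction on \<open>nat\<close> truncates:
  the empty set is not non-expanding.\<close>

definition non_expanding :: "complex mat \<Rightarrow> nat set \<Rightarrow> bool" where
  "non_expanding Q T \<longleftrightarrow>
     T \<subseteq> {..<dim_row Q} \<and>
     card {j. j < dim_col Q \<and> (\<exists>i\<in>T. Q $$ (i, j) \<noteq> 0)} < card T"

end

theory Submission
  imports Defs "HOL-Combinatorics.Multiset_Permutations" "HOL-Real_Asymp.Real_Asymp"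
begin

text \<open>A dependent set of rows contains the support \<open>T\<close> of a kernel vector of minimal support (a
  circuit). A circuit with \<open>k\<close> rows touches at least \<open>k - 1\<close> columns and touches none of
  them exactly once, and a first moment computation rules this out for \<open>s \<le> k \<le> \<delta> n\<close>: for
  small \<open>k\<close> by counting the columns that are touched twice, where the expected number of circuits is
  about \<open>n\<^sup>1\<^sup>-\<^sup>c\<^sup>k\<close> up to logarithms, and for larger \<open>k\<close> because
  \<open>k\<close> of the columns already determine the kernel of the rows in \<open>T\<close>, and every other column
  has to be orthogonal to a vector of it without zero entries. Circuits with fewer than \<open>s\<close> rows that
  touch \<open>k\<close> columns are ruled out in the same way, so the remaining small circuits are non-expanding.

  If some kernel vector has support larger than \<open>\<delta> n\<close>, then a random index \<open>i\<close> lies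
  in it with probability at least \<open>\<delta>\<close>. Delete row and column \<open>i\<close>, let
  \<open>B\<close> be the remaining matrix and \<open>x\<close> the deleted column. Either \<open>B\<close> has a
  circuit of large support, to which \<open>x\<close> must be orthogonal, or \<open>B u\<^sub>j = e\<^sub>j\<close> is
  solvable for most \<open>j\<close> with \<open>u\<^sub>j\<close> of large support, and \<open>x\<close> satisfies
  the quadratic equation \<open>x\<^sup>T B\<^sup>-\<^sup>1 x = q\<^sub>i\<^sub>i\<close>, which decoupling turns into
  a linear one. In both cases the Littlewood--Offord inequality bounds the probability by a power of \<open>1 / ln
  n\<close>.\<close>


section \<open>Product Bernoulli measures\<close>

text \<open>Requiring \<open>k\<close> rows to touch only \<open>k - 1\<close> columns leaves an
  expected number of about \<open>n powr (1 - c * k)\<close>. With \<open>c > 1 / s\<close> this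
  vanishes for \<open>k \<ge> s\<close>, while smaller supports may occur and can only be shown to
  cover few rows. Asking for one more doubly touched column removes the factor \<open>n\<close>, so
  circuits with \<open>k\<close> rows and \<open>k\<close> columns disappear for every
  \<open>k\<close>.

  The surviving small circuits are the obstacle to the quadratic argument: for \<open>s > 1\<close>
  the minor may well be singular, so it need not have an inverse. Unit equations are therefore
  solved one index at a time, only for indices outside those few rows.

  All estimates have to be uniform in \<open>p\<close>, and \<open>n * p\<close> may be anything
  from order \<open>ln n\<close> to order \<open>n\<close>. Hence the border between the two
  counting arguments is \<open>ln (n / k) = n * p / 640\<close>, not a fixed \<open>k\<close>.

  The exponent 1/4 arises from two square roots: the Littlewood-Offord bound is of order
  \<open>(n * p) powr (-1/2)\<close>, and decoupling bounds only the square of the wanted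
  probability.\<close>

abbreviation bern :: "'a set \<Rightarrow> real \<Rightarrow> ('a \<Rightarrow> bool) pmf" where
  "bern A p \<equiv> Pi_pmf A False (\<lambda>_. bernoulli_pmf p)"

abbreviation prob :: "'a pmf \<Rightarrow> 'a set \<Rightarrow> real" where
  "prob \<equiv> measure_pmf.prob"

lemma prob_mono: "(\<And>x. P x \<Longrightarrow> Q x) \<Longrightarrow> prob M {x. P x} \<le> prob M {x. Q x}"
  by (intro measure_pmf.finite_measure_mono) auto

lemma prob_UN_le:
  assumes "finite I"
  shows "prob M {x. \<exists>i\<in>I. P i x} \<le> (\<Sum>i\<in>I. prob M {x. P i x})"
proof -
  have "{x. \<exists>i\<in>I. P i x} = (\<Union>i\<in>I. {x. P i x})" by auto
  then show ?thesis
    using measure_pmf.finite_measure_subadditive_finite[OF assms, of "\<lambda>i. {x. P i x}" M] by simp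
qed

lemma prob_UN_le_const:
  assumes "finite I" "\<And>i. i \<in> I \<Longrightarrow> prob M {x. P i x} \<le> b"
  shows "prob M {x. \<exists>i\<in>I. P i x} \<le> real (card I) * b"
  using prob_UN_le[OF assms(1), of M P] sum_bounded_above[of I "\<lambda>i. prob M {x. P i x}" b] assms(2)
  by simp

lemma prob_disj_le: "prob M {x. P x \<or> Q x} \<le> prob M {x. P x} + prob M {x. Q x}"
proof -
  have "{x. P x \<or> Q x} = {x. P x} \<union> {x. Q x}" by auto
  then show ?thesis by (simp add: measure_Un_le)
qed

lemma integrable_prob [simp]: "integrable (measure_pmf M) (\<lambda>x. prob (N x) (R x))"
  by (rule measure_pmf.integrable_const_bound[where B = 1]) auto

lemma prob_pair:
  "prob (pair_pmf M N) {(x, y). R x y} = measure_pmf.expectation M (\<lambda>x. prob N {y. R x y})"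
proof -
  have "emeasure (pair_pmf M N) {(x, y). R x y} =
     (\<integral>\<^sup>+ x. emeasure (map_pmf (Pair x) N) {(x, y). R x y} \<partial>measure_pmf M)"
    unfolding pair_pmf_def map_pmf_def by (simp add: emeasure_bind_pmf)
  also have "\<dots> = (\<integral>\<^sup>+ x. ennreal (prob N {y. R x y}) \<partial>measure_pmf M)"
    by (simp add: vimage_def measure_pmf.emeasure_eq_measure)
  also have "\<dots> = ennreal (measure_pmf.expectation M (\<lambda>x. prob N {y. R x y}))"
    by (rule nn_integral_eq_integral) auto
  finally show ?thesis
    by (simp add: measure_pmf.emeasure_eq_measure)
qed

lemma prob_pair_le:
  assumes "\<And>x. C x \<Longrightarrow> prob N {y. R x y} \<le> b" "b \<ge> 0"
  shows "prob (pair_pmf M N) {(x, y). C x \<and> R x y} \<le> b * prob M {x. C x}"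
proof -
  have "prob (pair_pmf M N) {(x, y). C x \<and> R x y} \<le>
      measure_pmf.expectation M (\<lambda>x. b * indicator {x. C x} x)"
    unfolding prob_pair
  proof (intro integral_mono)
    show "integrable (measure_pmf M) (\<lambda>x. b * indicator {x. C x} x)"
      by (rule measure_pmf.integrable_const_bound[where B = b])
         (use assms(2) in \<open>auto simp: indicator_def intro!: AE_I2\<close>)
  qed (auto simp: indicator_def assms)
  also have "\<dots> = b * prob M {x. C x}" by simp
  finally show ?thesis .
qed

lemma bern_split:
  assumes "finite A" "D \<subseteq> A"
  shows "bern A p = map_pmf (\<lambda>(f, g). override_on f g D) (pair_pmf (bern (A - D) p) (bern D p))"
proof -
  have fin: "finite D" "finite (A - D)" using assms finite_subset by auto
  have "bern A p = bern (D \<union> (A - D)) p" using assms by (simp add: Un_absorb1)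
  also have "\<dots> = map_pmf (\<lambda>(f, g) x. if x \<in> D then f x else g x) (pair_pmf (bern D p) (bern (A - D) p))"
    by (rule Pi_pmf_union) (use fin in auto)
  also have "\<dots> = map_pmf (\<lambda>(f, g). override_on f g D) (pair_pmf (bern (A - D) p) (bern D p))"
    by (subst pair_commute_pmf) (auto simp: pmf.map_comp o_def override_on_def case_prod_unfold)
  finally show ?thesis .
qed

text \<open>This is conditioning on the entries outside \<open>D\<close>. The invariance assumption
  says that \<open>C\<close> is decided by those entries, so \<open>C\<close> can be fixed first and
  the block \<open>D\<close> sampled afterwards.\<close>

lemma prob_step:
  assumes "finite A" "D \<subseteq> A" "b \<ge> 0"
    and "\<And>f g. C (override_on f g D) = C f"
    and "\<And>f. C f \<Longrightarrow> prob (bern D p) {g. R (override_on f g D)} \<le> b"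
  shows "prob (bern A p) {x. C x \<and> R x} \<le> b * prob (bern A p) {x. C x}"
proof -
  let ?M = "bern (A - D) p" and ?N = "bern D p"
  have "prob (bern A p) {x. C x \<and> R x} = prob (pair_pmf ?M ?N) {(f, g). C f \<and> R (override_on f g D)}"
    by (subst bern_split[OF assms(1,2)]) (simp add: vimage_def case_prod_unfold assms(4))
  also have "\<dots> \<le> b * prob ?M {f. C f}"
    by (rule prob_pair_le) (use assms in auto)
  also have "prob ?M {f. C f} = prob (pair_pmf ?M ?N) {(f, g). C f}"
  proof -
    have "(\<lambda>x. prob ?N {y. C x}) = indicator {x. C x}"
      by (auto simp: indicator_def fun_eq_iff)
    then show ?thesis unfolding prob_pair by simp
  qed
  also have "\<dots> = prob (bern A p) {x. C x}"
    by (subst bern_split[OF assms(1,2)]) (simp add: vimage_def case_prod_unfold assms(4))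
  finally show ?thesis .
qed

lemma prob_cond:
  assumes "finite A" "D \<subseteq> A" "b \<ge> 0"
    and "\<And>f. prob (bern D p) {g. R (override_on f g D)} \<le> b"
  shows "prob (bern A p) {x. R x} \<le> b"
  using prob_step[OF assms(1-3), of "\<lambda>_. True" p R] assms(4) by (simp add: measure_pmf.prob_space)

text \<open>Independence is expressed by invariance: only \<open>C\<close> and the other \<open>F v\<close> must not
  see the block \<open>D u\<close>, while \<open>F u\<close> may refer to quantities computed from entries outside all
  blocks.\<close>

lemma prob_blocks:
  assumes "finite U" "finite A" "b \<ge> 0"
    and "\<And>u. u \<in> U \<Longrightarrow> D u \<subseteq> A"
    and "\<And>u f g. u \<in> U \<Longrightarrow> C (override_on f g (D u)) = C f"
    and "\<And>u v f g. u \<in> U \<Longrightarrow> v \<in> U \<Longrightarrow> u \<noteq> v \<Longrightarrow> F v (override_on f g (D u)) = F v f"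
    and "\<And>u f. u \<in> U \<Longrightarrow> C f \<Longrightarrow> prob (bern (D u) p) {g. F u (override_on f g (D u))} \<le> b"
  shows "prob (bern A p) {x. C x \<and> (\<forall>u\<in>U. F u x)} \<le> b ^ card U * prob (bern A p) {x. C x}"
  using assms(1,4-)
proof (induction U rule: finite_induct)
  case empty
  then show ?case by simp
next
  case (insert u U)
  have "prob (bern A p) {x. C x \<and> (\<forall>u\<in>insert u U. F u x)} =
      prob (bern A p) {x. (C x \<and> (\<forall>u\<in>U. F u x)) \<and> F u x}"
    by (intro arg_cong2[where f = measure_pmf.prob] refl) auto
  also have "\<dots> \<le> b * prob (bern A p) {x. C x \<and> (\<forall>u\<in>U. F u x)}"
  proof (rule prob_step[OF assms(2) _ assms(3)])
    show "D u \<subseteq> A" using insert.prems by auto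
    fix f g
    show "(C (override_on f g (D u)) \<and> (\<forall>v\<in>U. F v (override_on f g (D u)))) = (C f \<and> (\<forall>v\<in>U. F v f))"
      using insert.prems(2)[of u f g] insert.prems(3)[of u _ f g] insert.hyps by auto
  qed (use insert.prems in auto)
  also have "\<dots> \<le> b * (b ^ card U * prob (bern A p) {x. C x})"
    by (intro mult_left_mono insert.IH assms(3) insert.prems) auto
  finally show ?case using insert.hyps by simp
qed

lemma prob_bern_singleton:
  assumes "0 \<le> p" "p \<le> 1"
  shows "prob (bern {e} p) {g. g e} = p"
proof -
  have "prob (bern {e} p) {g. g e} = prob (bernoulli_pmf p) {True}"
    by (subst Pi_pmf_singleton) (auto simp: vimage_def intro!: arg_cong[where f = "prob _"])
  also have "\<dots> = p" using assms by (simp add: measure_pmf_single)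
  finally show ?thesis .
qed

lemma prob_bern_all:
  assumes "finite A" "X \<subseteq> A" "0 \<le> p" "p \<le> 1"
  shows "prob (bern A p) {g. \<forall>e\<in>X. g e} \<le> p ^ card X"
proof -
  have "prob (bern A p) {g. True \<and> (\<forall>e\<in>X. g e)} \<le> p ^ card X * prob (bern A p) {g. True}"
    by (rule prob_blocks[where D = "\<lambda>e. {e}"])
       (use assms finite_subset in \<open>auto simp: override_on_def prob_bern_singleton\<close>)
  then show ?thesis by (simp add: measure_pmf.prob_space)
qed

lemma prob_bern_card_ge:
  assumes "finite A" "D \<subseteq> A" "0 \<le> p" "p \<le> 1"
  shows "prob (bern A p) {g. b \<le> card {e\<in>D. g e}} \<le> real (card D choose b) * p ^ b"
proof -
  have fin: "finite D" using assms finite_subset by auto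
  have "prob (bern A p) {g. b \<le> card {e\<in>D. g e}} \<le>
      prob (bern A p) {g. \<exists>X\<in>{X. X \<subseteq> D \<and> card X = b}. \<forall>e\<in>X. g e}"
  proof (rule prob_mono)
    fix g :: "'a \<Rightarrow> bool" assume "b \<le> card {e\<in>D. g e}"
    then obtain X where "X \<subseteq> {e\<in>D. g e}" "card X = b" by (meson obtain_subset_with_card_n)
    then show "\<exists>X\<in>{X. X \<subseteq> D \<and> card X = b}. \<forall>e\<in>X. g e" by auto
  qed
  also have "\<dots> \<le> real (card {X. X \<subseteq> D \<and> card X = b}) * p ^ b"
    by (rule prob_UN_le_const) (use fin assms prob_bern_all[of A _ p] in auto)
  finally show ?thesis using fin by (simp add: n_subsets)
qed

lemma prob_bern_card_eq:
  assumes "finite D" "0 \<le> p" "p \<le> 1"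
  shows "prob (bern D p) {g. card {e\<in>D. g e} = l} =
    real (card D choose l) * p ^ l * (1 - p) ^ (card D - l)"
proof -
  have "prob (bern D p) {g. card {e\<in>D. g e} = l} =
     prob (map_pmf (\<lambda>f. card {x\<in>D. f x}) (bern D p)) {l}"
    by (simp add: vimage_def)
  also have "\<dots> = pmf (binomial_pmf (card D) p) l"
    using assms by (subst binomial_pmf_altdef'[symmetric, OF assms(1) refl]) (auto simp: measure_pmf_single)
  finally show ?thesis using assms by simp
qed

text \<open>The convex function \<open>4 powr (- p)\<close> meets the line \<open>1 - p\<close> at 0
  and at 1/2, so it stays below the line in between; its \<open>k\<close>-th power is at least 1/4
  as long as \<open>k * p \<le> 1\<close>.\<close>

lemma power_one_minus_ge:
  fixes p :: real
  assumes "0 \<le> p" "p \<le> 1/2" "real k * p \<le> 1"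
  shows "(1 - p) ^ k \<ge> 1 / 4"
proof -
  have *: "1 - p \<ge> exp (- (2 * ln 2) * p)"
  proof -
    have "convex_on UNIV (\<lambda>x::real. exp (- (2 * ln 2) * x))"
      by (rule f''_ge0_imp_convex[where f' = "\<lambda>x. - (2 * ln 2) * exp (- (2 * ln 2) * x)"
            and f'' = "\<lambda>x. (2 * ln 2)^2 * exp (- (2 * ln 2) * x)"])
         (auto intro!: derivative_eq_intros simp: power2_eq_square)
    from convex_onD[OF this, of "2 * p" 0 "1/2"] assms
    have "exp (- (2 * ln 2) * p) \<le> (1 - 2 * p) + 2 * p * exp (- ln 2)" by (simp add: algebra_simps)
    then show ?thesis by (simp add: exp_minus)
  qed
  have "(1::real) / 4 = exp (- (2 * ln 2))" 
    using exp_of_nat_mult[of 2 "ln 2::real"] by (simp add: exp_minus)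
  also have "\<dots> \<le> exp (- (2 * ln 2) * (real k * p))" using assms by auto
  also have "\<dots> = exp (- (2 * ln 2) * p) ^ k" by (simp add: exp_of_nat_mult[symmetric] mult_ac)
  also have "\<dots> \<le> (1 - p) ^ k" by (intro power_mono *) auto
  finally show ?thesis .
qed


section \<open>The Littlewood--Offord inequality for sparse Bernoulli variables\<close>

text \<open>A permutation of \<open>A\<close> has at most one member of an antichain among the sets of its first
  entries.\<close>

lemma LYM_inequality:
  fixes A :: "'a set"
  assumes fin: "finite A" and F: "F \<subseteq> Pow A"
    and anti: "\<And>X Y. X \<in> F \<Longrightarrow> Y \<in> F \<Longrightarrow> X \<subseteq> Y \<Longrightarrow> X = Y"
  shows "(\<Sum>X\<in>F. fact (card X) * fact (card A - card X)) \<le> (fact (card A) :: nat)"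
proof -
  define L where "L X = (\<lambda>(xs, ys). xs @ ys) ` (permutations_of_set X \<times> permutations_of_set (A - X))" for X
  have finF: "finite F" using F fin by (meson finite_Pow_iff finite_subset)
  have finX: "finite X" if "X \<in> F" for X
    using that F fin by (meson PowD finite_subset subsetD)
  have L: "set (take (card X) zs) = X" if zs: "zs \<in> L X" for X zs
  proof -
    obtain xs ys where "zs = xs @ ys" "xs \<in> permutations_of_set X"
      using zs unfolding L_def by auto
    then show ?thesis
      using permutations_of_setD[of xs X] distinct_card[of xs] by auto
  qed
  have card_L: "card (L X) = fact (card X) * fact (card A - card X)" if "X \<in> F" for X
  proof -
    have "inj_on (\<lambda>(xs, ys). xs @ ys) (permutations_of_set X \<times> permutations_of_set (A - X))"
    proof (rule inj_onI, clarify)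
      fix xs ys xs' ys' assume *: "xs \<in> permutations_of_set X" "xs' \<in> permutations_of_set X" "xs @ ys = xs' @ ys'"
      then have "length xs = length xs'"
        by (metis permutations_of_setD distinct_card)
      then show "xs = xs' \<and> ys = ys'" using * by simp
    qed
    moreover have "card (A - X) = card A - card X"
      using that F finX by (intro card_Diff_subset) auto
    ultimately show ?thesis
      unfolding L_def using finX[OF that] fin by (subst card_image) auto
  qed
  have sub: "L X \<subseteq> permutations_of_set A" if "X \<in> F" for X
  proof
    fix zs assume "zs \<in> L X"
    then obtain xs ys where *: "zs = xs @ ys" "xs \<in> permutations_of_set X" "ys \<in> permutations_of_set (A - X)"
      unfolding L_def by auto
    show "zs \<in> permutations_of_set A"
      using permutations_of_setD[OF *(2)] permutations_of_setD[OF *(3)] that F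
      by (intro permutations_of_setI) (auto simp: *(1))
  qed
  have disj: "L X \<inter> L Y = {}" if "X \<in> F" "Y \<in> F" "X \<noteq> Y" for X Y
  proof (rule ccontr)
    assume "L X \<inter> L Y \<noteq> {}"
    then obtain zs where "set (take (card X) zs) = X" "set (take (card Y) zs) = Y"
      using L by blast
    then have "X \<subseteq> Y \<or> Y \<subseteq> X"
      by (metis nat_le_linear set_take_subset_set_take)
    then show False using anti that by blast
  qed
  have "(\<Sum>X\<in>F. fact (card X) * fact (card A - card X)) = (\<Sum>X\<in>F. card (L X))"
    using card_L by simp
  also have "\<dots> = card (\<Union>X\<in>F. L X)"
  proof (rule card_UN_disjoint[symmetric])
    show "\<forall>X\<in>F. finite (L X)" using sub finite_subset finite_permutations_of_set by metis
  qed (use finF disj in auto)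
  also have "\<dots> \<le> card (permutations_of_set A)"
    using sub by (intro card_mono) auto
  finally show ?thesis using fin by simp
qed

text \<open>Within about the square root of \<open>m p (1 - p)\<close> steps from \<open>l\<close> towards the mode,
  the point masses stay above half of the mass at \<open>l\<close>.\<close>

lemma binomial_point_le:
  fixes p :: real
  assumes p: "0 < p" "p < 1" and m: "m > 0"
  shows "real (m choose l) * p ^ l * (1 - p) ^ (m - l) \<le> 4 / sqrt (real m * p * (1 - p))"
proof -
  define q where "q = 1 - p"
  define X where "X = real m * p * q"
  define b where "b l = real (m choose l) * p ^ l * q ^ (m - l)" for l
  define I where "I = nat \<lfloor>sqrt X / 2\<rfloor>"
  \<comment> \<open>Bounds the relative loss of one step taken at most \<open>I\<close> beyond the
    mean \<open>m * p\<close>. For \<open>X > 16\<close> one has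
    \<open>I * \<epsilon> \<le> 1/2\<close>, so \<open>I\<close> steps lose at most half of the
    mass.\<close>
  define \<epsilon> where "\<epsilon> = (real I + 2) / X"
  have q: "0 < q" "q < 1" "p + q = 1" using p by (auto simp: q_def)
  have X: "X > 0" using p q m by (simp add: X_def)
  have b0: "b l \<ge> 0" for l using p q by (simp add: b_def)
  have sum1: "(\<Sum>l\<le>m. b l) = 1"
    using binomial_ring[of p q m] q by (simp add: b_def)
  have bsum: "(\<Sum>l\<in>S. b l) \<le> 1" if "finite S" for S
  proof -
    have "(\<Sum>l\<in>S. b l) = (\<Sum>l\<in>S \<inter> {..m}. b l)"
      by (rule sum.mono_neutral_right) (use that in \<open>auto simp: b_def\<close>)
    also have "\<dots> \<le> (\<Sum>l\<le>m. b l)" by (rule sum_mono2) (use b0 in auto)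
    finally show ?thesis using sum1 by simp
  qed
  have rec: "b (Suc l) * (real l + 1) * q = b l * (real m - real l) * p" for l
  proof (cases "l < m")
    case True
    then obtain d where d: "m = Suc (l + d)" by (metis less_iff_Suc_add)
    have "Suc l * (m choose Suc l) = (m - l) * (m choose l)"
      using binomial_absorb_comp[of m l] binomial_absorption[of l "m"]
      by simp
    then have "(real l + 1) * real (m choose Suc l) = (real m - real l) * real (m choose l)"
      using True by (simp flip: of_nat_mult of_nat_Suc of_nat_diff add: add.commute)
    moreover have "q ^ (m - l) = q ^ (m - Suc l) * q" using d by simp
    moreover have "b (Suc l) * (real l + 1) * q =
        ((real l + 1) * real (m choose Suc l)) * (p ^ l * p * (q ^ (m - Suc l) * q))"
      by (simp add: b_def mult_ac)
    moreover have "b l * (real m - real l) * p =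
        ((real m - real l) * real (m choose l)) * (p ^ l * p * q ^ (m - l))"
      by (simp add: b_def mult_ac)
    ultimately show ?thesis by (simp only:)
  next
    case False
    then have "l = m \<or> l > m" by linarith
    then show ?thesis by (auto simp: b_def binomial_eq_0)
  qed
  have bl: "b l \<le> 4 / sqrt X"
  proof (cases "X \<le> 16")
    case True
    then have "sqrt X \<le> 4" using real_sqrt_le_mono[OF True] by simp
    then have "1 \<le> 4 / sqrt X" using X by (simp add: field_simps)
    then show ?thesis using bsum[of "{l}"] by simp
  next
    case False16: False
    then have sX: "sqrt X > 4" using real_less_rsqrt[of 4 X] by simp
    have I: "real I \<le> sqrt X / 2" "real I + 1 \<ge> sqrt X / 2" unfolding I_def using sX by linarith+
    have "real I * (real I + 2) \<le> sqrt X / 2 * (sqrt X / 2 + 2)"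
      using I sX X by (intro mult_mono) auto
    also have "\<dots> = X / 4 + sqrt X" using X by (simp add: algebra_simps)
    also have "sqrt X \<le> X / 4" using mult_right_mono[of 4 "sqrt X" "sqrt X"] sX X by simp
    finally have I2: "real I * \<epsilon> \<le> 1/2" using X by (simp add: \<epsilon>_def field_simps)
    have e0: "0 \<le> \<epsilon>" using X by (simp add: \<epsilon>_def)
    have I1: "real I \<ge> 1" using I sX by linarith
    have e1: "\<epsilon> \<le> 1/2" using I2 mult_right_mono[OF I1 e0] by simp
    have eX: "\<epsilon> * X = real I + 2" using X by (simp add: \<epsilon>_def)
    have half: "(1 - \<epsilon>) ^ i \<ge> 1/2" if "i \<le> I" for i
    proof -
      have "1 + real i * (- \<epsilon>) \<le> (1 + (- \<epsilon>)) ^ i" using e1 by (intro Bernoulli_inequality) auto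
      moreover have "real i * \<epsilon> \<le> real I * \<epsilon>" using that e0 by (intro mult_right_mono) auto
      ultimately show ?thesis using I2 by simp
    qed
    have aux: "(1 - \<epsilon>) * y * s \<le> z * s" if "y \<le> z" "0 \<le> z" "0 \<le> s" for y z s :: real
    proof -
      have "(1 - \<epsilon>) * y \<le> (1 - \<epsilon>) * z" using e1 that by (intro mult_left_mono) auto
      also have "\<dots> \<le> z" using e0 that by (simp add: algebra_simps)
      finally show ?thesis using that by (intro mult_right_mono) auto
    qed
    \<comment> \<open>The \<open>I + 1\<close> distinct points \<open>h i\<close> carry mass at
      least \<open>b l / 2\<close> each and at most 1 together, and
      \<open>I + 1 \<ge> sqrt X / 2\<close>.\<close>
    have fin: "b l \<le> 4 / sqrt X" if inj: "inj_on h {..I}" and h: "\<And>i. i \<le> I \<Longrightarrow> b (h i) \<ge> (1 - \<epsilon>) ^ i * b l" for h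
    proof -
      have "(real I + 1) * (1/2 * b l) = (\<Sum>i\<le>I. 1/2 * b l)" by simp
      also have "\<dots> \<le> (\<Sum>i\<le>I. b (h i))"
      proof (rule sum_mono)
        fix i assume "i \<in> {..I}"
        then show "1/2 * b l \<le> b (h i)"
          using h[of i] mult_right_mono[OF half[of i] b0[of l]] by simp
      qed
      also have "\<dots> = (\<Sum>j\<in>h ` {..I}. b j)" using inj by (simp add: sum.reindex)
      also have "\<dots> \<le> 1" by (rule bsum) simp
      finally have "(real I + 1) * b l \<le> 2" by simp
      moreover have "sqrt X / 2 * b l \<le> (real I + 1) * b l" using I b0 by (intro mult_right_mono) auto
      ultimately have "sqrt X / 2 * b l \<le> 2" by (rule order.trans[rotated])
      then have "b l * sqrt X \<le> 4" by (simp add: mult.commute)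
      then show ?thesis using sX X by (subst pos_le_divide_eq) auto
    qed
    show ?thesis
    \<comment> \<open>The walk goes right from points up to about the mean and left from the others.
      It may overshoot the mean, but by at most about \<open>I\<close>, where the ratio of
      neighbouring masses is still at least \<open>1 - \<epsilon>\<close>.\<close>
    proof (cases "real l \<le> real m * p + 1")
      case True
      have "b (l + i) \<ge> (1 - \<epsilon>) ^ i * b l" if "i \<le> I" for i
        using that
      proof (induction i)
        case (Suc i)
        define j where "j = real (l + i) - real m * p"
        have j: "j \<le> real I" using True Suc.prems by (simp add: j_def)
        have "(1 - \<epsilon>) * (j + 1) * q \<le> (real I + 1) * q" using j q by (intro aux) auto
        moreover have "j * p \<le> real I * p" using j p by simp
        ultimately have "j * p + (1 - \<epsilon>) * (j + 1) * q \<le> real I * (p + q) + q" by (simp add: algebra_simps)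
        also have "\<dots> \<le> \<epsilon> * X" using q eX by simp
        finally have "(1 - \<epsilon>) * (X + (j + 1) * q) \<le> X - j * p" by (simp add: algebra_simps)
        moreover have "X + (j + 1) * q = (real (l + i) + 1) * q" by (simp add: X_def j_def algebra_simps)
        moreover have "X - j * p = (real m - real (l + i)) * p"
          using q by (simp add: X_def j_def q_def algebra_simps)
        ultimately have "(1 - \<epsilon>) * ((real (l + i) + 1) * q) \<le> (real m - real (l + i)) * p" by simp
        from mult_left_mono[OF this b0[of "l + i"]]
        have "b (l + i) * (1 - \<epsilon>) * ((real (l + i) + 1) * q) \<le> b (l + i) * (real m - real (l + i)) * p"
          by (simp add: mult_ac)
        also have "\<dots> = b (Suc (l + i)) * ((real (l + i) + 1) * q)" using rec[of "l + i"] by (simp add: mult_ac)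
        finally have "b (l + i) * (1 - \<epsilon>) \<le> b (Suc (l + i))" using q by (simp add: mult_le_cancel_right)
        moreover have "(1 - \<epsilon>) * ((1 - \<epsilon>) ^ i * b l) \<le> (1 - \<epsilon>) * b (l + i)"
          using e1 Suc by (intro mult_left_mono) auto
        ultimately show ?case by (simp add: mult_ac)
      qed simp
      then show ?thesis by (intro fin[of "\<lambda>i. l + i"]) (auto simp: inj_on_def)
    next
      case False
      \<comment> \<open>Leads to \<open>l > I\<close>, which keeps the subtraction in
        \<open>l - i\<close> exact along the whole walk to the left.\<close>
      have "sqrt X \<le> X"using mult_right_mono[of 1 "sqrt X" "sqrt X"] sX X False16 by simp
      moreover have "X \<le> real m * p" unfolding X_def using p q by (intro mult_left_le) auto
      ultimately have lI: "l > I" using False I sX by linarith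
      have "b (l - i) \<ge> (1 - \<epsilon>) ^ i * b l" if "i \<le> I" for i
        using that
      proof (induction i)
        case (Suc i)
        define l' where "l' = l - Suc i"
        have l': "l - i = Suc l'" using Suc.prems lI by (simp add: l'_def)
        define j where "j = real m * p - real l'"
        have "real l' = real l - real i - 1" using l' lI Suc.prems by linarith
        then have j: "j \<le> real I" using False Suc.prems by (simp add: j_def)
        have "(1 - \<epsilon>) * j * p \<le> real I * p" using j p by (intro aux) auto
        moreover have "(j - 1) * q \<le> real I * q" using j q by simp
        ultimately have "(j - 1) * q + (1 - \<epsilon>) * j * p \<le> real I * (p + q)" by (simp add: algebra_simps)
        also have "\<dots> \<le> \<epsilon> * X" using q eX by simp
        finally have "(1 - \<epsilon>) * (X + j * p) \<le> X - (j - 1) * q" by (simp add: algebra_simps)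
        moreover have "X + j * p = (real m - real l') * p"
          using q by (simp add: X_def j_def q_def algebra_simps)
        moreover have "X - (j - 1) * q = (real l' + 1) * q" by (simp add: X_def j_def algebra_simps)
        ultimately have "(1 - \<epsilon>) * ((real m - real l') * p) \<le> (real l' + 1) * q" by simp
        from mult_left_mono[OF this b0[of "Suc l'"]]
        have "b (Suc l') * (1 - \<epsilon>) * ((real m - real l') * p) \<le> b (Suc l') * (real l' + 1) * q"
          by (simp add: mult_ac)
        also have "\<dots> = b l' * ((real m - real l') * p)" using rec[of "l'"] by (simp add: mult_ac)
        finally have *: "b (Suc l') * (1 - \<epsilon>) * ((real m - real l') * p) \<le> b l' * ((real m - real l') * p)" .
        have "b (Suc l') * (1 - \<epsilon>) \<le> b l'"
        proof (cases "l' < m")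
          case True
          then have "(real m - real l') * p > 0" using p by simp
          then show ?thesis using * by (simp add: mult_le_cancel_right)
        next
          case False
          then have "b (Suc l') = 0" by (simp add: b_def)
          then show ?thesis using b0 by simp
        qed
        moreover have "(1 - \<epsilon>) * ((1 - \<epsilon>) ^ i * b l) \<le> (1 - \<epsilon>) * b (l - i)"
          using e1 Suc by (intro mult_left_mono) auto
        ultimately show ?case using l' by (simp add: mult_ac l'_def)
      qed simp
      then show ?thesis using lI by (intro fin[of "\<lambda>i. l - i"]) (auto simp: inj_on_def)
    qed
  qed
  then show ?thesis by (simp add: b_def X_def q_def)
qed

text \<open>A single set of size \<open>l\<close> has probability equal to the binomial point mass
  at \<open>l\<close> divided by \<open>m choose l\<close>. The point masses are bounded uniformly,
  and by the LYM inequality the reciprocals of the binomial coefficients sum to at most 1 over an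
  antichain.\<close>

lemma prob_bern_antichain_le:
  assumes fin: "finite A" and A: "card A > 0" and p: "0 < p" "p < 1"
    and anti: "\<And>X Y. X \<in> F \<Longrightarrow> Y \<in> F \<Longrightarrow> X \<subseteq> Y \<Longrightarrow> X = Y"
  shows "prob (bern A p) {g. {e\<in>A. g e} \<in> F} \<le> 4 / sqrt (real (card A) * p * (1 - p))"
proof -
  define m where "m = card A"
  define F' where "F' = F \<inter> Pow A"
  define \<beta> where "\<beta> = 4 / sqrt (real m * p * (1 - p))"
  have \<beta>: "\<beta> \<ge> 0" using p by (simp add: \<beta>_def)
  have finF: "finite F'" using fin by (simp add: F'_def)
  have pt: "prob (bern A p) {g. {e\<in>A. g e} = X} \<le> p ^ card X * (1 - p) ^ (m - card X)" if "X \<subseteq> A" for X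
  proof -
    have "prob (bern A p) {g. {e\<in>A. g e} = X} = prob (bern A p) ({g. {e\<in>A. g e} = X} \<inter> set_pmf (bern A p))"
      by (simp add: measure_Int_set_pmf)
    also have "\<dots> \<le> prob (bern A p) {\<lambda>e. e \<in> X}"
      using set_Pi_pmf_subset[OF fin, of False "\<lambda>_. bernoulli_pmf p"]
      by (intro measure_pmf.finite_measure_mono) (auto simp: fun_eq_iff)
    also have "\<dots> = pmf (bern A p) (\<lambda>e. e \<in> X)" by (simp add: measure_pmf_single)
    also have "\<dots> = (\<Prod>e\<in>A. pmf (bernoulli_pmf p) (e \<in> X))"
      using fin that by (subst pmf_Pi') auto
    also have "\<dots> = (\<Prod>e\<in>X. pmf (bernoulli_pmf p) (e \<in> X)) * (\<Prod>e\<in>A - X. pmf (bernoulli_pmf p) (e \<in> X))"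
      using prod.subset_diff[OF that fin] by (metis mult.commute)
    also have "\<dots> = p ^ card X * (1 - p) ^ (m - card X)"
      using that fin p by (simp add: card_Diff_subset finite_subset m_def)
    finally show ?thesis .
  qed
  have "prob (bern A p) {g. {e\<in>A. g e} \<in> F} = prob (bern A p) {g. \<exists>X\<in>F'. {e\<in>A. g e} = X}"
    by (intro arg_cong2[where f = measure_pmf.prob] refl) (auto simp: F'_def)
  also have "\<dots> \<le> (\<Sum>X\<in>F'. prob (bern A p) {g. {e\<in>A. g e} = X})"
    by (rule prob_UN_le[OF finF])
  also have "\<dots> \<le> (\<Sum>X\<in>F'. \<beta> / fact m * (fact (card X) * fact (m - card X)))"
  proof (rule sum_mono)
    fix X assume "X \<in> F'"
    then have X: "X \<subseteq> A" by (simp add: F'_def)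
    have le: "card X \<le> m" using card_mono[OF fin X] by (simp add: m_def)
    have fact: "real (m choose card X) = fact m / (fact (card X) * fact (m - card X))"
      using binomial_fact[OF le] by simp
    have "prob (bern A p) {g. {e\<in>A. g e} = X} \<le> p ^ card X * (1 - p) ^ (m - card X)" by (rule pt[OF X])
    also have "\<dots> = real (m choose card X) * p ^ card X * (1 - p) ^ (m - card X) *
        ((fact (card X) * fact (m - card X)) / fact m)" by (simp add: fact)
    also have "\<dots> \<le> \<beta> * ((fact (card X) * fact (m - card X)) / fact m)"
      unfolding \<beta>_def using p A by (intro mult_right_mono binomial_point_le) (auto simp: m_def)
    finally show "prob (bern A p) {g. {e\<in>A. g e} = X} \<le> \<beta> / fact m * (fact (card X) * fact (m - card X))"
      by simp
  qed
  also have "\<dots> = \<beta> / fact m * real (\<Sum>X\<in>F'. fact (card X) * fact (m - card X))"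
    by (simp add: sum_distrib_left)
  also have "\<dots> \<le> \<beta> / fact m * fact m"
  proof (rule mult_left_mono)
    have "(\<Sum>X\<in>F'. fact (card X) * fact (m - card X)) \<le> (fact m :: nat)"
      unfolding m_def by (rule LYM_inequality[OF fin]) (use anti in \<open>auto simp: F'_def\<close>)
    then show "real (\<Sum>X\<in>F'. fact (card X) * fact (m - card X)) \<le> fact m"
      by (metis of_nat_fact of_nat_le_iff)
  qed (use \<beta> in auto)
  finally show ?thesis by (simp add: \<beta>_def m_def)
qed

lemma sum_of_bool_override:
  fixes c :: "'a \<Rightarrow> 'b :: comm_ring_1"
  assumes "finite A" "D \<subseteq> A"
  shows "(\<Sum>t\<in>A. c t * of_bool (override_on f g D t)) =
    (\<Sum>t\<in>D. c t * of_bool (g t)) + (\<Sum>t\<in>A - D. c t * of_bool (f t))"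
proof -
  have "(\<Sum>t\<in>A. c t * of_bool (override_on f g D t)) =
    (\<Sum>t\<in>A - D. c t * of_bool (override_on f g D t)) + (\<Sum>t\<in>D. c t * of_bool (override_on f g D t))"
    by (rule sum.subset_diff) (use assms in auto)
  then show ?thesis by (simp add: override_on_def add.commute)
qed

lemma exists_same_sign:
  fixes c :: "'a \<Rightarrow> complex"
  assumes fin: "finite D" and nz: "\<And>t. t \<in> D \<Longrightarrow> c t \<noteq> 0"
  shows "\<exists>T \<psi>. T \<subseteq> D \<and> card D \<le> 4 * card T \<and> Modules.additive \<psi> \<and> (\<forall>t\<in>T. \<psi> (c t) > (0::real))"
proof -
  let ?S = "\<lambda>\<psi>. {t\<in>D. \<psi> (c t) > (0::real)}"
  let ?R = "\<lambda>z. - Re z" and ?I = "\<lambda>z. - Im z"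
  have "D \<subseteq> ?S Re \<union> ?S ?R \<union> ?S Im \<union> ?S ?I"
  proof
    fix t assume "t \<in> D"
    with nz[of t] have "Re (c t) \<noteq> 0 \<or> Im (c t) \<noteq> 0" by (simp add: complex_eq_iff)
    then have "Re (c t) > 0 \<or> - Re (c t) > 0 \<or> Im (c t) > 0 \<or> - Im (c t) > 0" by linarith
    then show "t \<in> ?S Re \<union> ?S ?R \<union> ?S Im \<union> ?S ?I" using \<open>t \<in> D\<close> by blast
  qed
  then have "card D \<le> card (?S Re \<union> ?S ?R \<union> ?S Im \<union> ?S ?I)"
    using fin by (intro card_mono) auto
  also have "\<dots> \<le> card (?S Re) + card (?S ?R) + card (?S Im) + card (?S ?I)"
    using card_Un_le[of "?S Re \<union> ?S ?R \<union> ?S Im" "?S ?I"] card_Un_le[of "?S Re \<union> ?S ?R" "?S Im"]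
      card_Un_le[of "?S Re" "?S ?R"] by linarith
  finally have "card D \<le> 4 * card (?S Re) \<or> card D \<le> 4 * card (?S ?R) \<or>
      card D \<le> 4 * card (?S Im) \<or> card D \<le> 4 * card (?S ?I)" by linarith
  moreover have "Modules.additive Re" "Modules.additive ?R" "Modules.additive Im" "Modules.additive ?I"
    by (auto simp: Modules.additive_def)
  moreover have "?S \<psi> \<subseteq> D \<and> (\<forall>t\<in>?S \<psi>. \<psi> (c t) > 0)" for \<psi> by blast
  ultimately show ?thesis by meson
qed

text \<open>A quarter of the coefficients lie in one open half plane, and for these the solution sets
  form an antichain.\<close>

theorem littlewood_offord:
  fixes c :: "'a \<Rightarrow> complex"
  assumes fin: "finite A" and p: "0 < p" "p \<le> 1/2" and k: "0 < k" "k \<le> card {t\<in>A. c t \<noteq> 0}"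
  shows "prob (bern A p) {x. (\<Sum>t\<in>A. c t * of_bool (x t)) = z} \<le> 12 / sqrt (real k * p)"
proof -
  have "finite {t\<in>A. c t \<noteq> 0}" using fin by auto
  from exists_same_sign[OF this, of c]
  obtain T \<psi> where T: "T \<subseteq> {t\<in>A. c t \<noteq> 0}" "card {t\<in>A. c t \<noteq> 0} \<le> 4 * card T"
      "Modules.additive \<psi>" and pos': "\<forall>t\<in>T. \<psi> (c t) > (0::real)"
    by blast
  have pos: "\<psi> (c t) > 0" if "t \<in> T" for t using pos' that by blast
  have TA: "T \<subseteq> A" using T(1) by blast
  have finT: "finite T" using TA fin by (rule finite_subset)
  have cT: "card T > 0" using T k by auto
  have "prob (bern A p) {x. (\<Sum>t\<in>A. c t * of_bool (x t)) = z} \<le> 4 / sqrt (real (card T) * p * (1 - p))"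
  proof (rule prob_cond[OF fin TA])
    fix f
    define z' where "z' = z - (\<Sum>t\<in>A - T. c t * of_bool (f t))"
    define F where "F = {X. X \<subseteq> T \<and> (\<Sum>t\<in>X. c t) = z'}"
    have "{g. (\<Sum>t\<in>A. c t * of_bool (override_on f g T t)) = z} = {g. {e\<in>T. g e} \<in> F}"
    proof -
      have "(\<Sum>t\<in>T. c t * of_bool (g t)) = (\<Sum>t\<in>{e\<in>T. g e}. c t)" for g
        using finT by (intro sum.mono_neutral_cong_right) auto
      then show ?thesis
        by (auto simp: sum_of_bool_override[OF fin TA] F_def z'_def algebra_simps)
    qed
    moreover have "prob (bern T p) {g. {e\<in>T. g e} \<in> F} \<le> 4 / sqrt (real (card T) * p * (1 - p))"
    proof (rule prob_bern_antichain_le[OF finT cT])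
      fix X Y assume XY: "X \<in> F" "Y \<in> F" "X \<subseteq> Y"
      have finY: "finite Y" using XY finT by (auto simp: F_def intro: finite_subset)
      have "(\<Sum>t\<in>Y - X. c t) = 0" using XY finY by (simp add: F_def sum_diff)
      then have "(\<Sum>t\<in>Y - X. \<psi> (c t)) = 0"
        using Modules.additive.sum[OF T(3), of c "Y - X"] Modules.additive.zero[OF T(3)] by simp
      moreover have "(\<Sum>t\<in>Y - X. \<psi> (c t)) > 0" if "Y - X \<noteq> {}"
        by (rule sum_pos) (use that finY XY pos in \<open>auto simp: F_def\<close>)
      ultimately have "Y - X = {}" by auto
      then show "X = Y" using XY by auto
    qed (use p in auto)
    ultimately show "prob (bern T p) {g. (\<Sum>t\<in>A. c t * of_bool (override_on f g T t)) = z}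
      \<le> 4 / sqrt (real (card T) * p * (1 - p))" by simp
  qed (use p in auto)
  also have "\<dots> \<le> 12 / sqrt (real k * p)"
  proof -
    define y where "y = real (card T) * p"
    have "real k \<le> 4 * real (card T)" using k T by linarith
    then have "real k * p \<le> 4 * real (card T) * p" using p by (intro mult_right_mono) auto
    moreover have "y * (1/2) \<le> y * (1 - p)" using p by (intro mult_left_mono) (auto simp: y_def)
    moreover have "y \<ge> 0" using p by (simp add: y_def)
    \<comment> \<open>The losses are a factor 4 from the half plane and 2 from
      \<open>1 - p \<ge> 1/2\<close>; the product 8 is rounded up to the square 9, and
      \<open>4 * 3 = 12\<close> is the constant of the theorem.\<close>
    ultimately have "real k * p \<le> 9 * (real (card T) * p * (1 - p))"
      unfolding y_def by linarith
    then have "sqrt (real k * p) \<le> 3 * sqrt (real (card T) * p * (1 - p))"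
      using real_sqrt_le_mono[of "real k * p" "9 * (real (card T) * p * (1 - p))"]
      by (simp add: real_sqrt_mult)
    moreover have "sqrt (real k * p) > 0" using k p by simp
    moreover have "sqrt (real (card T) * p * (1 - p)) > 0" using cT p by simp
    ultimately show ?thesis by (simp add: field_simps)
  qed
  finally show ?thesis .
qed


section \<open>Kernels, circuits and unit solutions\<close>

lemma underdetermined_system:
  fixes M :: "'i \<Rightarrow> 'j \<Rightarrow> 'a :: field"
  assumes "finite C" "finite T" "card C < card T"
  shows "\<exists>a. (\<exists>i\<in>T. a i \<noteq> 0) \<and> (\<forall>i. i \<notin> T \<longrightarrow> a i = 0) \<and> (\<forall>j\<in>C. (\<Sum>i\<in>T. a i * M i j) = 0)"
  using assms
proof (induction C arbitrary: T M rule: finite_induct)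
  case empty
  then obtain i0 where "i0 \<in> T" by fastforce
  then show ?case by (intro exI[of _ "\<lambda>i. if i = i0 then 1 else 0"]) auto
next
  case (insert j C)
  show ?case
  proof (cases "\<forall>i\<in>T. M i j = 0")
    case True
    have "card C < card T" using insert by simp
    from insert.IH[OF insert.prems(1) this, of M] show ?thesis using True by auto
  next
    case False
    then obtain i0 where i0: "i0 \<in> T" "M i0 j \<noteq> 0" by blast
    define T' where "T' = T - {i0}"
    have fT': "finite T'" "i0 \<notin> T'" "T = insert i0 T'" using i0 insert by (auto simp: T'_def)
    define c where "c i = M i j / M i0 j" for i
    have "card C < card T'" using insert fT' by simp
    from insert.IH[OF fT'(1) this, of "\<lambda>i u. M i u - c i * M i0 u"]
    obtain a where a: "\<exists>i\<in>T'. a i \<noteq> 0" "\<forall>i. i \<notin> T' \<longrightarrow> a i = 0"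
      "\<And>u. u \<in> C \<Longrightarrow> (\<Sum>i\<in>T'. a i * (M i u - c i * M i0 u)) = 0" by blast
    define b where "b = a(i0 := - (\<Sum>i\<in>T'. a i * c i))"
    have "(\<Sum>i\<in>T. b i * M i u) = (\<Sum>i\<in>T'. a i * (M i u - c i * M i0 u))" for u
    proof -
      have "(\<Sum>i\<in>T. b i * M i u) = - (\<Sum>i\<in>T'. a i * c i) * M i0 u + (\<Sum>i\<in>T'. b i * M i u)"
        using fT' by (simp add: b_def)
      also have "(\<Sum>i\<in>T'. b i * M i u) = (\<Sum>i\<in>T'. a i * M i u)"
        using fT' by (intro sum.cong) (auto simp: b_def)
      finally show ?thesis by (simp add: algebra_simps sum_subtractf sum_distrib_left)
    qed
    moreover have "(\<Sum>i\<in>T'. a i * (M i j - c i * M i0 j)) = 0" using i0 by (simp add: c_def)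
    moreover have "\<exists>i\<in>T. b i \<noteq> 0"
    proof -
      obtain i where "i \<in> T'" "a i \<noteq> 0" using a(1) by blast
      then have "i \<in> T" "b i \<noteq> 0" using fT' by (auto simp: b_def)
      then show ?thesis by blast
    qed
    moreover have "\<forall>i. i \<notin> T \<longrightarrow> b i = 0" using a(2) fT' by (auto simp: b_def)
    ultimately show ?thesis using a(3) by (intro exI[of _ b]) auto
  qed
qed

text \<open>A rank bound obtained from a smallest determining set \<open>J\<close>. By minimality
  each \<open>j \<in> J\<close> has a vector \<open>w j\<close> that violates column
  \<open>j\<close> and no other column of \<open>J\<close>. If \<open>J\<close> had at least
  \<open>card T\<close> elements, these vectors together with \<open>v\<close> would be linearly
  dependent; testing the relation on column \<open>j\<close> kills the coefficient of
  \<open>w j\<close>, which leaves a nonzero multiple of \<open>v\<close> equal to zero.\<close>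

lemma kernel_determined_by_few_columns:
  fixes M :: "'i \<Rightarrow> 'j \<Rightarrow> 'a :: field"
  assumes fT: "finite T" and fC: "finite C" and v: "\<exists>t\<in>T. v t \<noteq> 0" "\<forall>u\<in>C. (\<Sum>t\<in>T. v t * M t u) = 0"
  shows "\<exists>J\<subseteq>C. card J < card T \<and>
    (\<forall>a. (\<forall>u\<in>J. (\<Sum>t\<in>T. a t * M t u) = 0) \<longrightarrow> (\<forall>u\<in>C. (\<Sum>t\<in>T. a t * M t u) = 0))"
proof -
  define K where "K J a \<longleftrightarrow> (\<forall>u\<in>J. (\<Sum>t\<in>T. a t * M t u) = 0)" for J a
  define P where "P J \<longleftrightarrow> J \<subseteq> C \<and> (\<forall>a. K J a \<longrightarrow> K C a)" for J
  have "P C" by (auto simp: P_def)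
  from ex_has_least_nat[of P C card, OF this]
  obtain J where J: "P J" and least: "\<And>J'. P J' \<Longrightarrow> card J \<le> card J'" by blast
  have JC: "J \<subseteq> C" and fJ: "finite J" using J fC finite_subset by (auto simp: P_def)
  have "\<exists>a. K (J - {j}) a \<and> (\<Sum>t\<in>T. a t * M t j) \<noteq> 0" if "j \<in> J" for j
  proof -
    have "\<not> P (J - {j})" using least[of "J - {j}"] card_Diff1_less[OF fJ that] by linarith
    then obtain a where a: "K (J - {j}) a" "\<not> K C a" using JC by (auto simp: P_def)
    then have "\<not> K J a" using J by (auto simp: P_def)
    then show ?thesis using a(1) by (intro exI[of _ a]) (auto simp: K_def)
  qed
  then obtain w where w: "\<And>j. j \<in> J \<Longrightarrow> K (J - {j}) (w j)"
    "\<And>j. j \<in> J \<Longrightarrow> (\<Sum>t\<in>T. w j t * M t j) \<noteq> 0" by metis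
  have "card J < card T"
  proof (rule ccontr)
    assume "\<not> card J < card T"
    define I where "I = insert None (Some ` J)"
    define N where "N x = (case x of None \<Rightarrow> v | Some j \<Rightarrow> w j)" for x
    have fI: "finite I" using fJ by (simp add: I_def)
    have "card I = Suc (card J)" using fJ by (simp add: I_def card_image)
    then have "card T < card I" using \<open>\<not> card J < card T\<close> by simp
    from underdetermined_system[OF fT fI this, of N]
    obtain \<beta> where \<beta>: "\<exists>x\<in>I. \<beta> x \<noteq> 0" "\<And>t. t \<in> T \<Longrightarrow> (\<Sum>x\<in>I. \<beta> x * N x t) = 0" by blast
    have some0: "\<beta> (Some j) = 0" if j: "j \<in> J" for j
    proof -
      have "0 = (\<Sum>t\<in>T. (\<Sum>x\<in>I. \<beta> x * N x t) * M t j)" using \<beta>(2) by simp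
      also have "\<dots> = (\<Sum>x\<in>I. \<beta> x * (\<Sum>t\<in>T. N x t * M t j))"
        unfolding sum_distrib_right sum_distrib_left by (subst sum.swap) (simp add: mult.assoc)
      also have "\<dots> = (\<Sum>x\<in>I. if x = Some j then \<beta> x * (\<Sum>t\<in>T. w j t * M t j) else 0)"
      proof (rule sum.cong)
        fix x assume x: "x \<in> I"
        show "\<beta> x * (\<Sum>t\<in>T. N x t * M t j) = (if x = Some j then \<beta> x * (\<Sum>t\<in>T. w j t * M t j) else 0)"
        proof (cases x)
          case None
          then show ?thesis using v(2) j JC by (auto simp: N_def)
        next
          case (Some i)
          then show ?thesis using x w(1)[of i] j by (auto simp: N_def I_def K_def)
        qed
      qed simp
      also have "\<dots> = \<beta> (Some j) * (\<Sum>t\<in>T. w j t * M t j)" using j fI by (simp add: I_def)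
      finally show ?thesis using w(2)[OF j] by simp
    qed
    then have n0: "\<beta> None \<noteq> 0" using \<beta>(1) by (auto simp: I_def)
    obtain t where t: "t \<in> T" "v t \<noteq> 0" using v by blast
    have "(\<Sum>x\<in>I. \<beta> x * N x t) = \<beta> None * v t"
      using fJ some0 by (simp add: I_def N_def sum.reindex)
    then show False using \<beta>(2)[OF t(1)] n0 t(2) by simp
  qed
  then show ?thesis using J unfolding P_def K_def by blast
qed

text \<open>Rows are added one at a time. If \<open>w\<close> obstructs the old system but not the
  new row \<open>s\<close>, subtracting \<open>\<gamma>\<close> times that row from \<open>b\<close>
  makes the right-hand side orthogonal to \<open>w\<close>. If a second obstruction
  \<open>w'\<close> remains, subtracting a multiple of \<open>w\<close> makes it orthogonal to row
  \<open>s\<close> as well, without changing its pairing with the reduced right-hand side.\<close>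

lemma fredholm_alternative:
  fixes M :: "'i \<Rightarrow> 'j \<Rightarrow> 'a :: field"
  assumes "finite T" "finite C"
  shows "(\<exists>u. \<forall>c\<in>C. (\<Sum>t\<in>T. u t * M t c) = b c) \<or>
    (\<exists>w. (\<forall>t\<in>T. (\<Sum>c\<in>C. M t c * w c) = 0) \<and> (\<Sum>c\<in>C. b c * w c) \<noteq> 0)"
  using assms(1)
proof (induction T arbitrary: b rule: finite_induct)
  case empty
  show ?case
  proof (cases "\<forall>c\<in>C. b c = 0")
    case False
    then obtain c0 where c0: "c0 \<in> C" "b c0 \<noteq> 0" by blast
    have "(\<Sum>c\<in>C. b c * (if c = c0 then 1 else 0)) = (\<Sum>c\<in>C. if c = c0 then b c else 0)"
      by (intro sum.cong) auto
    also have "\<dots> = b c0" using c0 assms(2) by simp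
    finally have "(\<Sum>c\<in>C. b c * (if c = c0 then 1 else 0)) = b c0" .
    then show ?thesis using c0 by (intro disjI2 exI[of _ "\<lambda>c. if c = c0 then 1 else 0"]) simp
  qed simp
next
  case (insert s T)
  consider (sol) u where "\<forall>c\<in>C. (\<Sum>t\<in>T. u t * M t c) = b c"
    | (alt) w where "\<forall>t\<in>T. (\<Sum>c\<in>C. M t c * w c) = 0" "(\<Sum>c\<in>C. b c * w c) \<noteq> 0"
    using insert.IH[of b] by blast
  then show ?case
  proof cases
    case sol
    have "(\<Sum>t\<in>T. (u(s := 0)) t * M t c) = (\<Sum>t\<in>T. u t * M t c)" for c
      using insert by (intro sum.cong) auto
    then show ?thesis using sol insert by (intro disjI1 exI[of _ "u(s := 0)"]) simp
  next
    case alt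
    define m where "m = (\<Sum>c\<in>C. M s c * w c)"
    show ?thesis
    proof (cases "m = 0")
      case True
      then show ?thesis using alt by (intro disjI2 exI[of _ w]) (auto simp: m_def)
    next
      case False
      define \<gamma> where "\<gamma> = (\<Sum>c\<in>C. b c * w c) / m"
      consider (sol') u where "\<forall>c\<in>C. (\<Sum>t\<in>T. u t * M t c) = b c - \<gamma> * M s c"
        | (alt') w' where "\<forall>t\<in>T. (\<Sum>c\<in>C. M t c * w' c) = 0" "(\<Sum>c\<in>C. (b c - \<gamma> * M s c) * w' c) \<noteq> 0"
        using insert.IH[of "\<lambda>c. b c - \<gamma> * M s c"] by blast
      then show ?thesis
      proof cases
        case sol'
        have "(\<Sum>t\<in>T. (u(s := \<gamma>)) t * M t c) = (\<Sum>t\<in>T. u t * M t c)" for c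
          using insert by (intro sum.cong) auto
        then show ?thesis using sol' insert by (intro disjI1 exI[of _ "u(s := \<gamma>)"]) simp
      next
        case alt'
        define m' where "m' = (\<Sum>c\<in>C. M s c * w' c)"
        define w'' where "w'' c = w' c - m' / m * w c" for c
        have lin: "(\<Sum>c\<in>C. f c * w'' c) = (\<Sum>c\<in>C. f c * w' c) - m' / m * (\<Sum>c\<in>C. f c * w c)" for f
          by (simp add: w''_def algebra_simps sum_subtractf sum_distrib_left)
        have "(\<Sum>c\<in>C. b c * w'' c) = (\<Sum>c\<in>C. (b c - \<gamma> * M s c) * w' c)"
        proof -
          have "(\<Sum>c\<in>C. (b c - \<gamma> * M s c) * w' c) = (\<Sum>c\<in>C. b c * w' c) - \<gamma> * m'"
            by (simp add: m'_def algebra_simps sum_subtractf sum_distrib_left)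
          then show ?thesis unfolding lin by (simp add: \<gamma>_def)
        qed
        moreover have "(\<Sum>c\<in>C. M s c * w'' c) = 0"
          unfolding lin using False by (simp add: m'_def m_def)
        moreover have "\<forall>t\<in>T. (\<Sum>c\<in>C. M t c * w'' c) = 0"
          unfolding lin using alt alt' by simp
        ultimately show ?thesis using alt' by (intro disjI2 exI[of _ w'']) auto
      qed
    qed
  qed
qed

section \<open>Kernel vectors of minimal support\<close>

definition left_kernel :: "nat set \<Rightarrow> (nat \<Rightarrow> nat \<Rightarrow> complex) \<Rightarrow> (nat \<Rightarrow> complex) \<Rightarrow> bool" where
  "left_kernel V M v \<longleftrightarrow> (\<forall>u\<in>V. (\<Sum>t\<in>V. v t * M t u) = 0)"

definition supp :: "nat set \<Rightarrow> (nat \<Rightarrow> complex) \<Rightarrow> nat set" where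
  "supp V v = {t\<in>V. v t \<noteq> 0}"

definition circuit :: "nat set \<Rightarrow> (nat \<Rightarrow> nat \<Rightarrow> complex) \<Rightarrow> (nat \<Rightarrow> complex) \<Rightarrow> bool" where
  "circuit V M v \<longleftrightarrow> left_kernel V M v \<and> supp V v \<noteq> {} \<and>
     (\<forall>w. left_kernel V M w \<and> supp V w \<subset> supp V v \<longrightarrow> supp V w = {})"

lemma supp_subset: "supp V v \<subseteq> V"
  by (auto simp: supp_def)

lemma sum_supp:
  assumes "finite V" "supp V v \<subseteq> T" "T \<subseteq> V"
  shows "(\<Sum>t\<in>V. v t * f t) = (\<Sum>t\<in>T. v t * f t)"
  using assms by (intro sum.mono_neutral_right) (auto simp: supp_def)

lemma left_kernel_diff:
  "left_kernel V M v \<Longrightarrow> left_kernel V M w \<Longrightarrow> left_kernel V M (\<lambda>t. v t - c * w t)"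
proof -
  have "(\<Sum>t\<in>V. (v t - c * w t) * M t u) = (\<Sum>t\<in>V. v t * M t u) - c * (\<Sum>t\<in>V. w t * M t u)" for u
    by (simp add: algebra_simps sum_subtractf sum_distrib_left)
  then show "left_kernel V M v \<Longrightarrow> left_kernel V M w \<Longrightarrow> left_kernel V M (\<lambda>t. v t - c * w t)"
    by (simp add: left_kernel_def)
qed

text \<open>Descent on the size of the support that never loses \<open>j\<close>. If a kernel vector
  \<open>w\<close> of smaller support contains \<open>j\<close>, continue with \<open>w\<close>;
  otherwise subtracting a multiple of \<open>w\<close> cancels a coordinate \<open>t\<close> while
  leaving the value at \<open>j\<close> alone.\<close>

lemma exists_circuit:
  assumes fin: "finite V" and "left_kernel V M v" "j \<in> supp V v"
  shows "\<exists>v'. circuit V M v' \<and> supp V v' \<subseteq> supp V v \<and> j \<in> supp V v'"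
  using assms(2,3)
proof (induction "card (supp V v)" arbitrary: v rule: less_induct)
  case less
  have fs: "finite (supp V v)" for v using fin by (simp add: supp_def)
  show ?case
  proof (cases "circuit V M v")
    case True
    then show ?thesis using less by blast
  next
    case False
    then obtain w where w: "left_kernel V M w" "supp V w \<subset> supp V v" "supp V w \<noteq> {}"
      using less unfolding circuit_def by blast
    show ?thesis
    proof (cases "j \<in> supp V w")
      case True
      have "card (supp V w) < card (supp V v)" using w fs by (simp add: psubset_card_mono)
      from less.hyps[OF this w(1) True] show ?thesis using w by blast
    next
      case False
      obtain t where t: "t \<in> supp V w" using w by blast
      define v' where "v' = (\<lambda>s. v s - v t / w t * w s)"
      have "left_kernel V M v'" unfolding v'_def by (intro left_kernel_diff less w)
      moreover have sub: "supp V v' \<subseteq> supp V v - {t}"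
      proof
        fix s assume s: "s \<in> supp V v'"
        then have "s \<noteq> t" using t by (auto simp: v'_def supp_def)
        moreover have "s \<in> supp V v"
        proof (rule ccontr)
          assume "s \<notin> supp V v"
          then have "s \<notin> supp V w" using w by blast
          then show False using s \<open>s \<notin> supp V v\<close> by (auto simp: supp_def v'_def)
        qed
        ultimately show "s \<in> supp V v - {t}" by simp
      qed
      moreover have "j \<in> supp V v'" using less.prems(2) False by (auto simp: supp_def v'_def)
      moreover have "card (supp V v') < card (supp V v)"
      proof -
        have "t \<in> supp V v" using t w by blast
        then have "supp V v' \<subset> supp V v" using sub by blast
        then show ?thesis using fs by (simp add: psubset_card_mono)
      qed
      ultimately show ?thesis using less.hyps[of v'] by blast
    qed
  qed
qed

section \<open>Columns met once and columns met repeatedly\<close>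

definition degree_in :: "(nat \<Rightarrow> nat \<Rightarrow> complex) \<Rightarrow> nat set \<Rightarrow> nat \<Rightarrow> nat" where
  "degree_in M T u = card {t\<in>T. M t u \<noteq> 0}"

definition single_cols :: "nat set \<Rightarrow> (nat \<Rightarrow> nat \<Rightarrow> complex) \<Rightarrow> nat set \<Rightarrow> nat set" where
  "single_cols V M T = {u\<in>V. degree_in M T u = 1}"

definition double_cols :: "nat set \<Rightarrow> (nat \<Rightarrow> nat \<Rightarrow> complex) \<Rightarrow> nat set \<Rightarrow> nat set" where
  "double_cols V M T = {u\<in>V. degree_in M T u \<ge> 2}"

text \<open>Allowing one exceptional column \<open>j\<close> covers both the circuits and the supports of the
  solutions of \<open>u M = e\<^sub>j\<close>.\<close>

definition nearly_dependent :: "nat set \<Rightarrow> (nat \<Rightarrow> nat \<Rightarrow> complex) \<Rightarrow> nat set \<Rightarrow> bool" where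
  "nearly_dependent V M T \<longleftrightarrow>
     (\<exists>v. (\<forall>t\<in>T. v t \<noteq> 0) \<and> (\<exists>j\<in>V. \<forall>u\<in>V - {j}. (\<Sum>t\<in>T. v t * M t u) = 0))"

text \<open>The tolerance of one singly touched column matches the exceptional column in
  \<open>nearly_dependent\<close>.\<close>

definition covers_sparsely :: "nat set \<Rightarrow> (nat \<Rightarrow> nat \<Rightarrow> complex) \<Rightarrow> nat set \<Rightarrow> nat \<Rightarrow> bool" where
  "covers_sparsely V M T r \<longleftrightarrow> card (single_cols V M T) \<le> 1 \<and> r \<le> card (double_cols V M T)"

lemma single_col_sum_nonzero:
  assumes "finite T" "\<forall>t\<in>T. v t \<noteq> 0" "degree_in M T u = 1"
  shows "(\<Sum>t\<in>T. v t * M t u) \<noteq> 0"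
proof -
  obtain t where t: "{t\<in>T. M t u \<noteq> 0} = {t}"
    using assms(3) unfolding degree_in_def by (auto simp: card_1_singleton_iff)
  have "(\<Sum>t\<in>T. v t * M t u) = (\<Sum>t\<in>{t\<in>T. M t u \<noteq> 0}. v t * M t u)"
    using assms by (intro sum.mono_neutral_right) auto
  also have "\<dots> = v t * M t u" using t by simp
  finally show ?thesis using t assms by auto
qed

lemma nearly_dependent_single_cols:
  assumes "finite V" "finite T" "nearly_dependent V M T"
  shows "card (single_cols V M T) \<le> 1"
proof -
  obtain v j where "\<forall>t\<in>T. v t \<noteq> 0" "j \<in> V" "\<forall>u\<in>V - {j}. (\<Sum>t\<in>T. v t * M t u) = 0"
    using assms unfolding nearly_dependent_def by blast
  then have "single_cols V M T \<subseteq> {j}"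
    using single_col_sum_nonzero[OF assms(2), of v M] by (auto simp: single_cols_def)
  then show ?thesis using card_mono[of "{j}"] by auto
qed

lemma touched_cols:
  assumes "finite V" "finite T"
  shows "card {u\<in>V. \<exists>t\<in>T. M t u \<noteq> 0} = card (single_cols V M T) + card (double_cols V M T)"
proof -
  have "{u\<in>V. \<exists>t\<in>T. M t u \<noteq> 0} = single_cols V M T \<union> double_cols V M T"
  proof -
    have "(\<exists>t\<in>T. M t u \<noteq> 0) \<longleftrightarrow> degree_in M T u \<noteq> 0" for u
      using assms by (auto simp: degree_in_def)
    then show ?thesis by (auto simp: single_cols_def double_cols_def)
  qed
  moreover have "single_cols V M T \<inter> double_cols V M T = {}"
    by (auto simp: single_cols_def double_cols_def)
  ultimately show ?thesis
    using assms by (simp add: card_Un_disjoint single_cols_def double_cols_def)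
qed

lemma few_touched_cols:
  assumes fin: "finite V" and T: "T \<subseteq> V" "card {u\<in>V. \<exists>t\<in>T. M t u \<noteq> 0} < card T"
  shows "\<exists>w. left_kernel V M w \<and> supp V w \<subseteq> T \<and> supp V w \<noteq> {}"
proof -
  let ?C = "{u\<in>V. \<exists>t\<in>T. M t u \<noteq> 0}"
  have fT: "finite T" using T fin finite_subset by blast
  obtain a where a: "\<exists>i\<in>T. a i \<noteq> 0" "\<forall>i. i \<notin> T \<longrightarrow> a i = 0" "\<forall>j\<in>?C. (\<Sum>i\<in>T. a i * M i j) = 0"
    using underdetermined_system[OF _ fT T(2), of M] fin by auto
  have sub: "supp V a \<subseteq> T" using a by (auto simp: supp_def)
  have "(\<Sum>i\<in>V. a i * M i j) = 0" if "j \<in> V" for j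
    unfolding sum_supp[OF fin sub T(1)] using a(3) that by (cases "j \<in> ?C") auto
  then show ?thesis using a sub T by (intro exI[of _ a]) (auto simp: left_kernel_def supp_def)
qed

text \<open>A column touched once would contribute a single nonzero term. If fewer than
  \<open>card T - 1\<close> columns were touched, the rows of \<open>T\<close> without
  \<open>t0\<close> would already be dependent, against minimality; so all of the at least
  \<open>card T - 1\<close> touched columns are touched twice.\<close>

lemma circuit_properties:
  assumes fin: "finite V" and v: "circuit V M v"
  defines "T \<equiv> supp V v"
  shows "nearly_dependent V M T" "single_cols V M T = {}" "covers_sparsely V M T (card T - 1)"
proof -
  have fT: "finite T" and TV: "T \<subseteq> V" using fin by (auto simp: T_def supp_def)
  have k: "(\<Sum>t\<in>T. v t * M t u) = 0" if "u \<in> V" for u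
    using v that sum_supp[OF fin, of v T "\<lambda>t. M t u"] TV
    by (auto simp: circuit_def left_kernel_def T_def)
  have nz: "\<forall>t\<in>T. v t \<noteq> 0" by (auto simp: T_def supp_def)
  obtain j where "j \<in> V" using v by (auto simp: circuit_def supp_def)
  then show nd: "nearly_dependent V M T"
    unfolding nearly_dependent_def using k nz by (intro exI[of _ v] conjI bexI[of _ j]) auto
  show sc: "single_cols V M T = {}"
    using single_col_sum_nonzero[OF fT nz] k by (auto simp: single_cols_def)
  have "card T - 1 \<le> card (double_cols V M T)"
  proof (rule ccontr)
    assume *: "\<not> card T - 1 \<le> card (double_cols V M T)"
    obtain t0 where t0: "t0 \<in> T" using v by (auto simp: circuit_def T_def)
    define T' where "T' = T - {t0}"
    have cT': "card T' = card T - 1" using t0 fT by (simp add: T'_def)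
    have "card {u\<in>V. \<exists>t\<in>T'. M t u \<noteq> 0} \<le> card {u\<in>V. \<exists>t\<in>T. M t u \<noteq> 0}"
      using fin by (intro card_mono) (auto simp: T'_def)
    also have "\<dots> < card T'" using * cT' touched_cols[OF fin fT, of M] sc by simp
    finally obtain w where "left_kernel V M w" "supp V w \<subseteq> T'" "supp V w \<noteq> {}"
      using few_touched_cols[OF fin, of T' M] TV by (auto simp: T'_def)
    moreover from this have "supp V w \<subset> supp V v" using t0 by (auto simp: T'_def T_def)
    ultimately show False using v unfolding circuit_def by blast
  qed
  then show "covers_sparsely V M T (card T - 1)" using sc by (simp add: covers_sparsely_def)
qed

lemma dependent_rows_few_cols:
  assumes fin: "finite V" "finite T" and "single_cols V M T = {}" and "\<not> covers_sparsely V M T (card T)"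
  shows "card {u\<in>V. \<exists>t\<in>T. M t u \<noteq> 0} < card T"
  using assms touched_cols[OF fin, of M] by (simp add: covers_sparsely_def)

text \<open>Symmetry makes such a \<open>u\<close> play the role of column \<open>j\<close> of the possibly
  nonexistent inverse of \<open>M\<close>.\<close>

definition solves_unit :: "nat set \<Rightarrow> (nat \<Rightarrow> nat \<Rightarrow> complex) \<Rightarrow> nat \<Rightarrow> (nat \<Rightarrow> complex) \<Rightarrow> bool" where
  "solves_unit V M j u \<longleftrightarrow> (\<forall>t\<in>V. (\<Sum>s\<in>V. u s * M s t) = (if t = j then 1 else 0))"

lemma exists_solves_unit:
  assumes fin: "finite V" and sym: "\<And>s t. s \<in> V \<Longrightarrow> t \<in> V \<Longrightarrow> M s t = M t s" and j: "j \<in> V"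
    and ker: "\<And>v. left_kernel V M v \<Longrightarrow> v j = 0"
  shows "\<exists>u. solves_unit V M j u"
proof (rule ccontr)
  assume "\<nexists>u. solves_unit V M j u"
  then obtain w where w: "\<forall>t\<in>V. (\<Sum>c\<in>V. M t c * w c) = 0" "(\<Sum>c\<in>V. (if c = j then 1 else 0) * w c) \<noteq> 0"
    using fredholm_alternative[OF fin fin, of M "\<lambda>t. if t = j then 1 else 0"]
    unfolding solves_unit_def by blast
  have "(\<Sum>t\<in>V. w t * M t u) = (\<Sum>c\<in>V. M u c * w c)" if "u \<in> V" for u
    using sym that by (intro sum.cong) auto
  then have "left_kernel V M w" using w by (simp add: left_kernel_def)
  moreover have "(\<Sum>c\<in>V. (if c = j then 1 else 0) * w c) = w j"
    using fin j by (simp add: if_distrib[of "\<lambda>x. x * _"] cong: if_cong)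
  ultimately show False using ker w(2) by auto
qed

text \<open>A solution of smallest support is taken. If it touched fewer columns than it has rows, a
  kernel vector inside the support could be subtracted to shrink it. Only column \<open>j\<close>
  can be touched once, hence the loss of 1 in the last conclusion.\<close>

lemma exists_sparse_solves_unit:
  assumes fin: "finite V" and j: "j \<in> V" and "\<exists>u. solves_unit V M j u"
  shows "\<exists>u. solves_unit V M j u \<and> supp V u \<noteq> {} \<and> nearly_dependent V M (supp V u) \<and>
    covers_sparsely V M (supp V u) (card (supp V u) - 1)"
proof -
  obtain u where u: "solves_unit V M j u" and least: "\<And>u'. solves_unit V M j u' \<Longrightarrow> card (supp V u) \<le> card (supp V u')"
    using ex_has_least_nat[of "solves_unit V M j" _ "\<lambda>u. card (supp V u)"] assms(3) by blast
  define T where "T = supp V u"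
  have fT: "finite T" and TV: "T \<subseteq> V" using fin by (auto simp: T_def supp_def)
  have sum_T: "(\<Sum>s\<in>V. u s * M s t) = (\<Sum>s\<in>T. u s * M s t)" for t
    by (rule sum_supp[OF fin]) (use TV in \<open>auto simp: T_def\<close>)
  have nz: "\<forall>t\<in>T. u t \<noteq> 0" by (auto simp: T_def supp_def)
  have ne: "T \<noteq> {}" using u j sum_T[of j] by (auto simp: solves_unit_def)
  have nd: "nearly_dependent V M T"
    unfolding nearly_dependent_def using u nz j
    by (intro exI[of _ u] conjI bexI[of _ j]) (auto simp: sum_T[symmetric] solves_unit_def)
  have "card T \<le> card {u\<in>V. \<exists>t\<in>T. M t u \<noteq> 0}"
  proof (rule ccontr)
    assume "\<not> ?thesis"
    then obtain w where w: "left_kernel V M w" "supp V w \<subseteq> T" "supp V w \<noteq> {}"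
      using few_touched_cols[OF fin TV, of M] by auto
    then obtain t where t: "t \<in> supp V w" by blast
    define u' where "u' = (\<lambda>s. u s - u t / w t * w s)"
    have "(\<Sum>s\<in>V. u' s * M s r) = (\<Sum>s\<in>V. u s * M s r) - u t / w t * (\<Sum>s\<in>V. w s * M s r)" for r
      by (simp add: u'_def algebra_simps sum_subtractf sum_distrib_left)
    then have "solves_unit V M j u'" using u w by (simp add: solves_unit_def left_kernel_def)
    from least[OF this] have "card T \<le> card (supp V u')" by (simp add: T_def)
    moreover have "supp V u' \<subset> T"
    proof -
      have "supp V u' \<subseteq> T" using w(2) by (auto simp: u'_def supp_def T_def)
      moreover have "t \<in> T - supp V u'" using t w(2) by (auto simp: u'_def supp_def T_def)
      ultimately show ?thesis by blast
    qed
    ultimately show False using fT psubset_card_mono by (metis not_less)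
  qed
  moreover have sc: "card (single_cols V M T) \<le> 1" by (rule nearly_dependent_single_cols[OF fin fT nd])
  ultimately have "covers_sparsely V M T (card T - 1)"
    using touched_cols[OF fin fT, of M] by (simp add: covers_sparsely_def)
  then show ?thesis using u nd ne unfolding T_def by blast
qed

text \<open>Solutions for different unit vectors are linearly independent, because multiplying a
  relation by \<open>M\<close> reads off its coefficients; so at most \<open>card Z\<close> of them
  fit into coordinates \<open>Z\<close>.\<close>

lemma card_solves_unit_le:
  assumes fin: "finite V" and G: "G \<subseteq> V" and Z: "Z \<subseteq> V"
    and u: "\<And>j. j \<in> G \<Longrightarrow> solves_unit V M j (u j)" "\<And>j. j \<in> G \<Longrightarrow> supp V (u j) \<subseteq> Z"
  shows "card G \<le> card Z"
proof (rule ccontr)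
  assume "\<not> card G \<le> card Z"
  have fG: "finite G" and fZ: "finite Z" using fin G Z finite_subset by blast+
  obtain a where a: "\<exists>i\<in>G. a i \<noteq> 0" "\<forall>s\<in>Z. (\<Sum>i\<in>G. a i * u i s) = 0"
    using underdetermined_system[OF fZ fG, of u] \<open>\<not> card G \<le> card Z\<close> by auto
  obtain t where t: "t \<in> G" "a t \<noteq> 0" using a by blast
  have z: "(\<Sum>i\<in>G. a i * u i s) = 0" if "s \<in> V" for s
  proof (cases "s \<in> Z")
    case False
    then have "\<forall>i\<in>G. u i s = 0" using u(2) that by (auto simp: supp_def)
    then show ?thesis by simp
  qed (use a in auto)
  have "0 = (\<Sum>s\<in>V. (\<Sum>i\<in>G. a i * u i s) * M s t)" using z by simp
  also have "\<dots> = (\<Sum>i\<in>G. a i * (\<Sum>s\<in>V. u i s * M s t))"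
    unfolding sum_distrib_right sum_distrib_left by (subst sum.swap) (simp add: mult.assoc)
  also have "\<dots> = (\<Sum>i\<in>G. if i = t then a i else 0)"
  proof (rule sum.cong)
    fix i assume i: "i \<in> G"
    have "t \<in> V" using t G by blast
    then have "(\<Sum>s\<in>V. u i s * M s t) = (if t = i then 1 else 0)"
      using u(1)[OF i] by (simp add: solves_unit_def)
    then show "a i * (\<Sum>s\<in>V. u i s * M s t) = (if i = t then a i else 0)" by auto
  qed simp
  also have "\<dots> = a t" using t fG by simp
  finally show False using t by simp
qed


section \<open>Probability of a sparse dependency\<close>

lemma prob_bern_sum_eq_le_small:
  fixes c :: "'a \<Rightarrow> complex"
  assumes fin: "finite A" and p: "0 < p" "p \<le> 1/2" and nz: "\<And>t. t \<in> A \<Longrightarrow> c t \<noteq> 0"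
    and A: "real (card A) * p \<le> 1"
  shows "prob (bern A p) {x. (\<Sum>t\<in>A. c t * of_bool (x t)) = z} \<le> 1 - real (card A) * p / 4"
proof -
  \<comment> \<open>A number of ones that rules out the value \<open>z\<close>: exactly one summand
    is never 0, and no summand at all gives 0. Either count has probability at least
    \<open>card A * p / 4\<close>.\<close>
  define l :: nat where "l = (if z = 0 then 1 else 0)"
  have sub: "(\<Sum>t\<in>A. c t * of_bool (x t)) \<noteq> z" if x: "card {e\<in>A. x e} = l" for x
  proof -
    have *: "(\<Sum>t\<in>A. c t * of_bool (x t)) = (\<Sum>t\<in>{e\<in>A. x e}. c t)"
      using fin by (intro sum.mono_neutral_cong_right) auto
    show ?thesis
    proof (cases "z = 0")
      case True
      then obtain e where e: "{e\<in>A. x e} = {e}" using x by (auto simp: l_def card_1_singleton_iff)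
      then have "e \<in> A" by auto
      then show ?thesis using True nz unfolding * e by simp
    next
      case False
      then have e: "{e\<in>A. x e} = {}" using x fin by (simp add: l_def)
      show ?thesis using False unfolding * e by simp
    qed
  qed
  have "prob (bern A p) {x. (\<Sum>t\<in>A. c t * of_bool (x t)) = z} \<le>
      prob (bern A p) (UNIV - {x. card {e\<in>A. x e} = l})"
    using sub by (intro measure_pmf.finite_measure_mono) auto
  also have "\<dots> = 1 - prob (bern A p) {x. card {e\<in>A. x e} = l}"
    using measure_pmf.prob_compl[of "{x. card {e\<in>A. x e} = l}" "bern A p"] by simp
  finally have upper: "prob (bern A p) {x. (\<Sum>t\<in>A. c t * of_bool (x t)) = z} \<le>
      1 - prob (bern A p) {x. card {e\<in>A. x e} = l}" .
  have "prob (bern A p) {x. card {e\<in>A. x e} = l} \<ge> real (card A) * p / 4"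
  proof (cases "z = 0")
    case True
    have "real (card A - 1) * p \<le> real (card A) * p" using p by (intro mult_right_mono) auto
    then have "real (card A - 1) * p \<le> 1" using A by linarith
    then have "(1 - p) ^ (card A - 1) \<ge> 1/4" using p by (intro power_one_minus_ge) auto
    from mult_left_mono[OF this, of "real (card A) * p"] show ?thesis
      using True p fin by (simp add: l_def prob_bern_card_eq)
  next
    case False
    have "(1 - p) ^ card A \<ge> 1/4" using p A by (intro power_one_minus_ge) auto
    moreover have "prob (bern A p) {x. card {e\<in>A. x e} = l} = (1 - p) ^ card A"
      by (subst prob_bern_card_eq) (use False p fin in \<open>auto simp: l_def\<close>)
    ultimately show ?thesis using A by linarith
  qed
  then show ?thesis using upper by linarith
qed

definition atom_bound :: "nat \<Rightarrow> real \<Rightarrow> real" where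
  "atom_bound k p = 1 - min (real k * p) 1 / 8"

lemma atom_bound_nonneg: "atom_bound k p \<ge> 0" and atom_bound_le_exp: "atom_bound k p \<le> exp (- min (real k * p) 1 / 8)"
  using exp_ge_add_one_self[of "- min (real k * p) 1 / 8"] by (auto simp: atom_bound_def)

text \<open>Only about \<open>min (card A) (1 / p)\<close> of the variables are kept random, which
  reduces to the case of expected number of ones at most 1. Rounding \<open>1 / p\<close> down costs
  a factor 2, which turns the 4 of that case into the 8 of \<open>atom_bound\<close>.\<close>

lemma prob_bern_sum_eq_le:
  fixes c :: "'a \<Rightarrow> complex"
  assumes fin: "finite A" and p: "0 < p" "p \<le> 1/2" and nz: "\<And>t. t \<in> A \<Longrightarrow> c t \<noteq> 0"
  shows "prob (bern A p) {x. (\<Sum>t\<in>A. c t * of_bool (x t)) = z} \<le> atom_bound (card A) p"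
proof -
  define m where "m = min (card A) (nat \<lfloor>1 / p\<rfloor>)"
  have m: "real m * p \<le> 1" "real m * p \<ge> min (real (card A) * p) 1 / 2"
  proof -
    have "real m \<le> real (nat \<lfloor>1 / p\<rfloor>)" unfolding m_def by simp
    also have "\<dots> \<le> 1 / p" using p by (intro of_nat_floor) auto
    finally have "real m \<le> 1 / p" .
    then show "real m * p \<le> 1" using p mult_right_mono[of "real m" "1 / p" p] by simp
    show "real m * p \<ge> min (real (card A) * p) 1 / 2"
    proof (cases "card A \<le> nat \<lfloor>1 / p\<rfloor>")
      case True
      then have "m = card A" by (simp add: m_def)
      then show ?thesis using p by (auto simp: min_def)
    next
      case False
      then have "real m \<ge> 1 / p - 1" unfolding m_def by linarith
      then have "real m * p \<ge> (1 / p - 1) * p" using p by (intro mult_right_mono) auto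
      moreover have "(1 / p - 1) * p = 1 - p" using p by (simp add: field_simps)
      moreover have "min (real (card A) * p) 1 \<le> 1" by simp
      ultimately show ?thesis using p by linarith
    qed
  qed
  obtain D where D: "D \<subseteq> A" "card D = m"
    using obtain_subset_with_card_n[of m A] by (auto simp: m_def)
  have fD: "finite D" using D fin finite_subset by auto
  have "prob (bern A p) {x. (\<Sum>t\<in>A. c t * of_bool (x t)) = z} \<le> 1 - real m * p / 4"
  proof (rule prob_cond[OF fin D(1)])
    fix f
    have "{g. (\<Sum>t\<in>A. c t * of_bool (override_on f g D t)) = z} =
        {g. (\<Sum>t\<in>D. c t * of_bool (g t)) = z - (\<Sum>t\<in>A - D. c t * of_bool (f t))}"
      by (auto simp: sum_of_bool_override[OF fin D(1)] algebra_simps)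
    then show "prob (bern D p) {g. (\<Sum>t\<in>A. c t * of_bool (override_on f g D t)) = z} \<le> 1 - real m * p / 4"
      using prob_bern_sum_eq_le_small[OF fD p, of c] nz D m by auto
  qed (use m in auto)
  also have "\<dots> \<le> atom_bound (card A) p" using m by (simp add: atom_bound_def)
  finally show ?thesis .
qed

lemma sum_the_inv_into:
  assumes "inj_on h T"
  shows "(\<Sum>t\<in>T. c t * of_bool (g (h t))) = (\<Sum>e\<in>h ` T. c (the_inv_into T h e) * of_bool (g e))"
  using assms by (simp add: sum.reindex the_inv_into_f_f)

section \<open>The independent entries of a symmetric matrix\<close>

definition edge :: "nat \<Rightarrow> nat \<Rightarrow> nat \<times> nat" where
  "edge t u = (min t u, max t u)"

definition edges :: "nat \<Rightarrow> (nat \<times> nat) set" where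
  "edges n = {(i, j). i \<le> j \<and> j < n}"

definition wmat :: "(nat \<Rightarrow> nat \<Rightarrow> complex) \<Rightarrow> (nat \<times> nat \<Rightarrow> bool) \<Rightarrow> nat \<Rightarrow> nat \<Rightarrow> complex" where
  "wmat w \<xi> t u = w t u * of_bool (\<xi> (edge t u))"

lemma finite_edges [simp]: "finite (edges n)"
  by (rule finite_subset[of _ "{..<n} \<times> {..<n}"]) (auto simp: edges_def)

lemma edge_in_edges: "t < n \<Longrightarrow> u < n \<Longrightarrow> edge t u \<in> edges n"
  by (auto simp: edge_def edges_def)

lemma edge_eq_iff: "edge t u = edge t' u' \<longleftrightarrow> t = t' \<and> u = u' \<or> t = u' \<and> u = t'"
  by (auto simp: edge_def min_def max_def)

lemma inj_edge: "inj_on (\<lambda>t. edge t u) T"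
  by (auto simp: inj_on_def edge_eq_iff)

definition col_edges :: "nat set \<Rightarrow> nat \<Rightarrow> (nat \<times> nat) set" where
  "col_edges T u = (\<lambda>t. edge t u) ` T"

lemma card_col_edges: "card (col_edges T u) = card T"
  unfolding col_edges_def by (rule card_image[OF inj_edge])

lemma edge_in_col_edges [simp]: "t \<in> T \<Longrightarrow> edge t u \<in> col_edges T u"
  by (auto simp: col_edges_def)

lemma edge_notin_col_edges: "t \<in> T \<Longrightarrow> u \<noteq> u' \<Longrightarrow> u' \<notin> T \<Longrightarrow> edge t u \<notin> col_edges T u'"
  by (auto simp: col_edges_def edge_eq_iff)

lemma col_edges_subset: "T \<subseteq> {..<n} \<Longrightarrow> u < n \<Longrightarrow> col_edges T u \<subseteq> edges n"
  unfolding col_edges_def by (intro image_subsetI edge_in_edges) auto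

lemma prob_col_sum_eq_le:
  fixes c :: "nat \<Rightarrow> complex"
  assumes fin: "finite T" and p: "0 < p" "p \<le> 1/2" and nz: "\<And>t. t \<in> T \<Longrightarrow> c t \<noteq> 0"
  shows "prob (bern (col_edges T u) p) {g. (\<Sum>t\<in>T. c t * of_bool (g (edge t u))) = z} \<le> atom_bound (card T) p"
proof -
  have "prob (bern (col_edges T u) p) {g. (\<Sum>t\<in>T. c t * of_bool (g (edge t u))) = z} \<le> atom_bound (card (col_edges T u)) p"
    unfolding sum_the_inv_into[OF inj_edge] col_edges_def[symmetric]
    by (rule prob_bern_sum_eq_le)
       (use fin p nz in \<open>auto simp: col_edges_def the_inv_into_f_f[OF inj_edge]\<close>)
  then show ?thesis by (simp add: card_col_edges)
qed

text \<open>Here \<open>J\<close> consists of \<open>k\<close> columns that determine the left kernel of the rows in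
  \<open>T\<close>; the chosen vector \<open>vs\<close> of that kernel depends only on \<open>J\<close>, and every
  further column is independent of it.\<close>

lemma prob_nearly_dependent_le:
  assumes V: "V \<subseteq> {..<n}" and TV: "T \<subseteq> V" "T \<noteq> {}" and p: "0 < p" "p \<le> 1/2"
    and nz: "\<And>t u. t < n \<Longrightarrow> u < n \<Longrightarrow> t \<noteq> u \<Longrightarrow> w t u \<noteq> 0"
    and N: "2 * card T + 1 \<le> card V"
  shows "prob (bern (edges n) p) {\<xi>. nearly_dependent V (wmat w \<xi>) T} \<le>
    real (card V) * (real (card V choose card T) * atom_bound (card T) p ^ (card V - 2 * card T - 1))"
proof -
  define k where "k = card T"
  have fV: "finite V" using V finite_subset by auto
  have fT: "finite T" using TV fV finite_subset by auto
  have k: "k > 0" using TV fT by (auto simp: k_def card_gt_0_iff)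
  define full where "full a \<longleftrightarrow> (\<forall>t\<in>T. a t \<noteq> (0::complex))" for a
  define kills where "kills \<xi> J a \<longleftrightarrow> (\<forall>u\<in>J. (\<Sum>t\<in>T. a t * wmat w \<xi> t u) = 0)" for \<xi> J a
  define vs where "vs \<xi> J = (SOME a. full a \<and> kills \<xi> J a)" for \<xi> J
  \<comment> \<open>Columns in \<open>T\<close> are avoided: diagonal weights may vanish there, and
    by symmetry two such columns share an entry. Outside \<open>T\<close> the blocks
    \<open>col_edges T u\<close> are disjoint.\<close>
  define \<J> where "\<J> j = {J. J \<subseteq> V - T - {j} \<and> card J = k}" for j
  define F where "F J u \<xi> \<longleftrightarrow> full (vs \<xi> J) \<and> (\<Sum>t\<in>T. vs \<xi> J t * wmat w \<xi> t u) = 0" for J u \<xi>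
  have cO: "card V - k - 1 \<le> card (V - T - {j})" for j
  proof -
    have "card (V - T) = card V - k" using TV fT by (simp add: card_Diff_subset k_def)
    moreover have "card (V - T) - 1 \<le> card (V - T - {j})" by (simp add: card_Diff_singleton_if)
    ultimately show ?thesis by linarith
  qed
  have event: "\<exists>j\<in>V. \<exists>J\<in>\<J> j. True \<and> (\<forall>u\<in>V - T - {j} - J. F J u \<xi>)" if nd: "nearly_dependent V (wmat w \<xi>) T" for \<xi>
  proof -
    obtain v j where v: "full v" and j: "j \<in> V" and z: "\<forall>u\<in>V - {j}. (\<Sum>t\<in>T. v t * wmat w \<xi> t u) = 0"
      using nd unfolding nearly_dependent_def full_def by blast
    have kv: "kills \<xi> (V - T - {j}) v" using z by (auto simp: kills_def)
    have "\<exists>t\<in>T. v t \<noteq> 0" using v TV by (auto simp: full_def)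
    from kernel_determined_by_few_columns[OF fT _ this, of "V - T - {j}" "wmat w \<xi>"]
    obtain J0 where J0: "J0 \<subseteq> V - T - {j}" "card J0 < k" "\<And>a. kills \<xi> J0 a \<Longrightarrow> kills \<xi> (V - T - {j}) a"
      using kv fV unfolding kills_def k_def by auto
    have "k \<le> card (V - T - {j})" using cO[of j] N by (simp add: k_def)
    \<comment> \<open>Fewer than \<open>k\<close> columns suffice; padding to exactly
      \<open>k\<close> makes the union bound run over sets of one size.\<close>
    then obtain J where J: "J0 \<subseteq> J" "J \<subseteq> V - T - {j}" "card J = k"
      using exists_subset_between[of J0 k "V - T - {j}"] J0 fV by auto
    have "full v \<and> kills \<xi> J v" using v kv J by (auto simp: kills_def)
    then have "full (vs \<xi> J) \<and> kills \<xi> J (vs \<xi> J)" unfolding vs_def by (rule someI[of "\<lambda>a. full a \<and> kills \<xi> J a"])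
    moreover from this have "kills \<xi> (V - T - {j}) (vs \<xi> J)" using J0(3) J(1) by (auto simp: kills_def)
    ultimately have "\<forall>u\<in>V - T - {j} - J. F J u \<xi>" by (auto simp: F_def kills_def)
    then show ?thesis using j J by (auto simp: \<J>_def)
  qed
  have vs_cong: "vs (override_on f g (col_edges T u)) J = vs f J" if "u \<notin> T" "u \<notin> J" for f g u J
  proof -
    have "wmat w (override_on f g (col_edges T u)) t u' = wmat w f t u'" if "t \<in> T" "u' \<in> J" for t u'
      using edge_notin_col_edges[of t T u' u] that \<open>u \<notin> T\<close> \<open>u \<notin> J\<close>
      by (auto simp: wmat_def override_on_def)
    then have "kills (override_on f g (col_edges T u)) J = kills f J"
      by (auto simp: kills_def fun_eq_iff)
    then show ?thesis by (simp add: vs_def)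
  qed
  have one: "prob (bern (edges n) p) {\<xi>. True \<and> (\<forall>u\<in>V - T - {j} - J. F J u \<xi>)} \<le> atom_bound k p ^ (card V - 2 * k - 1)"
    if J: "J \<in> \<J> j" for j J
  proof -
    let ?U = "V - T - {j} - J"
    have fJ: "finite J" using J fV by (auto simp: \<J>_def intro: finite_subset)
    have "prob (bern (edges n) p) {\<xi>. True \<and> (\<forall>u\<in>?U. F J u \<xi>)} \<le>
        atom_bound k p ^ card ?U * prob (bern (edges n) p) {\<xi>. True}"
    proof (rule prob_blocks[where D = "col_edges T"])
      fix u assume u: "u \<in> ?U"
      then show "col_edges T u \<subseteq> edges n"
        using V TV by (intro col_edges_subset) auto
      fix f
      show "prob (bern (col_edges T u) p) {g. F J u (override_on f g (col_edges T u))} \<le> atom_bound k p"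
      proof (cases "full (vs f J)")
        case True
        have "prob (bern (col_edges T u) p) {g. F J u (override_on f g (col_edges T u))} =
            prob (bern (col_edges T u) p) {g. (\<Sum>t\<in>T. (vs f J t * w t u) * of_bool (g (edge t u))) = 0}"
          using u True by (simp add: F_def vs_cong wmat_def mult.assoc)
        also have "\<dots> \<le> atom_bound k p"
          unfolding k_def
        proof (rule prob_col_sum_eq_le[OF fT p])
          fix t assume "t \<in> T"
          then have "w t u \<noteq> 0" using u TV V by (intro nz) auto
          then show "vs f J t * w t u \<noteq> 0" using True \<open>t \<in> T\<close> by (auto simp: full_def)
        qed
        finally show ?thesis .
      next
        case False
        then show ?thesis using u by (simp add: F_def vs_cong atom_bound_nonneg)
      qed
    next
      fix u u' f g assume u: "u \<in> ?U" "u' \<in> ?U" "u \<noteq> u'"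
      have "wmat w (override_on f g (col_edges T u)) t u' = wmat w f t u'" if "t \<in> T" for t
        using edge_notin_col_edges[of t T u' u] that u by (auto simp: wmat_def override_on_def)
      then show "F J u' (override_on f g (col_edges T u)) = F J u' f"
        using u by (simp add: F_def vs_cong)
    qed (use fV atom_bound_nonneg in auto)
    also have "\<dots> \<le> atom_bound k p ^ (card V - 2 * k - 1)"
    proof -
      have "card ?U = card (V - T - {j}) - k"
        using J fJ by (subst card_Diff_subset) (auto simp: \<J>_def)
      then have "card V - 2 * k - 1 \<le> card ?U" using cO[of j] by linarith
      moreover have "atom_bound k p \<le> 1" using p by (simp add: atom_bound_def)
      ultimately show ?thesis
        by (simp add: measure_pmf.prob_space power_decreasing atom_bound_nonneg)
    qed
    finally show ?thesis .
  qed
  have "prob (bern (edges n) p) {\<xi>. nearly_dependent V (wmat w \<xi>) T} \<le>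
      prob (bern (edges n) p) {\<xi>. \<exists>j\<in>V. \<exists>J\<in>\<J> j. True \<and> (\<forall>u\<in>V - T - {j} - J. F J u \<xi>)}"
    by (rule prob_mono) (rule event)
  also have "\<dots> \<le> real (card V) * (real (card V choose k) * atom_bound k p ^ (card V - 2 * k - 1))"
  proof (intro prob_UN_le_const fV)
    fix j
    have fJ: "finite (\<J> j)" using fV by (auto simp: \<J>_def)
    have "prob (bern (edges n) p) {\<xi>. \<exists>J\<in>\<J> j. True \<and> (\<forall>u\<in>V - T - {j} - J. F J u \<xi>)} \<le>
       real (card (\<J> j)) * atom_bound k p ^ (card V - 2 * k - 1)"
      by (intro prob_UN_le_const fJ one)
    also have "\<dots> \<le> real (card V choose k) * atom_bound k p ^ (card V - 2 * k - 1)"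
    proof -
      have "card (\<J> j) \<le> card {J. J \<subseteq> V \<and> card J = k}"
        using fV by (intro card_mono) (auto simp: \<J>_def)
      then have "card (\<J> j) \<le> card V choose k" using fV by (simp add: n_subsets)
      then show ?thesis by (intro mult_right_mono) (auto simp: atom_bound_nonneg)
    qed
    finally show "prob (bern (edges n) p) {\<xi>. \<exists>J\<in>\<J> j. True \<and> (\<forall>u\<in>V - T - {j} - J. F J u \<xi>)} \<le>
      real (card V choose k) * atom_bound k p ^ (card V - 2 * k - 1)" .
  qed
  finally show ?thesis by (simp add: k_def)
qed

lemma degree_in_wmat:
  assumes "\<And>t. t \<in> T \<Longrightarrow> w t u \<noteq> 0"
  shows "degree_in (wmat w \<xi>) T u = card {e\<in>col_edges T u. \<xi> e}"
proof -
  have "{e\<in>col_edges T u. \<xi> e} = (\<lambda>t. edge t u) ` {t\<in>T. wmat w \<xi> t u \<noteq> 0}"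
    using assms by (auto simp: col_edges_def wmat_def)
  then show ?thesis by (simp add: degree_in_def card_image inj_edge)
qed

definition inner_edges :: "nat set \<Rightarrow> (nat \<times> nat) set" where
  "inner_edges T = (\<lambda>(s, t). edge s t) ` (T \<times> T)"

lemma card_inner_edges_le: "finite T \<Longrightarrow> card (inner_edges T) \<le> card T ^ 2"
  unfolding inner_edges_def
  by (rule order.trans[OF card_image_le]) (auto simp: power2_eq_square card_cartesian_product)

text \<open>Every edge is incident to at most two columns.\<close>

lemma inner_double_cols_le:
  assumes fT: "finite T"
  shows "card {u\<in>T. degree_in (wmat w \<xi>) T u \<ge> 2} \<le> card {e\<in>inner_edges T. \<xi> e}"
proof -
  let ?D = "{u\<in>T. degree_in (wmat w \<xi>) T u \<ge> 2}" and ?E = "{e\<in>inner_edges T. \<xi> e}"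
  let ?P = "SIGMA u:?D. {t\<in>T. wmat w \<xi> t u \<noteq> 0}"
  have fE: "finite ?E" using fT by (simp add: inner_edges_def)
  have "2 * card ?D = (\<Sum>u\<in>?D. 2)" by simp
  also have "\<dots> \<le> (\<Sum>u\<in>?D. card {t\<in>T. wmat w \<xi> t u \<noteq> 0})"
    by (rule sum_mono) (simp add: degree_in_def)
  also have "\<dots> = card ?P" using fT by simp
  also have "\<dots> \<le> card (?E \<union> prod.swap ` ?E)"
  proof (rule card_mono)
    show "?P \<subseteq> ?E \<union> prod.swap ` ?E"
    proof
      fix x assume "x \<in> ?P"
      then obtain u t where x: "x = (u, t)" "u \<in> T" "t \<in> T" "\<xi> (edge t u)"
        by (auto simp: wmat_def)
      then have "edge t u \<in> ?E" by (auto simp: inner_edges_def)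
      moreover have "x = edge t u \<or> x = prod.swap (edge t u)"
        using x(1) by (auto simp: edge_def min_def max_def)
      ultimately show "x \<in> ?E \<union> prod.swap ` ?E" by (elim disjE) (simp_all only: UnI1 UnI2 imageI)
    qed
  qed (use fE in auto)
  also have "\<dots> \<le> card ?E + card (prod.swap ` ?E)" by (rule card_Un_le)
  also have "\<dots> \<le> 2 * card ?E" using card_image_le[OF fE, of prod.swap] by simp
  finally show ?thesis by simp
qed

text \<open>The index \<open>b\<close> counts doubly touched columns inside \<open>T\<close>, each of which is charged
  to an edge inside \<open>T\<close>, so that these columns are independent of the ones outside; the summand
  \<open>1\<close> in \<open>1 + N k p\<close> stands for the absence of a column touched once.\<close>

lemma prob_covers_sparsely_le:
  assumes V: "V \<subseteq> {..<n}" and TV: "T \<subseteq> V" "T \<noteq> {}" and p: "0 < p" "p \<le> 1/2"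
    and nz: "\<And>t u. t < n \<Longrightarrow> u < n \<Longrightarrow> t \<noteq> u \<Longrightarrow> w t u \<noteq> 0"
  defines "k \<equiv> card T" and "N \<equiv> card V"
  defines "\<tau> \<equiv> 1 - real k * p * (1 - p) ^ (k - 1)"
  shows "prob (bern (edges n) p) {\<xi>. covers_sparsely V (wmat w \<xi>) T r} \<le>
    (\<Sum>b\<le>r. real (k\<^sup>2 choose b) * p ^ b * (real (N choose (r - b)) * (real (k\<^sup>2) * p\<^sup>2) ^ (r - b) *
      ((1 + real N * (real k * p)) * \<tau> ^ (N - k - r - 1))))"
proof -
  let ?P = "bern (edges n) p" and ?blk = "\<lambda>u. bern (col_edges T u) p" and ?ov = "\<lambda>u f g. override_on f g (col_edges T u)"
  have fV: "finite V" using V finite_subset by auto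
  have fT: "finite T" using TV fV finite_subset by auto
  have k: "k > 0" using TV fT by (auto simp: k_def card_gt_0_iff)
  define Out where "Out = V - T"
  have fO: "finite Out" using fV by (simp add: Out_def)
  have cO: "card Out = N - k" using TV fT by (simp add: Out_def N_def k_def card_Diff_subset)
  define dg where "dg u \<xi> = card {e\<in>col_edges T u. \<xi> e}" for u and \<xi> :: "nat \<times> nat \<Rightarrow> bool"
  have dg: "degree_in (wmat w \<xi>) T u = dg u \<xi>" if u: "u \<in> Out" for u \<xi>
    unfolding dg_def
  proof (rule degree_in_wmat)
    fix t assume "t \<in> T"
    then have "t < n" "u < n" "t \<noteq> u" using u V TV by (auto simp: Out_def)
    then show "w t u \<noteq> 0" by (rule nz)
  qed
  define inner where "inner b \<xi> \<longleftrightarrow> b \<le> card {e\<in>inner_edges T. \<xi> e}" for b and \<xi> :: "nat \<times> nat \<Rightarrow> bool"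
  define Bs where "Bs b = {B. B \<subseteq> Out \<and> card B = r - b}" for b
  define Ss where "Ss B = insert {} ((\<lambda>u. {u}) ` (Out - B))" for B
  \<comment> \<open>The four conditions read disjoint sets of entries: those inside
    \<open>T\<close>, then the columns of \<open>B\<close>, of \<open>S\<close>, and the remaining
    outer columns. The bound \<open>one\<close> below peels them off in the reverse order.\<close>
  define Ev where "Ev b B S \<xi> \<longleftrightarrow> ((inner b \<xi> \<and> (\<forall>u\<in>B. 2 \<le> dg u \<xi>)) \<and> (\<forall>u\<in>S. dg u \<xi> = 1)) \<and>
      (\<forall>u\<in>Out - B - S. dg u \<xi> \<noteq> 1)" for b B S \<xi>
  have event: "\<exists>b\<in>{..r}. \<exists>B\<in>Bs b. \<exists>S\<in>Ss B. Ev b B S \<xi>" if cs: "covers_sparsely V (wmat w \<xi>) T r" for \<xi>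
  proof -
    let ?M = "wmat w \<xi>"
    define Din where "Din = {u\<in>T. degree_in ?M T u \<ge> 2}"
    define Dout where "Dout = {u\<in>Out. 2 \<le> dg u \<xi>}"
    define S where "S = {u\<in>Out. dg u \<xi> = 1}"
    have "double_cols V ?M T = Din \<union> Dout"
      using TV dg by (auto simp: double_cols_def Din_def Dout_def Out_def)
    then have "r \<le> card Din + card Dout"
      using cs card_Un_le[of Din Dout] by (simp add: covers_sparsely_def)
    \<comment> \<open>Capping at \<open>r\<close> keeps \<open>b\<close> in the range of the sum,
      and the missing \<open>r - b\<close> doubly touched columns are then available outside
      \<open>T\<close>.\<close>
    define b where "b = min r (card Din)"
    have "r - b \<le> card Dout" using \<open>r \<le> card Din + card Dout\<close> by (auto simp: b_def)
    then obtain B where B: "B \<subseteq> Dout" "card B = r - b" by (meson obtain_subset_with_card_n)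
    have "S \<subseteq> single_cols V ?M T" using dg by (auto simp: S_def single_cols_def Out_def)
    then have "card S \<le> card (single_cols V ?M T)"
      using fV by (intro card_mono) (auto simp: single_cols_def)
    then have "card S \<le> 1" using cs by (simp add: covers_sparsely_def)
    moreover have "finite S" using fO by (simp add: S_def)
    ultimately have "S = {} \<or> (\<exists>u. S = {u})"
      by (metis card_0_eq card_1_singletonE le_neq_implies_less less_one)
    moreover have "S \<subseteq> Out - B" using B by (auto simp: S_def Dout_def)
    ultimately have "S \<in> Ss B" by (auto simp: Ss_def)
    moreover have "B \<in> Bs b" using B by (auto simp: Bs_def Dout_def)
    moreover have "Ev b B S \<xi>"
    proof -
      have "b \<le> card {e\<in>inner_edges T. \<xi> e}"
        using inner_double_cols_le[OF fT, of w \<xi>] by (simp add: b_def Din_def)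
      then show ?thesis using B by (auto simp: Ev_def inner_def S_def Dout_def)
    qed
    ultimately show ?thesis by (intro bexI[of _ b] bexI[of _ B] bexI[of _ S]) (auto simp: b_def)
  qed
  have blk_sub: "col_edges T u \<subseteq> edges n" if "u \<in> Out" for u
    using that V TV by (intro col_edges_subset) (auto simp: Out_def)
  have inner_inv: "inner b (?ov u f g) = inner b f" if "u \<in> Out" for u b f g
  proof -
    have "{e\<in>inner_edges T. override_on f g (col_edges T u) e} = {e\<in>inner_edges T. f e}"
      using that by (auto simp: inner_edges_def Out_def override_on_def col_edges_def edge_eq_iff)
    then show ?thesis by (simp add: inner_def)
  qed
  have dg_inv: "dg u' (?ov u f g) = dg u' f" if "u \<in> Out" "u' \<in> Out" "u \<noteq> u'" for u u' f g
  proof -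
    have "{e\<in>col_edges T u'. override_on f g (col_edges T u) e} = {e\<in>col_edges T u'. f e}"
      using that by (auto simp: Out_def override_on_def col_edges_def edge_eq_iff)
    then show ?thesis by (simp add: dg_def)
  qed
  have dg_self: "dg u (?ov u f g) = dg u g" for u f g
  proof -
    have "{e\<in>col_edges T u. override_on f g (col_edges T u) e} = {e\<in>col_edges T u. g e}"
      by (auto simp: override_on_def)
    then show ?thesis by (simp add: dg_def)
  qed
  have p1: "0 \<le> p" "p \<le> 1" using p by auto
  have fc: "finite (col_edges T u)" for u using fT by (simp add: col_edges_def)
  have dg_eq1: "prob (?blk u) {g. dg u g = 1} = real k * p * (1 - p) ^ (k - 1)" for u
    unfolding dg_def using prob_bern_card_eq[OF fc p1] by (simp add: card_col_edges k_def)
  have \<tau>: "0 \<le> \<tau>" "\<tau> \<le> 1"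
  proof -
    show "0 \<le> \<tau>" using dg_eq1[of 0] measure_pmf.prob_le_1[of "?blk 0" "{g. dg 0 g = 1}"]
      by (simp add: \<tau>_def)
    show "\<tau> \<le> 1" using p by (simp add: \<tau>_def)
  qed
  have b2: "prob (?blk u) {g. 2 \<le> dg u g} \<le> real (k\<^sup>2) * p\<^sup>2" for u
  proof -
    have "prob (?blk u) {g. 2 \<le> dg u g} \<le> real (k choose 2) * p\<^sup>2"
      unfolding dg_def using prob_bern_card_ge[OF fc order.refl p1, of u 2] by (simp add: card_col_edges k_def)
    also have "\<dots> \<le> real (k\<^sup>2) * p\<^sup>2"
    proof (intro mult_right_mono of_nat_mono)
      show "k choose 2 \<le> k\<^sup>2" by (cases "2 \<le> k") (auto simp: binomial_le_pow binomial_eq_0)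
    qed auto
    finally show ?thesis .
  qed
  have b1: "prob (?blk u) {g. dg u g = 1} \<le> real k * p" for u
    unfolding dg_eq1 using p by (intro mult_left_le power_le_one) auto
  have b0: "prob (?blk u) {g. dg u g \<noteq> 1} \<le> \<tau>" for u
  proof -
    have "prob (?blk u) {g. dg u g \<noteq> 1} = prob (?blk u) (UNIV - {g. dg u g = 1})"
      by (intro arg_cong2[where f = measure_pmf.prob] refl) auto
    also have "\<dots> = 1 - prob (?blk u) {g. dg u g = 1}"
      using measure_pmf.prob_compl[of "{g. dg u g = 1}"] by simp
    finally show ?thesis using dg_eq1[of u] by (simp add: \<tau>_def)
  qed
  have inner: "prob ?P {\<xi>. inner b \<xi>} \<le> real (k\<^sup>2 choose b) * p ^ b" for b
  proof -
    have "edge t u \<in> edges n" if "t \<in> T" "u \<in> T" for t u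
      using that V TV by (intro edge_in_edges) auto
    then have "inner_edges T \<subseteq> edges n" by (auto simp: inner_edges_def)
    then have "prob ?P {\<xi>. inner b \<xi>} \<le> real (card (inner_edges T) choose b) * p ^ b"
      unfolding inner_def by (intro prob_bern_card_ge p1) auto
    also have "\<dots> \<le> real (k\<^sup>2 choose b) * p ^ b"
      using card_inner_edges_le[OF fT] p by (intro mult_right_mono of_nat_mono binomial_right_mono) (auto simp: k_def)
    finally show ?thesis .
  qed
  have one: "prob ?P {\<xi>. Ev b B S \<xi>} \<le>
      real (k\<^sup>2 choose b) * p ^ b * (real (k\<^sup>2) * p\<^sup>2) ^ (r - b) * \<tau> ^ (N - k - r - 1) * (real k * p) ^ card S"
    if B: "B \<in> Bs b" and S: "S \<in> Ss B" for b B S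
  proof -
    have BO: "B \<subseteq> Out" "card B = r - b" and SO: "S \<subseteq> Out - B" "card S \<le> 1"
      using B S by (auto simp: Bs_def Ss_def)
    have fB: "finite B" "finite S" using BO SO fO by (auto intro: finite_subset)
    let ?C1 = "\<lambda>\<xi>. inner b \<xi> \<and> (\<forall>u\<in>B. 2 \<le> dg u \<xi>)"
    let ?C2 = "\<lambda>\<xi>. ?C1 \<xi> \<and> (\<forall>u\<in>S. dg u \<xi> = 1)"
    have "prob ?P {\<xi>. Ev b B S \<xi>} \<le> \<tau> ^ card (Out - B - S) * prob ?P {\<xi>. ?C2 \<xi>}"
      unfolding Ev_def
    proof (rule prob_blocks[where D = "col_edges T"])
      fix u f g assume u: "u \<in> Out - B - S"
      then have "inner b (?ov u f g) = inner b f"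
        "\<forall>u'\<in>B. dg u' (?ov u f g) = dg u' f"
        "\<forall>u'\<in>S. dg u' (?ov u f g) = dg u' f"
        using BO SO by (auto intro!: inner_inv dg_inv)
      then show "?C2 (?ov u f g) = ?C2 f" by simp
    next
      fix u v f g assume "u \<in> Out - B - S" "v \<in> Out - B - S" "u \<noteq> v"
      then show "(dg v (?ov u f g) \<noteq> 1) = (dg v f \<noteq> 1)"
        by (simp add: dg_inv)
    qed (use fO \<tau> blk_sub b0 in \<open>auto simp: dg_self\<close>)
    also have "prob ?P {\<xi>. ?C2 \<xi>} \<le> (real k * p) ^ card S * prob ?P {\<xi>. ?C1 \<xi>}"
    proof (rule prob_blocks[where D = "col_edges T"])
      fix u f g assume u: "u \<in> S"
      then have "inner b (?ov u f g) = inner b f"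
        "\<forall>u'\<in>B. dg u' (?ov u f g) = dg u' f"
        using BO SO by (auto intro!: inner_inv dg_inv)
      then show "?C1 (?ov u f g) = ?C1 f" by simp
    next
      fix u v f g assume "u \<in> S" "v \<in> S" "u \<noteq> v"
      then have "u \<in> Out" "v \<in> Out" "u \<noteq> v" using SO by auto
      then show "(dg v (?ov u f g) = 1) = (dg v f = 1)" by (simp add: dg_inv)
    next
      fix u assume "u \<in> S"
      then show "col_edges T u \<subseteq> edges n" using SO by (intro blk_sub) auto
    qed (use fB p b1 in \<open>auto simp: dg_self\<close>)
    also have "prob ?P {\<xi>. ?C1 \<xi>} \<le> (real (k\<^sup>2) * p\<^sup>2) ^ card B * prob ?P {\<xi>. inner b \<xi>}"
    proof (rule prob_blocks[where D = "col_edges T"])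
      fix u f g assume u: "u \<in> B"
      then show "inner b (?ov u f g) = inner b f"
        using BO by (auto intro!: inner_inv)
    next
      fix u v f g assume "u \<in> B" "v \<in> B" "u \<noteq> v"
      then have "u \<in> Out" "v \<in> Out" "u \<noteq> v" using BO by auto
      then show "(2 \<le> dg v (?ov u f g)) = (2 \<le> dg v f)" by (simp add: dg_inv)
    next
      fix u assume "u \<in> B"
      then show "col_edges T u \<subseteq> edges n" using BO by (intro blk_sub) auto
    qed (use fB p b2 in \<open>auto simp: dg_self\<close>)
    also have "prob ?P {\<xi>. inner b \<xi>} \<le> real (k\<^sup>2 choose b) * p ^ b" by (rule inner)
    also have "\<tau> ^ card (Out - B - S) \<le> \<tau> ^ (N - k - r - 1)"
    proof (rule power_decreasing)
      have "card (Out - B - S) = N - k - (r - b) - card S"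
        using BO SO fB by (simp add: card_Diff_subset cO)
      then show "N - k - r - 1 \<le> card (Out - B - S)" using SO by linarith
    qed (use \<tau> in auto)
    finally show ?thesis
      using p \<tau> BO(2) by (simp add: mult_ac mult_left_mono mult_right_mono)
  qed
  have SS: "prob ?P {\<xi>. \<exists>S\<in>Ss B. Ev b B S \<xi>} \<le>
      real (k\<^sup>2 choose b) * p ^ b * (real (k\<^sup>2) * p\<^sup>2) ^ (r - b) * \<tau> ^ (N - k - r - 1) * (1 + real N * (real k * p))"
    if B: "B \<in> Bs b" for b B
  proof -
    let ?X = "real (k\<^sup>2 choose b) * p ^ b * (real (k\<^sup>2) * p\<^sup>2) ^ (r - b) * \<tau> ^ (N - k - r - 1)"
    have X: "?X \<ge> 0" using p \<tau> by auto
    have fin: "finite (Ss B)" using fO by (simp add: Ss_def)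
    have "prob ?P {\<xi>. \<exists>S\<in>Ss B. Ev b B S \<xi>} \<le> (\<Sum>S\<in>Ss B. prob ?P {\<xi>. Ev b B S \<xi>})"
      by (rule prob_UN_le[OF fin])
    also have "\<dots> \<le> (\<Sum>S\<in>Ss B. ?X * (real k * p) ^ card S)"
      by (rule sum_mono) (use one[OF B] in auto)
    also have "\<dots> = ?X * (\<Sum>S\<in>Ss B. (real k * p) ^ card S)" by (simp add: sum_distrib_left)
    also have "(\<Sum>S\<in>Ss B. (real k * p) ^ card S) = 1 + (\<Sum>S\<in>(\<lambda>u. {u}) ` (Out - B). (real k * p) ^ card S)"
      unfolding Ss_def using fO by (subst sum.insert) auto
    also have "(\<Sum>S\<in>(\<lambda>u. {u}) ` (Out - B). (real k * p) ^ card S) = real (card (Out - B)) * (real k * p)"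
      by (subst sum.reindex) (auto simp: inj_on_def)
    also have "?X * (1 + real (card (Out - B)) * (real k * p)) \<le> ?X * (1 + real N * (real k * p))"
    proof -
      have "card (Out - B) \<le> N" unfolding N_def using fV by (intro card_mono) (auto simp: Out_def)
      then have "1 + real (card (Out - B)) * (real k * p) \<le> 1 + real N * (real k * p)"
        using p by (intro add_left_mono mult_right_mono) auto
      then show ?thesis by (rule mult_left_mono[OF _ X])
    qed
    finally show ?thesis .
  qed
  have "prob ?P {\<xi>. covers_sparsely V (wmat w \<xi>) T r} \<le> prob ?P {\<xi>. \<exists>b\<in>{..r}. \<exists>B\<in>Bs b. \<exists>S\<in>Ss B. Ev b B S \<xi>}"
    by (rule prob_mono) (rule event)
  also have "\<dots> \<le> (\<Sum>b\<le>r. prob ?P {\<xi>. \<exists>B\<in>Bs b. \<exists>S\<in>Ss B. Ev b B S \<xi>})"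
    by (rule prob_UN_le) simp
  also have "\<dots> \<le> (\<Sum>b\<le>r. real (k\<^sup>2 choose b) * p ^ b * (real (N choose (r - b)) * (real (k\<^sup>2) * p\<^sup>2) ^ (r - b) *
      ((1 + real N * (real k * p)) * \<tau> ^ (N - k - r - 1))))"
  proof (rule sum_mono)
    fix b
    let ?Y = "real (k\<^sup>2 choose b) * p ^ b * (real (k\<^sup>2) * p\<^sup>2) ^ (r - b) * \<tau> ^ (N - k - r - 1) * (1 + real N * (real k * p))"
    have fB: "finite (Bs b)" using fO by (simp add: Bs_def)
    have "prob ?P {\<xi>. \<exists>B\<in>Bs b. \<exists>S\<in>Ss B. Ev b B S \<xi>} \<le> real (card (Bs b)) * ?Y"
      by (rule prob_UN_le_const[OF fB SS])
    also have "\<dots> \<le> real (N choose (r - b)) * ?Y"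
    proof (rule mult_right_mono)
      have "card (Bs b) = (N - k) choose (r - b)" using fO by (simp add: Bs_def n_subsets cO)
      then show "real (card (Bs b)) \<le> real (N choose (r - b))" by (simp add: binomial_right_mono)
    qed (use p \<tau> in auto)
    finally show "prob ?P {\<xi>. \<exists>B\<in>Bs b. \<exists>S\<in>Ss B. Ev b B S \<xi>} \<le>
      real (k\<^sup>2 choose b) * p ^ b * (real (N choose (r - b)) * (real (k\<^sup>2) * p\<^sup>2) ^ (r - b) *
      ((1 + real N * (real k * p)) * \<tau> ^ (N - k - r - 1)))" by (simp add: mult_ac)
  qed
  finally show ?thesis .
qed


section \<open>Union bound estimates\<close>

lemma power_div_fact_le: "real k ^ k / fact k \<le> exp (real k)"
proof -
  have s: "(\<lambda>n. real k ^ n /\<^sub>R fact n) sums exp (real k)" by (rule exp_converges)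
  have "(\<Sum>n\<in>{k}. real k ^ n /\<^sub>R fact n) \<le> (\<Sum>n. real k ^ n /\<^sub>R fact n)"
    by (rule sum_le_suminf) (use s in \<open>auto simp: sums_iff\<close>)
  then show ?thesis using s by (simp add: sums_iff divide_inverse mult.commute)
qed

lemma binomial_le_power_div_fact: "real (n choose k) \<le> real n ^ k / fact k"
proof -
  have "real (n choose k) * fact k \<le> real n ^ k"
    using binomial_fact_pow[of n k] by (metis of_nat_fact of_nat_le_iff of_nat_mult of_nat_power)
  then show ?thesis by (simp add: field_simps)
qed

lemma binomial_le_exp:
  assumes "0 < k" "k \<le> n"
  shows "real (n choose k) \<le> exp (real k * (1 + ln (real n / real k)))"
proof -
  have "real (n choose k) \<le> real n ^ k / fact k" by (rule binomial_le_power_div_fact)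
  also have "\<dots> = (real n / real k) ^ k * (real k ^ k / fact k)"
    using assms by (simp add: power_divide)
  also have "\<dots> \<le> (real n / real k) ^ k * exp (real k)"
    by (intro mult_left_mono power_div_fact_le) auto
  also have "(real n / real k) ^ k = exp (real k * ln (real n / real k))"
    using assms by (simp add: exp_of_nat_mult)
  finally show ?thesis by (simp add: exp_add[symmetric] algebra_simps)
qed

text \<open>The threshold between small and large supports, as a proportion of the dimension.\<close>

definition \<delta> :: real where "\<delta> = 1 / 40000"

text \<open>The left side is the entropy of two binomial coefficients, per unit of \<open>n\<close>.
  Applying \<open>ln x \<le> x - 1\<close> to \<open>1 / sqrt y\<close> bounds it by
  \<open>4 * sqrt y\<close>, and \<open>\<delta>\<close> is the square of 1/200, so 1/50 is
  reached.\<close>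

lemma entropy_bound:
  fixes y :: real
  assumes "0 < y" "y \<le> \<delta>"
  shows "2 * y * (1 + ln (1 / y)) \<le> 1 / 32"
proof -
  define z where "z = sqrt y"
  have z: "0 < z" "z\<^sup>2 = y" using assms by (auto simp: z_def)
  have z2: "z \<le> 1 / 200" using real_sqrt_le_mono[OF assms(2)] real_sqrt_abs[of "1/200"]
    by (simp add: z_def \<delta>_def real_sqrt_divide power2_eq_square)
  have "ln (1 / z) \<le> 1 / z - 1" using z by (intro ln_le_minus_one) auto
  moreover have "ln (1 / y) = 2 * ln (1 / z)" using z(1) by (simp add: z(2)[symmetric] ln_div ln_realpow)
  ultimately have "ln (1 / y) \<le> 2 / z - 2" by simp
  then have "2 * y * (1 + ln (1 / y)) \<le> 2 * y * (2 / z)" using assms by (intro mult_left_mono) auto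
  also have "\<dots> = 4 * z" using z by (simp add: z(2)[symmetric] power2_eq_square)
  finally show ?thesis using z2 by linarith
qed

text \<open>Choosing \<open>T\<close> and the determining columns costs about
  \<open>exp (2 * k * (1 + ln (n / k)))\<close>; the orthogonality of the other columns gains
  \<open>exp (- min (k * p) 1 * n / 16)\<close>. The target \<open>1 / n^2\<close> allows a later
  sum over all \<open>k \<le> n\<close>.\<close>

lemma medium_sets_estimate:
  assumes "c > 0"
  shows "\<forall>\<^sub>F n in sequentially. \<forall>p N k. n - 1 \<le> N \<and> N \<le> n \<and> c * ln (real n) / real n < p \<and> p \<le> 1/2 \<and>
    0 < k \<and> real k \<le> \<delta> * real n \<and> ln (real n / real k) \<le> real n * p / 640 \<longrightarrow>
    real (N choose k) * (real N * (real (N choose k) * atom_bound k p ^ (N - 2 * k - 1))) \<le> 1 / real n ^ 2"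
proof -
  have "\<forall>\<^sub>F n::nat in sequentially. c * ln (real n) \<ge> 100" using assms by real_asymp
  moreover have "\<forall>\<^sub>F n::nat in sequentially. 3 * ln (real n) \<le> real n / 32" by real_asymp
  moreover have "\<forall>\<^sub>F n::nat in sequentially. n \<ge> 10" by (rule eventually_ge_at_top)
  ultimately show ?thesis
  proof eventually_elim
    case (elim n)
    show ?case
    proof (intro allI impI, elim conjE)
      fix p N k
      assume N: "n - 1 \<le> N" "N \<le> n" and p: "c * ln (real n) / real n < p" "p \<le> 1/2"
        and k: "0 < k" "real k \<le> \<delta> * real n" and L: "ln (real n / real k) \<le> real n * p / 640"
      let ?e = "real (N choose k) * (real N * (real (N choose k) * atom_bound k p ^ (N - 2 * k - 1)))"
      define l where "l = ln (real n / real k)"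
      define \<mu> where "\<mu> = real n * p"
      have n: "real n \<ge> 10" using elim by simp
      have "0 \<le> c * ln (real n) / real n" using elim(1) n by (intro divide_nonneg_nonneg) auto
      then have p0: "p > 0" using p(1) by linarith
      have \<mu>: "\<mu> \<ge> 100" using p(1) elim(1) n by (simp add: \<mu>_def field_simps)
      have kn: "real k \<le> real n / 40000" using k by (simp add: \<delta>_def)
      then have kn': "k \<le> n" by linarith
      have l0: "l \<ge> 0" using kn k n by (simp add: l_def)
      have lnn: "ln (real n) = l + ln (real k)" using k n by (simp add: l_def ln_div)
      have lnk: "ln (real k) \<le> real k" using ln_le_minus_one[of "real k"] k by simp
      have ch: "real (N choose k) \<le> exp (real k * (1 + l))"
        using binomial_le_exp[OF k(1) kn'] binomial_right_mono[OF N(2), of k] unfolding l_def by linarith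
      have at: "atom_bound k p ^ (N - 2 * k - 1) \<le> exp (- min (real k * p) 1 * real n / 16)"
      proof -
        have "atom_bound k p ^ (N - 2 * k - 1) \<le> exp (- min (real k * p) 1 / 8) ^ (N - 2 * k - 1)"
          by (intro power_mono atom_bound_le_exp atom_bound_nonneg)
        also have "\<dots> = exp (- (min (real k * p) 1 / 8 * real (N - 2 * k - 1)))"
          by (simp add: exp_of_nat_mult[symmetric] mult_ac)
        also have "\<dots> \<le> exp (- (min (real k * p) 1 / 8 * (real n / 2)))"
        proof -
          have "real (N - 2 * k - 1) \<ge> real n - 1 - 2 * real k - 1" using N by linarith
          then have "real n / 2 \<le> real (N - 2 * k - 1)" using kn n by linarith
          then have "min (real k * p) 1 / 8 * (real n / 2) \<le> min (real k * p) 1 / 8 * real (N - 2 * k - 1)"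
            using p0 by (intro mult_left_mono) auto
          then show ?thesis by simp
        qed
        finally show ?thesis by (simp add: mult_ac)
      qed
      have "?e \<le>
          exp (real k * (1 + l)) * (exp (ln (real n)) * (exp (real k * (1 + l)) * exp (- min (real k * p) 1 * real n / 16)))"
        using N n by (intro mult_mono ch at) (auto simp: atom_bound_nonneg)
      also have "\<dots> = exp (2 * real k * (1 + l) + ln (real n) - min (real k * p) 1 * real n / 16)"
        by (simp add: exp_add[symmetric] algebra_simps)
      also have "\<dots> \<le> exp (- 2 * ln (real n))"
      proof -
        have "2 * real k * (1 + l) + 3 * ln (real n) \<le> min (real k * p) 1 * real n / 16"
        proof (cases "real k * p \<le> 1")
          case True
          have "3 * ln (real n) \<le> 3 * l + 3 * real k" using lnn lnk by simp
          moreover have "l \<le> \<mu> / 640" using L by (simp add: l_def \<mu>_def)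
          moreover have "real k * l \<le> real k * (\<mu> / 640)" using calculation(2) by (intro mult_left_mono) auto
          moreover have "1 * \<mu> \<le> real k * \<mu>" using k \<mu> by (intro mult_right_mono) auto
          moreover have "real k * 100 \<le> real k * \<mu>" using \<mu> by (intro mult_left_mono) auto
          \<comment> \<open>In units of \<open>k * \<mu>\<close>, the terms cost 1/20 (five times
            \<open>k\<close>, with \<open>\<mu> \<ge> 100\<close>), 1/320 and 3/640: together
            37/640, just below 1/16. This is the reason for the constant 640.\<close>
          ultimately have "2 * real k + 2 * (real k * l) + 3 * ln (real n) \<le> real k * \<mu> / 16" by linarith
          moreover have "min (real k * p) 1 * real n = real k * \<mu>" using True by (simp add: \<mu>_def)
          ultimately show ?thesis by (simp add: algebra_simps)
        next
          case False
          define y where "y = real k / real n"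
          have y: "0 < y" "y \<le> \<delta>" using k n by (auto simp: y_def field_simps)
          have "1 / y = real n / real k" using k n by (simp add: y_def)
          \<comment> \<open>Here the available exponent is \<open>n / 16\<close>: half of it pays
            for the entropy, the other half for \<open>3 * ln n\<close>.\<close>
          then have "real n * (2 * y * (1 + l)) \<le> real n * (1 / 32)"
            using entropy_bound[OF y] n unfolding l_def by (intro mult_left_mono) auto
          moreover have "real n * (2 * y * (1 + l)) = 2 * real k * (1 + l)" using n by (simp add: y_def)
          ultimately have "2 * real k * (1 + l) \<le> real n / 32" by simp
          moreover have "min (real k * p) 1 = 1" using False by simp
          ultimately show ?thesis using elim(2) by simp
        qed
        then show ?thesis by simp
      qed
      also have "\<dots> = 1 / real n ^ 2"
      proof -
        have "exp (- 2 * ln (real n)) = inverse (exp (2 * ln (real n)))" by (simp add: exp_minus)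
        also have "exp (2 * ln (real n)) = real n ^ 2"
          using exp_of_nat_mult[of 2 "ln (real n)"] n by simp
        finally show ?thesis by (simp add: inverse_eq_divide)
      qed
      finally show "?e \<le> 1 / real n ^ 2" .
    qed
  qed
qed

lemma sum_two_binomials_le:
  fixes a b :: real
  assumes "a \<ge> 0" "b \<ge> 0"
  shows "(\<Sum>j\<le>r. real (A choose j) * a ^ j * (real (B choose (r - j)) * b ^ (r - j))) \<le>
    (real A * a + real B * b) ^ r / fact r"
proof -
  have "(\<Sum>j\<le>r. real (A choose j) * a ^ j * (real (B choose (r - j)) * b ^ (r - j))) \<le>
      (\<Sum>j\<le>r. (real A * a) ^ j / fact j * ((real B * b) ^ (r - j) / fact (r - j)))"
  proof (rule sum_mono)
    fix j
    have "real (A choose j) * a ^ j \<le> real A ^ j / fact j * a ^ j"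
      using assms by (intro mult_right_mono binomial_le_power_div_fact) auto
    moreover have "real (B choose (r - j)) * b ^ (r - j) \<le> real B ^ (r - j) / fact (r - j) * b ^ (r - j)"
      using assms by (intro mult_right_mono binomial_le_power_div_fact) auto
    ultimately show "real (A choose j) * a ^ j * (real (B choose (r - j)) * b ^ (r - j)) \<le>
      (real A * a) ^ j / fact j * ((real B * b) ^ (r - j) / fact (r - j))"
      using assms mult_mono[of "real (A choose j) * a ^ j" "real A ^ j / fact j * a ^ j"
          "real (B choose (r - j)) * b ^ (r - j)" "real B ^ (r - j) / fact (r - j) * b ^ (r - j)"]
      by (simp add: power_mult_distrib)
  qed
  also have "\<dots> = (\<Sum>j\<le>r. real (r choose j) * (real A * a) ^ j * (real B * b) ^ (r - j) / fact r)"
    by (intro sum.cong) (auto simp: binomial_fact)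
  also have "\<dots> = (real A * a + real B * b) ^ r / fact r"
    by (simp add: binomial_ring sum_divide_distrib)
  finally show ?thesis .
qed

text \<open>The choice of \<open>T\<close> contributes \<open>1 / fact k\<close>, the doubly touched
  columns \<open>1 / fact r\<close>. The two factorials absorb \<open>k ^ (2 * k)\<close> up to
  \<open>exp (2 * k)\<close>, and the powers of \<open>n\<close> cancel except for one factor when
  \<open>r = k - 1\<close>.\<close>

lemma small_sets_factorial_bound:
  fixes \<mu> :: real
  assumes k: "0 < k" "0 < n" and r: "r = k \<or> r = k - 1" and \<mu>: "\<mu> \<ge> 1"
  shows "real n ^ k / fact k * ((2 * real k ^ 2 * \<mu>\<^sup>2 / real n) ^ r / fact r) \<le>
    real n ^ (k - r) * (2 * \<mu>\<^sup>2 * exp 2) ^ k"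
proof -
  define q where "q = real k ^ k / fact k"
  have q: "0 \<le> q" "q \<le> exp (real k)" by (auto simp: q_def power_div_fact_le)
  have qq: "q * q \<le> exp 2 ^ k"
  proof -
    have "q * q \<le> exp (real k) * exp (real k)" using q by (intro mult_mono) auto
    also have "\<dots> = exp 2 ^ k" by (simp add: exp_add[symmetric] exp_of_nat_mult[symmetric])
    finally show ?thesis .
  qed
  from r show ?thesis
  proof
    assume r: "r = k"
    have "real n ^ k / fact k * ((2 * real k ^ 2 * \<mu>\<^sup>2 / real n) ^ r / fact r) = (2 * \<mu>\<^sup>2) ^ k * (q * q)"
      using k by (simp add: r q_def power_divide power_mult_distrib power2_eq_square)
    also have "\<dots> \<le> (2 * \<mu>\<^sup>2) ^ k * exp 2 ^ k" using qq by (intro mult_left_mono) auto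
    finally show ?thesis using r by (simp add: power_mult_distrib)
  next
    assume r: "r = k - 1"
    obtain m where m: "k = Suc m" using k by (cases k) auto
    have "real n ^ k / fact k * ((2 * real k ^ 2 * \<mu>\<^sup>2 / real n) ^ r / fact r) =
        real n * ((2 * \<mu>\<^sup>2) ^ m * (real k ^ (2 * m) / (fact k * fact m)))"
      using k by (simp add: r m power_divide power_mult_distrib power_mult[symmetric] mult_ac)
    also have "real k ^ (2 * m) / (fact k * fact m) = q * q / real k"
      by (simp add: q_def m mult_2 power_add del: of_nat_Suc)
    also have "real n * ((2 * \<mu>\<^sup>2) ^ m * (q * q / real k)) \<le> real n * ((2 * \<mu>\<^sup>2) ^ k * exp 2 ^ k)"
    proof (intro mult_left_mono mult_mono)
      have "1 \<le> \<mu>\<^sup>2" using \<mu> by (simp add: one_le_power)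
      then show "(2 * \<mu>\<^sup>2) ^ m \<le> (2 * \<mu>\<^sup>2) ^ k" by (intro power_increasing) (auto simp: m)
      have "q * q / real k \<le> q * q / 1" using k q by (intro divide_left_mono) auto
      then show "q * q / real k \<le> exp 2 ^ k" using qq by simp
    qed (use q in auto)
    also have "\<dots> = real n ^ (k - r) * (2 * \<mu>\<^sup>2 * exp 2) ^ k"
      using r m by (simp only: power_mult_distrib) simp
    finally show ?thesis .
  qed
qed

text \<open>With \<open>\<mu> = n * p\<close>, the assumption forces
  \<open>k / n < exp (- \<mu> / 640)\<close>, so \<open>k * p\<close> is negligible and the absence
  of singly touched columns costs nearly \<open>exp (- k * \<mu>)\<close>. All other factors are
  polynomial in \<open>\<mu>\<close> per row and are absorbed by
  \<open>exp (\<epsilon> * \<mu>)\<close>; only afterwards is \<open>\<mu>\<close> replaced by its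
  lower bound \<open>c * ln n\<close>, which gives uniformity in \<open>p\<close>.\<close>

lemma small_sets_estimate:
  assumes "c > 0" "0 < \<epsilon>" "\<epsilon> < 1/2"
  shows "\<forall>\<^sub>F n in sequentially. \<forall>p N k r. n - 1 \<le> N \<and> N \<le> n \<and> c * ln (real n) / real n < p \<and> p \<le> 1/2 \<and>
    0 < k \<and> real k \<le> \<delta> * real n \<and> real n * p / 640 < ln (real n / real k) \<and> (r = k \<or> r = k - 1) \<longrightarrow>
    real (N choose k) * (\<Sum>b\<le>r. real (k\<^sup>2 choose b) * p ^ b * (real (N choose (r - b)) * (real (k\<^sup>2) * p\<^sup>2) ^ (r - b) *
      ((1 + real N * (real k * p)) * (1 - real k * p * (1 - p) ^ (k - 1)) ^ (N - k - r - 1))))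
     \<le> real n ^ (k - r) * (real n powr (- c * (1 - 2 * \<epsilon>))) ^ k"
proof -
  have "\<forall>\<^sub>F \<mu>::real in at_top. 2 * \<mu>\<^sup>2 * exp 2 * (1 + \<mu>) \<le> exp (\<epsilon> * \<mu>)" using assms by real_asymp
  moreover have "\<forall>\<^sub>F \<mu>::real in at_top. (\<mu> + 4) * exp (- \<mu> / 640) \<le> \<epsilon>" using assms by real_asymp
  moreover have "\<forall>\<^sub>F \<mu>::real in at_top. \<mu> \<ge> 1" by (rule eventually_ge_at_top)
  ultimately have "\<forall>\<^sub>F \<mu>::real in at_top. 2 * \<mu>\<^sup>2 * exp 2 * (1 + \<mu>) \<le> exp (\<epsilon> * \<mu>) \<and> (\<mu> + 4) * exp (- \<mu> / 640) \<le> \<epsilon> \<and> \<mu> \<ge> 1"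
    by eventually_elim auto
  then obtain \<mu>0 where \<mu>0: "\<And>\<mu>. \<mu> \<ge> \<mu>0 \<Longrightarrow> 2 * \<mu>\<^sup>2 * exp 2 * (1 + \<mu>) \<le> exp (\<epsilon> * \<mu>) \<and> (\<mu> + 4) * exp (- \<mu> / 640) \<le> \<epsilon> \<and> \<mu> \<ge> 1"
    unfolding eventually_at_top_linorder by blast
  have "\<forall>\<^sub>F n::nat in sequentially. c * ln (real n) \<ge> \<mu>0" using assms by real_asymp
  moreover have "\<forall>\<^sub>F n::nat in sequentially. n \<ge> 10" by (rule eventually_ge_at_top)
  ultimately show ?thesis
  proof eventually_elim
    case (elim n)
    show ?case
    proof (intro allI impI, elim conjE)
      fix p N k r
      assume N: "n - 1 \<le> N" "N \<le> n" and p: "c * ln (real n) / real n < p" "p \<le> 1/2"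
        and k: "0 < k" "real k \<le> \<delta> * real n" and L: "real n * p / 640 < ln (real n / real k)"
        and r: "r = k \<or> r = k - 1"
      define \<mu> where "\<mu> = real n * p"
      have n: "real n \<ge> 10" using elim by simp
      have c\<mu>: "c * ln (real n) \<le> \<mu>" using p(1) n by (simp add: \<mu>_def field_simps)
      then have \<mu>: "2 * \<mu>\<^sup>2 * exp 2 * (1 + \<mu>) \<le> exp (\<epsilon> * \<mu>)" "(\<mu> + 4) * exp (- \<mu> / 640) \<le> \<epsilon>" "\<mu> \<ge> 1"
        using \<mu>0[of \<mu>] elim(1) by auto
      have p0: "p > 0" 
        using \<mu>(3) mult_nonneg_nonpos[of "real n" p] unfolding \<mu>_def by linarith
      have kn: "real k \<le> real n / 40000" using k by (simp add: \<delta>_def)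
      have kexp: "real k / real n \<le> exp (- \<mu> / 640)"
      proof -
        have "exp (\<mu> / 640) \<le> real n / real k"
          using L k n by (subst ln_ge_iff[symmetric]) (auto simp: \<mu>_def)
        then have "exp (\<mu> / 640) * real k \<le> real n" using k by (simp add: field_simps)
        then show ?thesis using n by (simp add: exp_minus field_simps)
      qed
      define \<tau> where "\<tau> = 1 - real k * p * (1 - p) ^ (k - 1)"
      \<comment> \<open>Both relative losses in the exponent at once: \<open>k * p\<close> from
        replacing \<open>(1 - p) ^ (k - 1)\<close> by 1, and \<open>4 * k / n\<close> from having
        only \<open>N - k - r - 1 \<ge> n - 4 * k\<close> columns.\<close>
      have kp: "real k * p + 4 * (real k / real n) \<le> \<epsilon>"
      proof -
        have "real k * p + 4 * (real k / real n) = (\<mu> + 4) * (real k / real n)"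
          using n by (simp add: \<mu>_def field_simps)
        also have "\<dots> \<le> (\<mu> + 4) * exp (- \<mu> / 640)" using kexp \<mu>(3) by (intro mult_left_mono) auto
        finally show ?thesis using \<mu>(2) by linarith
      qed
      have kp1: "real k * p \<le> 1" using kp assms divide_nonneg_nonneg[of "real k" "real n"] by linarith
      have \<tau>0: "0 \<le> \<tau>"
      proof -
        have "real k * p * (1 - p) ^ (k - 1) \<le> 1 * 1" using kp1 p p0 by (intro mult_mono power_le_one) auto
        then show ?thesis by (simp add: \<tau>_def)
      qed
      have \<tau>: "\<tau> ^ (N - k - r - 1) \<le> exp (- (1 - \<epsilon>) * \<mu>) ^ k"
      proof -
        have "1 + real (k - 1) * (- p) \<le> (1 + (- p)) ^ (k - 1)" using p by (intro Bernoulli_inequality) auto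
        moreover have "real (k - 1) * p \<le> real k * p" using p0 by (intro mult_right_mono) auto
        ultimately have "(1 - p) ^ (k - 1) \<ge> 1 - real k * p" by simp
        then have "real k * p * (1 - real k * p) \<le> real k * p * (1 - p) ^ (k - 1)"
          using p0 by (intro mult_left_mono) auto
        then have "\<tau> \<le> 1 + - (real k * p * (1 - real k * p))" by (simp add: \<tau>_def)
        also have "\<dots> \<le> exp (- (real k * p * (1 - real k * p)))" by (rule exp_ge_add_one_self)
        finally have "\<tau> ^ (N - k - r - 1) \<le> exp (- (real k * p * (1 - real k * p))) ^ (N - k - r - 1)"
          using \<tau>0 by (intro power_mono)
        also have "\<dots> = exp (- (real k * p * (1 - real k * p) * real (N - k - r - 1)))"
          by (simp add: exp_of_nat_mult[symmetric] mult_ac)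
        also have "\<dots> \<le> exp (- (real k * p * (1 - real k * p) * (real n - 4 * real k)))"
        proof -
          have "r \<le> k" using r by auto
          then have "real n - 4 * real k \<le> real (N - k - r - 1)" using N k by linarith
          then show ?thesis using p0 kp1 by (simp add: mult_left_mono)
        qed
        also have "\<dots> \<le> exp (- (real k * ((1 - \<epsilon>) * \<mu>)))"
        proof -
          have "1 - \<epsilon> \<le> 1 - real k * p - 4 * (real k / real n)" using kp by simp
          also have "\<dots> \<le> (1 - real k * p) * (1 - 4 * (real k / real n))"
          proof -
            have "1 - a - b \<le> (1 - a) * (1 - b)" if "0 \<le> a * b" for a b :: real
              using that by (simp add: algebra_simps)
            then show ?thesis using p0 by simp
          qed
          finally have "real k * \<mu> * (1 - \<epsilon>) \<le> real k * \<mu> * ((1 - real k * p) * (1 - 4 * (real k / real n)))"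
            using \<mu>(3) by (intro mult_left_mono) auto
          also have "\<dots> = real k * p * (1 - real k * p) * (real n - 4 * real k)"
            using n by (simp add: \<mu>_def field_simps)
          finally show ?thesis by (simp add: mult_ac)
        qed
        also have "\<dots> = exp (- (1 - \<epsilon>) * \<mu>) ^ k"
          by (simp add: exp_of_nat_mult[symmetric] algebra_simps)
        finally show ?thesis .
      qed
      define S where "S = (\<Sum>b\<le>r. real (k\<^sup>2 choose b) * p ^ b * (real (N choose (r - b)) * (real (k\<^sup>2) * p\<^sup>2) ^ (r - b)))"
      have S: "S \<le> (2 * real k ^ 2 * \<mu>\<^sup>2 / real n) ^ r / fact r"
      proof -
        have "S \<le> (real (k\<^sup>2) * p + real N * (real (k\<^sup>2) * p\<^sup>2)) ^ r / fact r"
          unfolding S_def using p0 by (intro sum_two_binomials_le) auto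
        also have "\<dots> \<le> (2 * real k ^ 2 * \<mu>\<^sup>2 / real n) ^ r / fact r"
        proof (intro divide_right_mono power_mono)
          have "real N * (real (k\<^sup>2) * p\<^sup>2) \<le> real n * (real (k\<^sup>2) * p\<^sup>2)" using N by (intro mult_right_mono) auto
          moreover have "real n * (real (k\<^sup>2) * p\<^sup>2) = real k ^ 2 * \<mu>\<^sup>2 / real n"
            using n by (simp add: \<mu>_def power2_eq_square field_simps)
          moreover have "real (k\<^sup>2) * p = real k ^ 2 * \<mu> / real n" using n by (simp add: \<mu>_def)
          moreover have "real k ^ 2 * \<mu> / real n \<le> real k ^ 2 * \<mu>\<^sup>2 / real n"
            using \<mu>(3) by (intro divide_right_mono mult_left_mono) (auto simp: power2_eq_square)
          ultimately show "real (k\<^sup>2) * p + real N * (real (k\<^sup>2) * p\<^sup>2) \<le> 2 * real k ^ 2 * \<mu>\<^sup>2 / real n"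
            by simp
        qed (use p0 in auto)
        finally show ?thesis .
      qed
      have S0: "0 \<le> S" unfolding S_def using p0 by (intro sum_nonneg) auto
      \<comment> \<open>Bernoulli's inequality turns even this prefactor into a \<open>k\<close>-th
        power, so that it can be absorbed row by row.\<close>
      have kl: "1 + real N * (real k * p) \<le> (1 + \<mu>) ^ k"
      proof -
        have "real N * (real k * p) \<le> real n * (real k * p)" using N p0 by (intro mult_right_mono) auto
        then have "1 + real N * (real k * p) \<le> 1 + real k * \<mu>" by (simp add: \<mu>_def mult_ac)
        also have "\<dots> \<le> (1 + \<mu>) ^ k" using \<mu>(3) by (intro Bernoulli_inequality) auto
        finally show ?thesis .
      qed
      have "real (N choose k) * (\<Sum>b\<le>r. real (k\<^sup>2 choose b) * p ^ b * (real (N choose (r - b)) * (real (k\<^sup>2) * p\<^sup>2) ^ (r - b) *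
          ((1 + real N * (real k * p)) * \<tau> ^ (N - k - r - 1)))) =
          real (N choose k) * S * ((1 + real N * (real k * p)) * \<tau> ^ (N - k - r - 1))"
        by (simp add: S_def sum_distrib_right mult.assoc)
      also have "\<dots> \<le> (real n ^ k / fact k * ((2 * real k ^ 2 * \<mu>\<^sup>2 / real n) ^ r / fact r)) *
          ((1 + \<mu>) ^ k * exp (- (1 - \<epsilon>) * \<mu>) ^ k)"
      proof (intro mult_mono S kl \<tau>)
        show "real (N choose k) \<le> real n ^ k / fact k"
          using binomial_le_power_div_fact[of n k] binomial_right_mono[OF N(2), of k] by linarith
      qed (use S0 p0 \<tau>0 \<mu>(3) in auto)
      also have "\<dots> \<le> (real n ^ (k - r) * (2 * \<mu>\<^sup>2 * exp 2) ^ k) * ((1 + \<mu>) ^ k * exp (- (1 - \<epsilon>) * \<mu>) ^ k)"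
        by (intro mult_right_mono small_sets_factorial_bound) (use k n r \<mu>(3) in auto)
      also have "\<dots> = real n ^ (k - r) * ((2 * \<mu>\<^sup>2 * exp 2 * (1 + \<mu>)) * exp (- (1 - \<epsilon>) * \<mu>)) ^ k"
        by (simp add: power_mult_distrib mult_ac)
      also have "\<dots> \<le> real n ^ (k - r) * (real n powr (- c * (1 - 2 * \<epsilon>))) ^ k"
      proof (intro mult_left_mono power_mono)
        have "(2 * \<mu>\<^sup>2 * exp 2 * (1 + \<mu>)) * exp (- (1 - \<epsilon>) * \<mu>) \<le> exp (\<epsilon> * \<mu>) * exp (- (1 - \<epsilon>) * \<mu>)"
          by (intro mult_right_mono \<mu>) auto
        also have "\<dots> = exp (- (\<mu> * (1 - 2 * \<epsilon>)))" by (simp add: exp_add[symmetric] algebra_simps)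
        also have "\<dots> \<le> exp (- (c * ln (real n) * (1 - 2 * \<epsilon>)))"
          using c\<mu> assms by (simp add: mult_right_mono)
        also have "\<dots> = real n powr (- c * (1 - 2 * \<epsilon>))" using n by (simp add: powr_def mult_ac)
        finally show "(2 * \<mu>\<^sup>2 * exp 2 * (1 + \<mu>)) * exp (- (1 - \<epsilon>) * \<mu>) \<le> real n powr (- c * (1 - 2 * \<epsilon>))" .
      qed (use \<mu>(3) in auto)
      finally show "real (N choose k) * (\<Sum>b\<le>r. real (k\<^sup>2 choose b) * p ^ b * (real (N choose (r - b)) * (real (k\<^sup>2) * p\<^sup>2) ^ (r - b) *
          ((1 + real N * (real k * p)) * (1 - real k * p * (1 - p) ^ (k - 1)) ^ (N - k - r - 1))))
        \<le> real n ^ (k - r) * (real n powr (- c * (1 - 2 * \<epsilon>))) ^ k"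
        unfolding \<tau>_def .
    qed
  qed
qed


section \<open>Typical matrices\<close>

lemma prob_weighted_markov:
  assumes fin: "finite I" and "\<And>x. P x \<Longrightarrow> a \<le> (\<Sum>i\<in>I. h i * of_bool (A i x))" and h: "\<And>i. i \<in> I \<Longrightarrow> 0 \<le> h i"
  shows "a * prob M {x. P x} \<le> (\<Sum>i\<in>I. h i * prob M {x. A i x})"
proof -
  have int: "integrable (measure_pmf M) (\<lambda>x. indicator S x :: real)" for S
    by (rule measure_pmf.integrable_const_bound[where B = 1]) auto
  have "a * prob M {x. P x} = measure_pmf.expectation M (\<lambda>x. a * indicator {x. P x} x)" by simp
  also have "\<dots> \<le> measure_pmf.expectation M (\<lambda>x. \<Sum>i\<in>I. h i * indicator {x. A i x} x)"
  proof (intro integral_mono)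
    fix x
    show "a * indicator {x. P x} x \<le> (\<Sum>i\<in>I. h i * indicator {x. A i x} x)"
    proof (cases "P x")
      case True
      then show ?thesis using assms(2)[of x] by (simp add: indicator_def of_bool_def)
    next
      case False
      then show ?thesis using h by (auto intro!: sum_nonneg simp: indicator_def)
    qed
  qed (auto intro!: integrable_mult_right Bochner_Integration.integrable_sum int)
  also have "\<dots> = (\<Sum>i\<in>I. h i * prob M {x. A i x})"
    by (subst Bochner_Integration.integral_sum) (auto intro!: integrable_mult_right int)
  finally show ?thesis .
qed

text \<open>Each \<open>T\<close> must satisfy both conditions, so the better bound may be used:
  orthogonality of columns when \<open>ln (n / k) \<le> n * p / 640\<close>, counting of doubly
  touched columns otherwise. The cases cover every \<open>k\<close> up to
  \<open>\<delta> * n\<close>.\<close>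

lemma expected_sparse_sets:
  assumes "c > 0" "0 < \<epsilon>" "\<epsilon> < 1/2"
  shows "\<forall>\<^sub>F n in sequentially. \<forall>p V w k r. V \<subseteq> {..<n} \<and> n - 1 \<le> card V \<and>
    c * ln (real n) / real n < p \<and> p \<le> 1/2 \<and> (\<forall>t<n. \<forall>u<n. t \<noteq> u \<longrightarrow> w t u \<noteq> 0) \<and>
    0 < k \<and> real k \<le> \<delta> * real n \<and> (r = k \<or> r = k - 1) \<longrightarrow>
    (\<Sum>T\<in>{T. T \<subseteq> V \<and> card T = k}. prob (bern (edges n) p)
      {\<xi>. nearly_dependent V (wmat w \<xi>) T \<and> covers_sparsely V (wmat w \<xi>) T r}) \<le>
    1 / real n ^ 2 + real n ^ (k - r) * (real n powr (- c * (1 - 2 * \<epsilon>))) ^ k"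
  using medium_sets_estimate[OF assms(1)] small_sets_estimate[OF assms] eventually_ge_at_top[of 10]
proof eventually_elim
  case (elim n)
  show ?case
  proof (intro allI impI, elim conjE)
    fix p :: real and V :: "nat set" and w :: "nat \<Rightarrow> nat \<Rightarrow> complex" and k r :: nat
    assume V: "V \<subseteq> {..<n}" "n - 1 \<le> card V" and p: "c * ln (real n) / real n < p" "p \<le> 1/2"
      and nz: "\<forall>t<n. \<forall>u<n. t \<noteq> u \<longrightarrow> w t u \<noteq> 0"
      and k: "0 < k" "real k \<le> \<delta> * real n" and r: "r = k \<or> r = k - 1"
    let ?P = "\<lambda>T. prob (bern (edges n) p) {\<xi>. nearly_dependent V (wmat w \<xi>) T \<and> covers_sparsely V (wmat w \<xi>) T r}"
    have fV: "finite V" using V finite_subset by auto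
    have N: "card V \<le> n" using card_mono[OF _ V(1)] by simp
    have "0 \<le> c * ln (real n) / real n" using assms elim(3) by simp
    then have p0: "p > 0" using p by linarith
    have count: "card {T. T \<subseteq> V \<and> card T = k} = card V choose k" using fV by (rule n_subsets)
    show "(\<Sum>T\<in>{T. T \<subseteq> V \<and> card T = k}. ?P T) \<le>
      1 / real n ^ 2 + real n ^ (k - r) * (real n powr (- c * (1 - 2 * \<epsilon>))) ^ k"
    proof (cases "ln (real n / real k) \<le> real n * p / 640")
      case True
      have "2 * k + 1 \<le> card V" using k(2) V(2) elim(3) unfolding \<delta>_def by linarith
      then have "?P T \<le> real (card V) * (real (card V choose k) * atom_bound k p ^ (card V - 2 * k - 1))"
        if "T \<in> {T. T \<subseteq> V \<and> card T = k}" for T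
      proof -
        have T: "T \<subseteq> V" "card T = k" "T \<noteq> {}" using that k by auto
        have "?P T \<le> prob (bern (edges n) p) {\<xi>. nearly_dependent V (wmat w \<xi>) T}" by (rule prob_mono) auto
        also have "\<dots> \<le> real (card V) * (real (card V choose k) * atom_bound k p ^ (card V - 2 * k - 1))"
          using prob_nearly_dependent_le[OF V(1) T(1,3) p0 p(2), of w] nz \<open>2 * k + 1 \<le> card V\<close>
          unfolding T(2) by blast
        finally show ?thesis .
      qed
      then have "(\<Sum>T\<in>{T. T \<subseteq> V \<and> card T = k}. ?P T) \<le>
          real (card {T. T \<subseteq> V \<and> card T = k}) * (real (card V) * (real (card V choose k) * atom_bound k p ^ (card V - 2 * k - 1)))"
        by (rule sum_bounded_above)
      also have "\<dots> \<le> 1 / real n ^ 2"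
        unfolding count by (rule elim(1)[rule_format]) (use V N p k True in auto)
      finally show ?thesis by (rule order.trans) simp
    next
      case False
      let ?B = "\<Sum>b\<le>r. real (k\<^sup>2 choose b) * p ^ b * (real (card V choose (r - b)) * (real (k\<^sup>2) * p\<^sup>2) ^ (r - b) *
        ((1 + real (card V) * (real k * p)) * (1 - real k * p * (1 - p) ^ (k - 1)) ^ (card V - k - r - 1)))"
      have "?P T \<le> ?B" if "T \<in> {T. T \<subseteq> V \<and> card T = k}" for T
      proof -
        have T: "T \<subseteq> V" "card T = k" "T \<noteq> {}" using that k by auto
        have "?P T \<le> prob (bern (edges n) p) {\<xi>. covers_sparsely V (wmat w \<xi>) T r}" by (rule prob_mono) auto
        also have "\<dots> \<le> ?B"
          using prob_covers_sparsely_le[OF V(1) T(1,3) p0 p(2), of w r] nz unfolding T(2) by blast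
        finally show ?thesis .
      qed
      then have "(\<Sum>T\<in>{T. T \<subseteq> V \<and> card T = k}. ?P T) \<le> real (card {T. T \<subseteq> V \<and> card T = k}) * ?B"
        by (rule sum_bounded_above)
      also have "\<dots> \<le> real n ^ (k - r) * (real n powr (- c * (1 - 2 * \<epsilon>))) ^ k"
        unfolding count by (rule elim(2)[rule_format]) (use V N p k False r in auto)
      finally show ?thesis by (rule order.trans) simp
    qed
  qed
qed

definition small_dependent_rows :: "nat \<Rightarrow> nat set \<Rightarrow> (nat \<Rightarrow> nat \<Rightarrow> complex) \<Rightarrow> nat set" where
  "small_dependent_rows s V M = \<Union>{T. T \<subseteq> V \<and> 0 < card T \<and> card T < s \<and> nearly_dependent V M T \<and>
     covers_sparsely V M T (card T - 1)}"

text \<open>Below size \<open>s\<close> a sparse cover with \<open>k - 1\<close> doubly touched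
  columns cannot be excluded, so the second clause only limits the rows involved; the third excludes
  covers with \<open>k\<close> such columns. The thresholds use \<open>n\<close> also when
  \<open>V\<close> has \<open>n - 1\<close> elements, so that the matrix and its minors share
  them.\<close>

definition typical :: "nat \<Rightarrow> nat \<Rightarrow> nat set \<Rightarrow> (nat \<Rightarrow> nat \<Rightarrow> complex) \<Rightarrow> bool" where
  "typical s n V M \<longleftrightarrow>
     (\<forall>T\<subseteq>V. s \<le> card T \<and> real (card T) \<le> \<delta> * real n \<longrightarrow>
        \<not> (nearly_dependent V M T \<and> covers_sparsely V M T (card T - 1))) \<and>
     10 * card (small_dependent_rows s V M) \<le> n \<and>
     (\<forall>T\<subseteq>V. 0 < card T \<and> card T < s \<longrightarrow> \<not> (nearly_dependent V M T \<and> covers_sparsely V M T (card T)))"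

lemma geometric_tail_le:
  fixes x :: real
  assumes "0 \<le> x" "x \<le> 1/2"
  shows "(\<Sum>k\<in>{s..m}. x ^ k) \<le> 2 * x ^ s"
proof -
  have "(1 - x) * (\<Sum>k=s..m. x ^ k) \<le> x ^ s"
    using assms by (cases "m < s") (auto simp: sum_gp_multiplied)
  moreover have "(\<Sum>k=s..m. x ^ k) \<ge> 0" using assms by (intro sum_nonneg) auto
  moreover have "1/2 * (\<Sum>k=s..m. x ^ k) \<le> (1 - x) * (\<Sum>k=s..m. x ^ k)"
    using assms calculation(2) by (intro mult_right_mono) auto
  ultimately show ?thesis by linarith
qed

lemma typical_whp:
  assumes "s > 0" "c > 1 / real s"
  shows "\<forall>\<^sub>F n in sequentially. \<forall>p V w. V \<subseteq> {..<n} \<and> n - 1 \<le> card V \<and>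
    c * ln (real n) / real n < p \<and> p \<le> 1/2 \<and> (\<forall>t<n. \<forall>u<n. t \<noteq> u \<longrightarrow> w t u \<noteq> 0) \<longrightarrow>
    prob (bern (edges n) p) {\<xi>. \<not> typical s n V (wmat w \<xi>)} \<le> ln (real n) powr (- 1/4)"
proof -
  have c0: "c > 0" and cs: "c * real s > 1"
    using assms by (auto simp: field_simps intro: less_trans[of 0 "1 / real s" c])
  have s0: "real s > 0" using assms by simp
  \<comment> \<open>Chosen so that \<open>c' * s = (c * s + 1) / 2\<close>, halfway between 1 and
    \<open>c * s\<close>: the loss \<open>2 * \<epsilon>\<close> still leaves an exponent above
    1.\<close>
  define \<epsilon> where "\<epsilon> = (1 - 1 / (c * real s)) / 4"
  have \<epsilon>: "0 < \<epsilon>" "\<epsilon> < 1/2" using cs c0 assms(1) by (auto simp: \<epsilon>_def field_simps)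
  define c' where "c' = c * (1 - 2 * \<epsilon>)"
  have c's: "c' * real s > 1"
  proof -
    have "c' * real s = (c * real s + 1) / 2" using c0 assms(1) by (simp add: c'_def \<epsilon>_def field_simps)
    then show ?thesis using cs by simp
  qed
  have c'0: "c' > 0" using c0 \<epsilon> by (simp add: c'_def)
  define \<gamma> where "\<gamma> = c' * real s - 1"
  have \<gamma>: "\<gamma> > 0" using c's by (simp add: \<gamma>_def)
  have "\<forall>\<^sub>F n::nat in sequentially. 1 / real n \<le> ln (real n) powr (- 1/4) / 4" by real_asymp
  moreover have "\<forall>\<^sub>F n::nat in sequentially. 2 * real n powr (- \<gamma>) \<le> ln (real n) powr (- 1/4) / 4"
    using \<gamma> by real_asymp
  moreover have "\<forall>\<^sub>F n::nat in sequentially. real s * (1 / real n ^ 2) \<le> ln (real n) powr (- 1/4) / 8"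
    using s0 by real_asymp
  moreover have "\<forall>\<^sub>F n::nat in sequentially. real s * real n powr (- c') \<le> ln (real n) powr (- 1/4) / 8"
    using c'0 s0 by real_asymp
  moreover have "\<forall>\<^sub>F n::nat in sequentially. 10 / real n * (real s * (real s * (1 / real n ^ 2))) \<le> ln (real n) powr (- 1/4) / 8"
    using s0 by real_asymp
  moreover have "\<forall>\<^sub>F n::nat in sequentially. 10 / real n * (real s * (real s * (real n * real n powr (- c')))) \<le> ln (real n) powr (- 1/4) / 8"
    using c'0 s0 by real_asymp
  moreover have "\<forall>\<^sub>F n::nat in sequentially. real n powr (- c') \<le> 1/2" using c'0 by real_asymp
  moreover have "\<forall>\<^sub>F n::nat in sequentially. \<delta> * real n \<ge> real s"
    unfolding \<delta>_def by real_asymp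
  ultimately show ?thesis
    using expected_sparse_sets[OF c0 \<epsilon>] eventually_ge_at_top[of 10]
  proof eventually_elim
    case (elim n)
    show ?case
    proof (intro allI impI, elim conjE)
      fix p :: real and V :: "nat set" and w :: "nat \<Rightarrow> nat \<Rightarrow> complex"
      assume V: "V \<subseteq> {..<n}" "n - 1 \<le> card V" and p: "c * ln (real n) / real n < p" "p \<le> 1/2"
        and nz: "\<forall>t<n. \<forall>u<n. t \<noteq> u \<longrightarrow> w t u \<noteq> 0"
      let ?P = "bern (edges n) p"
      have fV: "finite V" using V finite_subset by auto
      define x where "x = real n powr (- c')"
      have x: "0 \<le> x" "x \<le> 1/2" using elim(7) by (auto simp: x_def)
      define A where "A T r \<xi> \<longleftrightarrow> nearly_dependent V (wmat w \<xi>) T \<and> covers_sparsely V (wmat w \<xi>) T r" for T r \<xi>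
      define K where "K k = {T. T \<subseteq> V \<and> card T = k}" for k
      have fK: "finite (K k)" for k using fV by (simp add: K_def)
      have n: "real n \<ge> 10" using elim(10) by simp
      have bound: "(\<Sum>T\<in>K k. prob ?P {\<xi>. A T r \<xi>}) \<le> 1 / real n ^ 2 + real n ^ (k - r) * x ^ k"
        if "0 < k" "real k \<le> \<delta> * real n" "r = k \<or> r = k - 1" for k r
        using elim(9)[rule_format, of V p w k r] V p nz that by (simp add: A_def K_def x_def c'_def)
      have sk: "real k \<le> \<delta> * real n" if "k < s" for k
        using that elim(8) by (simp add: \<delta>_def)
      have xk: "x ^ k \<le> x" if "k > 0" for k
        using power_decreasing[of 1 k x] that x by simp
      define m where "m = nat \<lfloor>\<delta> * real n\<rfloor>"
      have mn: "m \<le> n" by (simp add: m_def \<delta>_def) linarith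
      have m: "real k \<le> \<delta> * real n \<longleftrightarrow> k \<le> m" for k
      proof -
        have "\<delta> * real n \<ge> 0" by (simp add: \<delta>_def)
        then show ?thesis unfolding m_def by (simp add: le_nat_iff le_floor_iff)
      qed
      define E1 where "E1 \<xi> \<longleftrightarrow> (\<exists>k\<in>{s..m}. \<exists>T\<in>K k. A T (k - 1) \<xi>)" for \<xi>
      define E2 where "E2 \<xi> \<longleftrightarrow> n < 10 * card (small_dependent_rows s V (wmat w \<xi>))" for \<xi>
      define E3 where "E3 \<xi> \<longleftrightarrow> (\<exists>k\<in>{1..<s}. \<exists>T\<in>K k. A T k \<xi>)" for \<xi>
      have "prob ?P {\<xi>. E1 \<xi>} \<le> (\<Sum>k\<in>{s..m}. \<Sum>T\<in>K k. prob ?P {\<xi>. A T (k - 1) \<xi>})"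
        unfolding E1_def
        by (rule order.trans[OF prob_UN_le]) (auto intro!: sum_mono prob_UN_le fK)
      also have "\<dots> \<le> (\<Sum>k\<in>{s..m}. 1 / real n ^ 2 + real n * x ^ k)"
      proof (rule sum_mono)
        fix k assume "k \<in> {s..m}"
        then show "(\<Sum>T\<in>K k. prob ?P {\<xi>. A T (k - 1) \<xi>}) \<le> 1 / real n ^ 2 + real n * x ^ k"
          using bound[of k "k - 1"] assms(1) m[of k] by simp
      qed
      also have "\<dots> = real (card {s..m}) * (1 / real n ^ 2) + real n * (\<Sum>k\<in>{s..m}. x ^ k)"
        by (simp add: sum.distrib sum_distrib_left)
      also have "\<dots> \<le> real n * (1 / real n ^ 2) + real n * (2 * x ^ s)"
        using mn assms(1) by (intro add_mono mult_right_mono mult_left_mono geometric_tail_le x) auto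
      also have "real n * (1 / real n ^ 2) = 1 / real n" using n by (simp add: power2_eq_square)
      also have "real n * (2 * x ^ s) = 2 * real n powr (- \<gamma>)"
      proof -
        have "x ^ s = real n powr (- (c' * real s))" using n by (simp add: x_def powr_powr flip: powr_realpow)
        then have "real n * x ^ s = real n powr (1 + - (c' * real s))"
          using n by (subst powr_add) simp
        then show ?thesis by (simp add: \<gamma>_def)
      qed
      finally have P1: "prob ?P {\<xi>. E1 \<xi>} \<le> 1 / real n + 2 * real n powr (- \<gamma>)" .
      have "prob ?P {\<xi>. E3 \<xi>} \<le> (\<Sum>k\<in>{1..<s}. \<Sum>T\<in>K k. prob ?P {\<xi>. A T k \<xi>})"
        unfolding E3_def
        by (rule order.trans[OF prob_UN_le]) (auto intro!: sum_mono prob_UN_le fK)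
      also have "\<dots> \<le> (\<Sum>k\<in>{1..<s}. 1 / real n ^ 2 + x)"
      proof (rule sum_mono)
        fix k assume "k \<in> {1..<s}"
        then show "(\<Sum>T\<in>K k. prob ?P {\<xi>. A T k \<xi>}) \<le> 1 / real n ^ 2 + x"
          using bound[of k k] sk[of k] xk[of k] by simp
      qed
      also have "\<dots> \<le> real s * (1 / real n ^ 2 + x)"
        using x by (simp only: sum_constant) (intro mult_right_mono; simp)
      finally have P3: "prob ?P {\<xi>. E3 \<xi>} \<le> real s * (1 / real n ^ 2 + x)" .
      define I where "I = (SIGMA k:{1..<s}. K k)"
      have fI: "finite I" using fK by (auto simp: I_def)
      \<comment> \<open>Markov's inequality with each set weighted by its size, since a union has at
        most as many elements as the sizes add up to.\<close>
      have "real n / 10 * prob ?P {\<xi>. E2 \<xi>} \<le> (\<Sum>(k, T)\<in>I. real k * prob ?P {\<xi>. A T (k - 1) \<xi>})"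
        unfolding case_prod_unfold
      proof (rule prob_weighted_markov[OF fI])
        fix \<xi> assume "E2 \<xi>"
        let ?Ts = "{T. T \<subseteq> V \<and> 0 < card T \<and> card T < s \<and> A T (card T - 1) \<xi>}"
        have fT: "finite ?Ts" using fV by auto
        have "card (small_dependent_rows s V (wmat w \<xi>)) = card (\<Union>?Ts)"
          by (simp add: small_dependent_rows_def A_def)
        also have "\<dots> \<le> sum card ?Ts"
          by (rule card_Union_le_sum_card)
        finally have "n \<le> 10 * sum card ?Ts" using \<open>E2 \<xi>\<close> unfolding E2_def by linarith
        then have "real n \<le> 10 * real (sum card ?Ts)"
          using of_nat_mono[of n "10 * sum card ?Ts", where ?'a = real] by (simp only: of_nat_mult of_nat_numeral)
        then have "real n / 10 \<le> real (sum card ?Ts)" by linarith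
        also have "\<dots> = (\<Sum>T\<in>?Ts. real (card T) * of_bool (A T (card T - 1) \<xi>))" by simp
        also have "\<dots> = (\<Sum>i\<in>(\<lambda>T. (card T, T)) ` ?Ts. real (fst i) * of_bool (A (snd i) (fst i - 1) \<xi>))"
          by (subst sum.reindex) (auto simp: inj_on_def)
        also have "\<dots> \<le> (\<Sum>i\<in>I. real (fst i) * of_bool (A (snd i) (fst i - 1) \<xi>))"
          by (rule sum_mono2[OF fI]) (auto simp: I_def K_def)
        finally show "real n / 10 \<le> (\<Sum>i\<in>I. real (fst i) * of_bool (A (snd i) (fst i - 1) \<xi>))" .
      qed auto
      also have "\<dots> = (\<Sum>k\<in>{1..<s}. real k * (\<Sum>T\<in>K k. prob ?P {\<xi>. A T (k - 1) \<xi>}))"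
        unfolding I_def using fK by (subst sum.Sigma[symmetric]) (auto simp: sum_distrib_left)
      also have "\<dots> \<le> (\<Sum>k\<in>{1..<s}. real s * (1 / real n ^ 2 + real n * x))"
      proof (rule sum_mono, rule mult_mono)
        fix k assume k: "k \<in> {1..<s}"
        then show "real k \<le> real s" by simp
        have "real n * x ^ k \<le> real n * x" using k by (intro mult_left_mono xk) auto
        then show "(\<Sum>T\<in>K k. prob ?P {\<xi>. A T (k - 1) \<xi>}) \<le> 1 / real n ^ 2 + real n * x"
          using bound[of k "k - 1"] sk[of k] k by simp
      qed (auto intro!: sum_nonneg)
      also have "\<dots> \<le> real s * (real s * (1 / real n ^ 2 + real n * x))"
        using x by (simp only: sum_constant) (intro mult_right_mono; simp)
      finally have "prob ?P {\<xi>. E2 \<xi>} \<le> 10 / real n * (real s * (real s * (1 / real n ^ 2 + real n * x)))"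
        using n by (simp add: field_simps)
      note P2 = this
      have "prob ?P {\<xi>. \<not> typical s n V (wmat w \<xi>)} \<le> prob ?P {\<xi>. E1 \<xi> \<or> E2 \<xi> \<or> E3 \<xi>}"
      proof (rule prob_mono)
        fix \<xi> assume "\<not> typical s n V (wmat w \<xi>)"
        then consider
            T where "T \<subseteq> V" "s \<le> card T" "real (card T) \<le> \<delta> * real n" "A T (card T - 1) \<xi>"
          | "\<not> 10 * card (small_dependent_rows s V (wmat w \<xi>)) \<le> n"
          | T where "T \<subseteq> V" "0 < card T" "card T < s" "A T (card T) \<xi>"
          unfolding typical_def A_def by blast
        then show "E1 \<xi> \<or> E2 \<xi> \<or> E3 \<xi>"
        proof cases
          case 1
          then have "E1 \<xi>" unfolding E1_def using m[of "card T"]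
            by (intro bexI[of _ "card T"] bexI[of _ T]) (auto simp: K_def)
          then show ?thesis by simp
        next
          case 2
          then show ?thesis by (simp add: E2_def)
        next
          case 3
          then have "E3 \<xi>" unfolding E3_def
            by (intro bexI[of _ "card T"] bexI[of _ T]) (auto simp: K_def)
          then show ?thesis by simp
        qed
      qed
      also have "\<dots> \<le> prob ?P {\<xi>. E1 \<xi>} + (prob ?P {\<xi>. E2 \<xi>} + prob ?P {\<xi>. E3 \<xi>})"
        by (intro order.trans[OF prob_disj_le] add_left_mono prob_disj_le)
      also have "\<dots> \<le> ln (real n) powr (- 1/4)"
        using P1 P2 P3 elim(1-6) unfolding x_def by (simp only: distrib_left)
      finally show "prob ?P {\<xi>. \<not> typical s n V (wmat w \<xi>)} \<le> ln (real n) powr (- 1/4)" .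
    qed
  qed
qed


section \<open>The quadratic condition for a new row and column\<close>

text \<open>Decoupling by the Cauchy-Schwarz inequality, here as nonnegativity of a variance: given
  \<open>x\<close>, the copies \<open>y\<close> and \<open>y'\<close> are independent and both
  succeed with probability \<open>(h x)^2\<close>.\<close>

lemma prob_pair_square_le:
  "(prob (pair_pmf M N) {(x, y). R x y})\<^sup>2 \<le>
     prob (pair_pmf M (pair_pmf N N)) {(x, (y, y')). R x y \<and> R x y'}"
proof -
  define h where "h x = prob N {y. R x y}" for x
  have h: "0 \<le> h x" "h x \<le> 1" for x by (auto simp: h_def)
  have h_eq: "h = (\<lambda>x. prob N {y. R x y})" by (simp add: h_def fun_eq_iff)
  then have int: "integrable (measure_pmf M) h" by simp
  have int2: "integrable (measure_pmf M) (\<lambda>x. (h x)\<^sup>2)"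
    by (rule measure_pmf.integrable_const_bound[where B = 1]) (use h in \<open>auto simp: power_le_one\<close>)
  have sq: "prob (pair_pmf N N) {(y, y'). R x y \<and> R x y'} = (h x)\<^sup>2" for x
  proof -
    have "prob (pair_pmf N N) {(y, y'). R x y \<and> R x y'} =
        measure_pmf.expectation N (\<lambda>y. prob N {y'. R x y \<and> R x y'})" by (rule prob_pair)
    also have "(\<lambda>y. prob N {y'. R x y \<and> R x y'}) = (\<lambda>y. indicator {y. R x y} y * h x)"
      by (auto simp: h_def indicator_def fun_eq_iff)
    also have "measure_pmf.expectation N (\<lambda>y. indicator {y. R x y} y * h x) = h x * h x"
      by (simp add: h_def)
    finally show ?thesis by (simp add: power2_eq_square)
  qed
  have "(prob (pair_pmf M N) {(x, y). R x y})\<^sup>2 = (measure_pmf.expectation M h)\<^sup>2"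
    unfolding prob_pair h_eq ..
  also have "\<dots> \<le> measure_pmf.expectation M (\<lambda>x. (h x)\<^sup>2)"
    using measure_pmf.variance_positive[of M h] measure_pmf.variance_eq[OF int int2] by linarith
  also have "\<dots> = prob (pair_pmf M (pair_pmf N N)) {(x, z). R x (fst z) \<and> R x (snd z)}"
    by (subst prob_pair) (simp only: sq[symmetric] case_prod_unfold)
  finally show ?thesis by (simp add: case_prod_unfold)
qed

text \<open>By typicality every short circuit lies in \<open>Z\<close>, so no kernel vector is
  nonzero at an index outside \<open>Z\<close> and the unit equation is solvable there. A sparse
  solution is either long or supported in \<open>Z\<close>. Independence permits at most
  \<open>card Z\<close> of the latter, so all but \<open>2 * card Z\<close> indices are good, and
  \<open>10 * card Z \<le> n\<close> leaves at least half of \<open>n\<close>.\<close>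

lemma many_large_unit_solutions:
  assumes fin: "finite V" and sym: "\<And>s t. s \<in> V \<Longrightarrow> t \<in> V \<Longrightarrow> M s t = M t s"
    and tp: "typical s n V M" and N: "n - 1 \<le> card V" and n: "n \<ge> 10"
    and circ: "\<And>v. circuit V M v \<Longrightarrow> real (card (supp V v)) \<le> \<delta> * real n"
  shows "\<exists>u G. G \<subseteq> V \<and> real n / 2 \<le> real (card G) \<and>
    (\<forall>j\<in>G. solves_unit V M j (u j) \<and> \<delta> * real n < real (card (supp V (u j))))"
proof -
  define Z where "Z = small_dependent_rows s V M"
  have ZV: "Z \<subseteq> V" by (auto simp: Z_def small_dependent_rows_def)
  have fZ: "finite Z" using ZV fin finite_subset by auto
  have cZ: "10 * card Z \<le> n" using tp by (simp add: typical_def Z_def)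
  have sub: "T \<subseteq> Z" if "T \<subseteq> V" "T \<noteq> {}" "nearly_dependent V M T" "covers_sparsely V M T (card T - 1)"
    "real (card T) \<le> \<delta> * real n" for T
  proof -
    have "\<not> s \<le> card T" using tp that unfolding typical_def by blast
    moreover have "0 < card T" using that fin by (meson card_gt_0_iff finite_subset)
    ultimately show ?thesis using that by (auto simp: Z_def small_dependent_rows_def)
  qed
  have "\<exists>u. solves_unit V M j u \<and> (supp V u \<subseteq> Z \<or> \<delta> * real n < real (card (supp V u)))" if j: "j \<in> V - Z" for j
  proof -
    have "v j = 0" if v: "left_kernel V M v" for v
    proof (rule ccontr)
      assume "v j \<noteq> 0"
      then have "j \<in> supp V v" using j by (simp add: supp_def)
      from exists_circuit[OF fin v this]
      obtain v' where v': "circuit V M v'" "j \<in> supp V v'" by blast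
      have "supp V v' \<subseteq> Z"
        by (rule sub[OF supp_subset _ circuit_properties(1)[OF fin v'(1)] circuit_properties(3)[OF fin v'(1)] circ[OF v'(1)]])
           (use v' in auto)
      then show False using v' j by auto
    qed
    then have "\<exists>u. solves_unit V M j u" using j by (intro exists_solves_unit fin sym) auto
    from exists_sparse_solves_unit[OF fin _ this] j
    obtain u where u: "solves_unit V M j u" "supp V u \<noteq> {}" "nearly_dependent V M (supp V u)"
        "covers_sparsely V M (supp V u) (card (supp V u) - 1)" by blast
    show ?thesis using u sub[OF supp_subset u(2,3,4)] by (intro exI[of _ u]) force
  qed
  then have "\<exists>u. \<forall>j\<in>V - Z. solves_unit V M j (u j) \<and> (supp V (u j) \<subseteq> Z \<or> \<delta> * real n < real (card (supp V (u j))))"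
    by metis
  then obtain u where u: "\<forall>j\<in>V - Z. solves_unit V M j (u j) \<and> (supp V (u j) \<subseteq> Z \<or> \<delta> * real n < real (card (supp V (u j))))"
    by blast
  define G where "G = {j\<in>V - Z. \<delta> * real n < real (card (supp V (u j)))}"
  have "card (V - Z - G) \<le> card Z"
    by (rule card_solves_unit_le[OF fin _ ZV, of _ M u]) (use u in \<open>auto simp: G_def\<close>)
  moreover have "card (V - Z - G) = card V - card Z - card G"
    using ZV fin fZ by (subst card_Diff_subset) (auto simp: G_def card_Diff_subset)
  ultimately have "n - 1 \<le> 2 * card Z + card G" using N by linarith
  then have "5 * n \<le> 10 * card G" using cZ n by linarith
  then have "real n / 2 \<le> real (card G)" by linarith
  moreover have "G \<subseteq> V" by (auto simp: G_def)
  moreover have "\<forall>j\<in>G. solves_unit V M j (u j) \<and> \<delta> * real n < real (card (supp V (u j)))"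
    using u by (auto simp: G_def)
  ultimately show ?thesis by blast
qed

section \<open>Solvability of the bordered system\<close>

lemma bilinear_sym:
  fixes M :: "'i \<Rightarrow> 'i \<Rightarrow> complex"
  assumes "\<And>s t. s \<in> V \<Longrightarrow> t \<in> V \<Longrightarrow> M s t = M t s"
  shows "(\<Sum>a\<in>V. (\<Sum>t\<in>V. g t * M t a) * h a) = (\<Sum>a\<in>V. (\<Sum>t\<in>V. h t * M t a) * g a)"
proof -
  have "(\<Sum>a\<in>V. (\<Sum>t\<in>V. g t * M t a) * h a) = (\<Sum>a\<in>V. \<Sum>t\<in>V. g t * M t a * h a)"
    by (simp add: sum_distrib_right)
  also have "\<dots> = (\<Sum>t\<in>V. \<Sum>a\<in>V. g t * M t a * h a)" by (rule sum.swap)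
  also have "\<dots> = (\<Sum>t\<in>V. \<Sum>a\<in>V. h a * M a t * g t)"
    using assms by (intro sum.cong) (auto simp: mult_ac)
  also have "\<dots> = (\<Sum>t\<in>V. (\<Sum>a\<in>V. h a * M a t) * g t)"
    by (simp add: sum_distrib_right)
  finally show ?thesis .
qed

text \<open>The condition for the bordered matrix with new row \<open>y\<close> and corner \<open>m\<close> to have a kernel vector that does
  not vanish at the new index, normalised to \<open>-1\<close> there.\<close>

definition bordered :: "nat set \<Rightarrow> (nat \<Rightarrow> nat \<Rightarrow> complex) \<Rightarrow> complex \<Rightarrow> (nat \<Rightarrow> complex) \<Rightarrow> bool" where
  "bordered V M m y \<longleftrightarrow>
     (\<exists>g. (\<forall>a\<in>V. (\<Sum>t\<in>V. g t * M t a) = y a) \<and> (\<Sum>t\<in>V. y t * g t) = m)"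

text \<open>\<open>y\<close> is in the row space of a symmetric matrix, hence orthogonal to its
  kernel. This replaces the quadratic condition when the minor has a kernel vector of large
  support.\<close>

lemma bordered_orthogonal:
  assumes sym: "\<And>s t. s \<in> V \<Longrightarrow> t \<in> V \<Longrightarrow> M s t = M t s"
    and "bordered V M m y" "left_kernel V M v"
  shows "(\<Sum>t\<in>V. v t * y t) = 0"
proof -
  obtain g where g: "\<forall>a\<in>V. (\<Sum>t\<in>V. g t * M t a) = y a" using assms(2) unfolding bordered_def by blast
  have "(\<Sum>t\<in>V. v t * y t) = (\<Sum>a\<in>V. (\<Sum>t\<in>V. g t * M t a) * v a)"
    using g by (intro sum.cong) (auto simp: mult_ac)
  also have "\<dots> = (\<Sum>a\<in>V. (\<Sum>t\<in>V. v t * M t a) * g a)" by (rule bilinear_sym[OF sym])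
  also have "\<dots> = 0" using assms(3) by (simp add: left_kernel_def)
  finally show ?thesis .
qed

text \<open>Resampling the entries in \<open>U\<close> turns the quadratic condition into one that is linear in the others.\<close>

lemma bordered_resample:
  assumes fin: "finite V" and sym: "\<And>s t. s \<in> V \<Longrightarrow> t \<in> V \<Longrightarrow> M s t = M t s"
    and UV: "U \<subseteq> V" and u: "\<And>j. j \<in> U \<Longrightarrow> solves_unit V M j (u j)"
    and b: "bordered V M m y" "bordered V M m y'" and d: "\<And>t. t \<in> V \<Longrightarrow> y' t = y t + (if t \<in> U then d t else 0)"
  shows "(\<Sum>t\<in>V. y t * (2 * (\<Sum>j\<in>U. d j * u j t))) + (\<Sum>j\<in>U. d j * (\<Sum>k\<in>U. d k * u k j)) = 0"
proof -
  obtain g where g: "\<And>a. a \<in> V \<Longrightarrow> (\<Sum>t\<in>V. g t * M t a) = y a" "(\<Sum>t\<in>V. y t * g t) = m"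
    using b(1) unfolding bordered_def by blast
  obtain g' where g': "\<And>a. a \<in> V \<Longrightarrow> (\<Sum>t\<in>V. g' t * M t a) = y' a" "(\<Sum>t\<in>V. y' t * g' t) = m"
    using b(2) unfolding bordered_def by blast
  have fU: "finite U" using UV fin finite_subset by auto
  define h where "h t = (\<Sum>k\<in>U. d k * u k t)" for t
  have sum_d: "(\<Sum>t\<in>V. (if t \<in> U then d t else 0) * f t) = (\<Sum>j\<in>U. d j * f j)" for f
    using UV fin by (intro sum.mono_neutral_cong_right) auto
  have hM: "(\<Sum>t\<in>V. h t * M t a) = (if a \<in> U then d a else 0)" if "a \<in> V" for a
  proof -
    have "(\<Sum>t\<in>V. h t * M t a) = (\<Sum>k\<in>U. d k * (\<Sum>t\<in>V. u k t * M t a))"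
      unfolding h_def sum_distrib_right sum_distrib_left by (subst sum.swap) (simp add: mult.assoc)
    also have "\<dots> = (\<Sum>k\<in>U. if k = a then d k else 0)"
      using u that by (intro sum.cong) (auto simp: solves_unit_def)
    finally show ?thesis using fU by simp
  qed
  \<comment> \<open>As \<open>M\<close> may be singular, \<open>g\<close> is not unique; its values
    on \<open>U\<close> are nevertheless linear functions of \<open>y\<close>, because the unit
    equations there are solvable.\<close>
  have gj: "g j = (\<Sum>t\<in>V. y t * u j t)" if "j \<in> U" for j
  proof -
    have "(\<Sum>t\<in>V. y t * u j t) = (\<Sum>a\<in>V. (\<Sum>t\<in>V. g t * M t a) * u j a)" using g by simp
    also have "\<dots> = (\<Sum>a\<in>V. (\<Sum>t\<in>V. u j t * M t a) * g a)" by (rule bilinear_sym[OF sym])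
    also have "\<dots> = (\<Sum>a\<in>V. if a = j then g a else 0)"
      using u[OF that] by (intro sum.cong) (auto simp: solves_unit_def)
    also have "\<dots> = g j" using that UV fin by auto
    finally show ?thesis by simp
  qed
  define g'' where "g'' t = g t + h t" for t
  have g'': "(\<Sum>t\<in>V. g'' t * M t a) = y' a" if "a \<in> V" for a
    using that by (simp add: g''_def distrib_right sum.distrib g hM d)
  \<comment> \<open>By symmetry any solution for \<open>y'\<close> gives the same quadratic value,
    so \<open>g'\<close> may be exchanged for \<open>g''\<close>, which is \<open>g\<close> plus a
    term depending only on the change \<open>d\<close>.\<close>
  have "m = (\<Sum>a\<in>V. (\<Sum>t\<in>V. g'' t * M t a) * g' a)" using g' g'' by (simp cong: sum.cong)
  also have "\<dots> = (\<Sum>a\<in>V. (\<Sum>t\<in>V. g' t * M t a) * g'' a)" by (rule bilinear_sym[OF sym])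
  also have "\<dots> = (\<Sum>a\<in>V. y' a * g'' a)" using g' by simp
  also have "\<dots> = (\<Sum>a\<in>V. (y a + (if a \<in> U then d a else 0)) * g'' a)" using d by simp
  also have "\<dots> = (\<Sum>a\<in>V. y a * g'' a) + (\<Sum>j\<in>U. d j * g'' j)"
    by (simp only: distrib_right sum.distrib sum_d)
  also have "(\<Sum>a\<in>V. y a * g'' a) = m + (\<Sum>a\<in>V. y a * h a)"
    using g by (simp add: g''_def distrib_left sum.distrib)
  also have "(\<Sum>j\<in>U. d j * g'' j) = (\<Sum>j\<in>U. d j * (\<Sum>t\<in>V. y t * u j t)) + (\<Sum>j\<in>U. d j * h j)"
    by (simp add: g''_def distrib_left sum.distrib gj)
  also have "(\<Sum>j\<in>U. d j * (\<Sum>t\<in>V. y t * u j t)) = (\<Sum>t\<in>V. y t * h t)"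
    unfolding h_def sum_distrib_left by (subst sum.swap) (simp add: mult_ac)
  finally have "2 * (\<Sum>t\<in>V. y t * h t) + (\<Sum>j\<in>U. d j * h j) = 0" by simp
  moreover have "(\<Sum>t\<in>V. y t * (2 * h t)) = 2 * (\<Sum>t\<in>V. y t * h t)"
    by (simp add: sum_distrib_left mult_ac)
  ultimately show ?thesis by (simp add: h_def)
qed

text \<open>Double counting for an arbitrary \<open>U\<close> of \<open>h\<close> indices. Each
  loses at most \<open>h\<close> of its \<open>4 * h\<close> positions to \<open>U\<close>, leaving
  \<open>3 * h^2\<close> incidences. Positions outside \<open>B\<close> account for at most
  \<open>h^2\<close> of them, and each position in \<open>B\<close> for at most \<open>h\<close>, so
  \<open>B\<close> even has \<open>2 * h\<close> elements.\<close>

lemma exists_balanced_split: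
  fixes A :: "nat \<Rightarrow> nat \<Rightarrow> bool"
  assumes fin: "finite V" and GV: "G \<subseteq> V" and N: "card V \<le> n" and h: "h \<le> card G" "h > 0"
    and many: "\<And>j. j \<in> G \<Longrightarrow> 4 * h \<le> card {t\<in>V. A j t}"
  shows "\<exists>U\<subseteq>G. card U = h \<and> (\<exists>B\<subseteq>V - U. h \<le> card B \<and> (\<forall>t\<in>B. h * h \<le> n * card {j\<in>U. A j t}))"
proof -
  obtain U where U: "U \<subseteq> G" "card U = h" using h obtain_subset_with_card_n by metis
  have fU: "finite U" using U GV fin by (meson finite_subset)
  define B where "B = {t\<in>V - U. h * h \<le> n * card {j\<in>U. A j t}}"
  have "3 * h \<le> card {t\<in>V - U. A j t}" if "j \<in> U" for j
  proof -
    have "card {t\<in>V. A j t} \<le> card ({t\<in>V - U. A j t} \<union> U)" using fin fU by (intro card_mono) auto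
    also have "\<dots> \<le> card {t\<in>V - U. A j t} + h" using card_Un_le[of "{t\<in>V - U. A j t}" U] U by simp
    finally show ?thesis using many[of j] that U by auto
  qed
  then have "(\<Sum>j\<in>U. 3 * h) \<le> (\<Sum>j\<in>U. card {t\<in>V - U. A j t})" by (intro sum_mono) auto
  also have "\<dots> = card (SIGMA j:U. {t\<in>V - U. A j t})" using fU fin by simp
  also have "\<dots> = card (SIGMA t:V - U. {j\<in>U. A j t})"
    by (rule bij_betw_same_card[of prod.swap]) (auto simp: bij_betw_def inj_on_def)
  also have "\<dots> = (\<Sum>t\<in>V - U. card {j\<in>U. A j t})" using fU fin by simp
  finally have total: "h * (3 * h) \<le> (\<Sum>t\<in>V - U. card {j\<in>U. A j t})" using U by simp
  have "n * (\<Sum>t\<in>V - U. card {j\<in>U. A j t}) \<le> (\<Sum>t\<in>V - U. (if t \<in> B then n * h else 0) + h * h)"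
    unfolding sum_distrib_left
  proof (rule sum_mono)
    fix t assume t: "t \<in> V - U"
    have "card {j\<in>U. A j t} \<le> h" using card_mono[OF fU, of "{j\<in>U. A j t}"] U by auto
    then have "n * card {j\<in>U. A j t} \<le> n * h" by simp
    then show "n * card {j\<in>U. A j t} \<le> (if t \<in> B then n * h else 0) + h * h"
    proof (cases "t \<in> B")
      case True
      then show ?thesis using \<open>n * card {j\<in>U. A j t} \<le> n * h\<close> by (simp only: if_True)
    next
      case False
      then have "n * card {j\<in>U. A j t} < h * h" using t by (auto simp: B_def)
      then show ?thesis by simp
    qed
  qed
  also have "\<dots> = card B * (n * h) + card (V - U) * (h * h)"
  proof -
    have "(\<Sum>t\<in>V - U. if t \<in> B then n * h else 0) = (\<Sum>t\<in>B. n * h)"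
      using fin by (intro sum.mono_neutral_cong_right) (auto simp: B_def)
    then show ?thesis by (simp add: sum.distrib)
  qed
  also have "\<dots> \<le> card B * (n * h) + n * (h * h)"
    using N card_mono[OF fin, of "V - U"] by (intro add_left_mono mult_right_mono) auto
  finally have "n * (h * (3 * h)) \<le> card B * (n * h) + n * (h * h)"
    using mult_le_mono2[OF total, of n] by linarith
  then have "(n * h) * (2 * h) \<le> (n * h) * card B" by (simp add: algebra_simps)
  moreover have "n * h > 0"
  proof -
    have "U \<subseteq> V" using U GV by blast
    then have "h \<le> n" using card_mono[OF fin, of U] U N by linarith
    then show ?thesis using h by simp
  qed
  ultimately have "2 * h \<le> card B" by (simp add: mult_le_cancel1)
  then have "h \<le> card B" by simp
  then show ?thesis using U B_def by (intro exI[of _ U]) (auto intro!: exI[of _ B])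
qed

lemma prob_linear_le:
  assumes fin: "finite V" and p: "0 < p" "p \<le> 1/2" and a: "\<And>t. t \<in> V \<Longrightarrow> a t \<noteq> 0"
    and k: "0 < k" "k \<le> card (supp V v)"
  shows "prob (bern V p) {x. (\<Sum>t\<in>V. v t * (a t * of_bool (x t))) = z} \<le> 12 / sqrt (real k * p)"
proof -
  have "{t\<in>V. v t * a t \<noteq> 0} = supp V v" using a by (auto simp: supp_def)
  then show ?thesis
    using littlewood_offord[OF fin p k(1), of "\<lambda>t. v t * a t" z] k by (simp add: mult.assoc)
qed

text \<open>Littlewood-Offord is used twice after resampling \<open>U\<close>: over the new copy
  \<open>y'\<close>, to see that the linear condition rarely has few nonzero coefficients, and over
  the entries outside \<open>U\<close>, for that condition itself. The bounds
  \<open>2 * \<rho>\<close> and \<open>\<rho>\<close> add up to the constant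
  \<open>36 = 3 * 12\<close>.\<close>

lemma prob_bordered_le:
  assumes fin: "finite V" and sym: "\<And>s t. s \<in> V \<Longrightarrow> t \<in> V \<Longrightarrow> M s t = M t s"
    and p: "0 < p" "p \<le> 1/2" and a: "\<And>t. t \<in> V \<Longrightarrow> a t \<noteq> 0"
    and GV: "G \<subseteq> V" and u: "\<And>j. j \<in> G \<Longrightarrow> solves_unit V M j (u j)"
    and N: "card V \<le> n" and h: "h > 0" "h \<le> card G" "\<And>j. j \<in> G \<Longrightarrow> 4 * h \<le> card (supp V (u j))"
    and k: "0 < k" "k * n \<le> h * h" "2 * k \<le> h"
  shows "(prob (bern V p) {x. bordered V M m (\<lambda>t. a t * of_bool (x t))})\<^sup>2 \<le> 36 / sqrt (real k * p)"
proof -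
  have "\<exists>U\<subseteq>G. card U = h \<and> (\<exists>B\<subseteq>V - U. h \<le> card B \<and> (\<forall>t\<in>B. h * h \<le> n * card {j\<in>U. u j t \<noteq> 0}))"
    by (rule exists_balanced_split[OF fin GV N h(2,1)]) (use h(3) in \<open>simp add: supp_def\<close>)
  then obtain U B where U: "U \<subseteq> G" "card U = h" and B: "B \<subseteq> V - U" "h \<le> card B"
      "\<forall>t\<in>B. h * h \<le> n * card {j\<in>U. u j t \<noteq> 0}" by (elim exE conjE) (rule that)
  have UV: "U \<subseteq> V" using U GV by blast
  have fU: "finite U" using UV fin finite_subset by blast
  have fB: "finite B" using B fin by (meson finite_Diff finite_subset)
  have n: "n > 0" using N GV fin h U card_mono[OF fin UV] by linarith
  have kU: "k \<le> card {j\<in>U. u j t \<noteq> 0}" if "t \<in> B" for t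
  proof -
    have "n * k \<le> n * card {j\<in>U. u j t \<noteq> 0}" 
      using order.trans[OF k(2) bspec[OF B(3) that]] by (simp only: mult.commute)
    then show ?thesis using n by simp
  qed
  define M1 where "M1 = bern (V - U) p"
  define N1 where "N1 = bern U p"
  define \<rho> where "\<rho> = 12 / sqrt (real k * p)"
  have \<rho>: "\<rho> \<ge> 0" using p by (simp add: \<rho>_def)
  define vec where "vec x y = (\<lambda>t. a t * of_bool (override_on x y U t))" for x y :: "nat \<Rightarrow> bool"
  define dd where "dd z j = a j * (of_bool (snd z j) - of_bool (fst z j))" for z :: "(nat \<Rightarrow> bool) \<times> (nat \<Rightarrow> bool)" and j
  define cf where "cf z t = 2 * (\<Sum>j\<in>U. dd z j * u j t)" for z t
  define few where "few z \<longleftrightarrow> card {t\<in>V - U. cf z t \<noteq> 0} < k" for z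
  have cf0: "prob (pair_pmf N1 N1) {(y, y'). cf (y, y') t = 0} \<le> \<rho>" if t: "t \<in> B" for t
  proof -
    have "prob (pair_pmf N1 N1) {(y, y'). True \<and> cf (y, y') t = 0} \<le> \<rho> * prob N1 {y. True}"
    proof (rule prob_pair_le[OF _ \<rho>])
      fix y
      have "cf (y, y') t = 0 \<longleftrightarrow> (\<Sum>j\<in>U. u j t * (a j * of_bool (y' j))) = (\<Sum>j\<in>U. u j t * (a j * of_bool (y j)))" for y'
        by (simp add: cf_def dd_def algebra_simps sum_subtractf)
      moreover have "prob (bern U p) {y'. (\<Sum>j\<in>U. u j t * (a j * of_bool (y' j))) = z} \<le> \<rho>" for z
        unfolding \<rho>_def
        by (rule prob_linear_le[OF fU p _ k(1), of a "\<lambda>j. u j t"]) (use a UV kU[OF t] in \<open>auto simp: supp_def\<close>)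
      ultimately show "prob N1 {y'. cf (y, y') t = 0} \<le> \<rho>" by (simp add: N1_def)
    qed
    then show ?thesis by (simp add: measure_pmf.prob_space)
  qed
  \<comment> \<open>With fewer than \<open>k \<le> h / 2\<close> nonzero coefficients, at least half
    of those in \<open>B\<close> vanish. Each vanishes with probability at most
    \<open>\<rho>\<close>, so Markov's inequality gives \<open>2 * \<rho>\<close>.\<close>
  have few: "prob (pair_pmf N1 N1) {z. few z} \<le> 2 * \<rho>"
  proof -
    have "real (card B) / 2 * prob (pair_pmf N1 N1) {z. few z} \<le>
        (\<Sum>t\<in>B. 1 * prob (pair_pmf N1 N1) {z. cf z t = 0})"
    proof (rule prob_weighted_markov[OF fB])
      fix z assume "few z"
      moreover have "card {t\<in>B. cf z t \<noteq> 0} \<le> card {t\<in>V - U. cf z t \<noteq> 0}"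
        by (rule card_mono) (use B(1) fin in auto)
      ultimately have "card {t\<in>B. cf z t \<noteq> 0} < k"
        unfolding few_def by linarith
      moreover have "card B \<le> card {t\<in>B. cf z t \<noteq> 0} + card {t\<in>B. cf z t = 0}"
      proof -
        have "B = {t\<in>B. cf z t \<noteq> 0} \<union> {t\<in>B. cf z t = 0}" by blast
        then show ?thesis
          using card_Un_le[of "{t\<in>B. cf z t \<noteq> 0}" "{t\<in>B. cf z t = 0}"] by simp
      qed
      ultimately have "card B \<le> 2 * card {t\<in>B. cf z t = 0}" using k(3) B(2) by linarith
      then have "real (card B) / 2 \<le> real (card {t\<in>B. cf z t = 0})" by linarith
      also have "\<dots> = (\<Sum>t\<in>B. 1 * of_bool (cf z t = 0))"
        using fB by (simp add: of_bool_def sum.If_cases Int_def)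
      finally show "real (card B) / 2 \<le> (\<Sum>t\<in>B. 1 * of_bool (cf z t = 0))" .
    qed auto
    also have "\<dots> \<le> (\<Sum>t\<in>B. \<rho>)"
      using cf0 by (intro sum_mono) (simp add: case_prod_unfold)
    finally have "real (card B) * prob (pair_pmf N1 N1) {z. few z} \<le> real (card B) * (2 * \<rho>)"
      by simp
    moreover have "real (card B) > 0" using B(2) h by simp
    ultimately show ?thesis by (simp only: mult_le_cancel_left_pos)
  qed
  have lin: "(\<Sum>t\<in>V - U. cf (y, y') t * (a t * of_bool (x t))) = - ((\<Sum>t\<in>U. a t * of_bool (y t) * cf (y, y') t) + (\<Sum>j\<in>U. dd (y, y') j * (\<Sum>k\<in>U. dd (y, y') k * u k j)))"
    if "bordered V M m (vec x y)" "bordered V M m (vec x y')" for x y y'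
  proof -
    have "(\<Sum>t\<in>V. vec x y t * (2 * (\<Sum>j\<in>U. dd (y, y') j * u j t))) + (\<Sum>j\<in>U. dd (y, y') j * (\<Sum>k\<in>U. dd (y, y') k * u k j)) = 0"
      by (rule bordered_resample[OF fin sym UV _ that(1,2)])
         (use u U in \<open>auto simp: vec_def dd_def override_on_def algebra_simps\<close>)
    moreover have "(\<Sum>t\<in>V. vec x y t * cf (y, y') t) = (\<Sum>t\<in>V - U. vec x y t * cf (y, y') t) + (\<Sum>t\<in>U. vec x y t * cf (y, y') t)"
      by (rule sum.subset_diff[OF UV fin])
    moreover have "(\<Sum>t\<in>V - U. vec x y t * cf (y, y') t) = (\<Sum>t\<in>V - U. cf (y, y') t * (a t * of_bool (x t)))"
      by (intro sum.cong) (auto simp: vec_def)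
    moreover have "(\<Sum>t\<in>U. vec x y t * cf (y, y') t) = (\<Sum>t\<in>U. a t * of_bool (y t) * cf (y, y') t)"
      by (intro sum.cong) (auto simp: vec_def)
    ultimately show ?thesis unfolding cf_def[symmetric] by (simp add: eq_neg_iff_add_eq_0 add.assoc del: minus_add_distrib)
  qed
  have "(prob (bern V p) {x. bordered V M m (\<lambda>t. a t * of_bool (x t))})\<^sup>2 =
      (prob (pair_pmf M1 N1) {(x, y). bordered V M m (vec x y)})\<^sup>2"
    unfolding M1_def N1_def vec_def by (subst bern_split[OF fin UV]) (simp add: vimage_def case_prod_unfold)
  also have "\<dots> \<le> prob (pair_pmf M1 (pair_pmf N1 N1)) {(x, (y, y')). bordered V M m (vec x y) \<and> bordered V M m (vec x y')}"
    by (rule prob_pair_square_le)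
  also have "\<dots> = prob (pair_pmf (pair_pmf N1 N1) M1)
      {(z, x). bordered V M m (vec x (fst z)) \<and> bordered V M m (vec x (snd z))}"
    by (subst pair_commute_pmf) (simp add: vimage_def case_prod_unfold)
  also have "\<dots> \<le> prob (pair_pmf (pair_pmf N1 N1) M1) {w. few (fst w) \<or>
      (case w of (z, x) \<Rightarrow> \<not> few z \<and> (bordered V M m (vec x (fst z)) \<and> bordered V M m (vec x (snd z))))}"
    by (intro measure_pmf.finite_measure_mono) auto
  also have "\<dots> \<le> prob (pair_pmf (pair_pmf N1 N1) M1) {w. few (fst w)} +
      prob (pair_pmf (pair_pmf N1 N1) M1) {w. case w of (z, x) \<Rightarrow> \<not> few z \<and> (bordered V M m (vec x (fst z)) \<and> bordered V M m (vec x (snd z)))}"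
    by (rule prob_disj_le)
  also have "prob (pair_pmf (pair_pmf N1 N1) M1) {w. few (fst w)} =
      prob (map_pmf fst (pair_pmf (pair_pmf N1 N1) M1)) {z. few z}"
    by (simp add: vimage_def)
  also have "\<dots> = prob (pair_pmf N1 N1) {z. few z}" by (simp add: map_fst_pair_pmf)
  also have "prob (pair_pmf (pair_pmf N1 N1) M1) {w. case w of (z, x) \<Rightarrow> \<not> few z \<and> (bordered V M m (vec x (fst z)) \<and> bordered V M m (vec x (snd z)))}
      \<le> \<rho> * prob (pair_pmf N1 N1) {z. \<not> few z}"
  proof (rule prob_pair_le[OF _ \<rho>])
    fix z assume z: "\<not> few z"
    let ?c = "cf z"
    define r where "r = - ((\<Sum>t\<in>U. a t * of_bool (fst z t) * ?c t) + (\<Sum>j\<in>U. dd z j * (\<Sum>k\<in>U. dd z k * u k j)))"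
    have "prob M1 {x. bordered V M m (vec x (fst z)) \<and> bordered V M m (vec x (snd z))} \<le>
        prob M1 {x. (\<Sum>t\<in>V - U. ?c t * (a t * of_bool (x t))) = r}"
      unfolding r_def by (rule prob_mono) (use lin[of _ "fst z" "snd z"] in simp)
    also have "\<dots> \<le> \<rho>"
      unfolding M1_def \<rho>_def
      by (rule prob_linear_le) (use fin p a k z in \<open>auto simp: few_def supp_def\<close>)
    finally show "prob M1 {x. bordered V M m (vec x (fst z)) \<and> bordered V M m (vec x (snd z))} \<le> \<rho>" .
  qed
  also have "\<rho> * prob (pair_pmf N1 N1) {z. \<not> few z} \<le> \<rho>"
    using \<rho> by (intro mult_left_le) auto
  also have "prob (pair_pmf N1 N1) {z. few z} + \<rho> \<le> 3 * \<rho>" using few by linarith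
  finally show ?thesis by (simp add: \<rho>_def)
qed


section \<open>Dependent rows\<close>

lemma divide_sqrt_powr:
  fixes x y :: real
  assumes "0 \<le> y"
  shows "x / sqrt y = x * y powr (- 1/2)"
proof -
  have "y powr (- 1/2) = inverse (y powr (1/2))" using powr_minus[of y "1/2"] by simp
  also have "y powr (1/2) = sqrt y" by (rule powr_half_sqrt[OF assms])
  finally show ?thesis by (simp only: divide_inverse)
qed

text \<open>Everything outside the new row, including the corner, is fixed by \<open>f\<close>, so
  only the off-diagonal entries of row \<open>i\<close> are random. A large circuit of the minor
  gives the exponent 1/2; the quadratic case bounds the square of the probability and determines the
  exponent 1/4.\<close>

lemma prob_new_row_le:
  assumes i: "i < n" and n: "n \<ge> 10"
    and sym: "\<And>t u. w t u = w u t" and nz: "\<And>t u. t < n \<Longrightarrow> u < n \<Longrightarrow> t \<noteq> u \<Longrightarrow> w t u \<noteq> 0"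
    and p: "0 < p" "p \<le> 1/2"
    and h: "0 < h" "4 * real h \<le> \<delta> * real n" and k: "0 < k" "k * n \<le> h * h" "2 * k \<le> h" "1 \<le> real k * p"
    and typl: "typical s n ({..<n} - {i}) (wmat w f)"
  shows "prob (bern (col_edges ({..<n} - {i}) i) p)
    {g. \<exists>v. left_kernel {..<n} (wmat w (override_on f g (col_edges ({..<n} - {i}) i))) v \<and> v i \<noteq> 0}
    \<le> 12 * (real k * p) powr (- 1/4)"
proof -
  define V where "V = {..<n} - {i}"
  define D where "D = col_edges V i"
  define M where "M = wmat w f"
  define m where "m = wmat w f i i"
  define a where "a t = w t i" for t
  have fV: "finite V" and cV: "card V = n - 1" and iV: "i \<notin> V" and nV: "{..<n} = insert i V"
    using i by (auto simp: V_def)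
  have Msym: "M t u = M u t" for t u
    by (simp add: M_def wmat_def sym[of t u] edge_def min.commute max.commute)
  have a0: "a t \<noteq> 0" if "t \<in> V" for t
    using that nz[of t i] i by (auto simp: V_def a_def)
  have inside: "wmat w (override_on f g D) t u = M t u" if "t \<in> V" "u \<in> V" for g t u
  proof -
    have "edge t u \<notin> D" unfolding D_def using that iV by (intro edge_notin_col_edges) auto
    then show ?thesis by (simp add: wmat_def M_def override_on_def)
  qed
  have corner: "wmat w (override_on f g D) i i = m" for g
  proof -
    have "edge i i \<notin> D" unfolding D_def col_edges_def using iV by (auto simp: edge_eq_iff)
    then show ?thesis by (simp add: wmat_def m_def override_on_def)
  qed
  have star: "wmat w (override_on f g D) t i = a t * of_bool (g (edge t i))"
    "wmat w (override_on f g D) i t = a t * of_bool (g (edge t i))" if "t \<in> V" for g t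
  proof -
    have "edge t i \<in> D" using that by (simp add: D_def)
    moreover have "edge i t = edge t i" by (simp add: edge_eq_iff)
    ultimately show "wmat w (override_on f g D) t i = a t * of_bool (g (edge t i))"
      "wmat w (override_on f g D) i t = a t * of_bool (g (edge t i))"
      by (simp_all add: wmat_def a_def override_on_def sym[of i t])
  qed
  have to_bordered: "bordered V M m (\<lambda>t. a t * of_bool (g (edge t i)))"
    if v: "left_kernel {..<n} (wmat w (override_on f g D)) v" "v i \<noteq> 0" for g v
  proof -
    let ?Q = "wmat w (override_on f g D)"
    have eq: "v i * ?Q i u + (\<Sum>t\<in>V. v t * ?Q t u) = 0" if "u \<in> insert i V" for u
      using v(1) that fV iV unfolding left_kernel_def nV by auto
    define h where "h t = - v t / v i" for t
    have hs: "(\<Sum>t\<in>V. h t * F t) = - (\<Sum>t\<in>V. v t * F t) / v i" for F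
      by (simp add: h_def sum_negf sum_divide_distrib)
    have "(\<Sum>t\<in>V. h t * M t u) = a u * of_bool (g (edge u i))" if u: "u \<in> V" for u
    proof -
      have "(\<Sum>t\<in>V. v t * ?Q t u) = (\<Sum>t\<in>V. v t * M t u)" using inside u by (intro sum.cong) auto
      then have "- (\<Sum>t\<in>V. v t * M t u) = v i * (a u * of_bool (g (edge u i)))"
        using eq[of u] u star(2)[OF u] by (simp add: neg_eq_iff_add_eq_0 add.commute)
      then show ?thesis unfolding hs using v(2) by (simp del: of_bool_eq_1_iff)
    qed
    moreover have "(\<Sum>t\<in>V. a t * of_bool (g (edge t i)) * h t) = m"
    proof -
      have "(\<Sum>t\<in>V. v t * ?Q t i) = (\<Sum>t\<in>V. v t * (a t * of_bool (g (edge t i))))"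
        using star(1) by (intro sum.cong) auto
      then have "- (\<Sum>t\<in>V. v t * (a t * of_bool (g (edge t i)))) = v i * m"
        using eq[of i] corner by (simp add: neg_eq_iff_add_eq_0 add.commute)
      then have "(\<Sum>t\<in>V. h t * (a t * of_bool (g (edge t i)))) = m" unfolding hs using v(2) by simp
      then show ?thesis by (simp add: mult.commute)
    qed
    ultimately show ?thesis unfolding bordered_def by blast
  qed
  have bij: "bij_betw (\<lambda>t. edge t i) V D"
    by (simp add: D_def col_edges_def bij_betw_def inj_edge)
  have out: "edge t i \<notin> D" if "t \<notin> V" for t
    using that by (auto simp: D_def col_edges_def edge_eq_iff)
  have transfer: "prob (bern D p) {g. bordered V M m (\<lambda>t. a t * of_bool (g (edge t i)))} =
      prob (bern V p) {x. bordered V M m (\<lambda>t. a t * of_bool (x t))}"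
    by (subst Pi_pmf_bij_betw[OF fV bij out]) (auto simp: vimage_def)
  let ?q = "prob (bern V p) {x. bordered V M m (\<lambda>t. a t * of_bool (x t))}"
  have "prob (bern D p) {g. \<exists>v. left_kernel {..<n} (wmat w (override_on f g D)) v \<and> v i \<noteq> 0} \<le>
      prob (bern D p) {g. bordered V M m (\<lambda>t. a t * of_bool (g (edge t i)))}"
    by (rule prob_mono) (use to_bordered in blast)
  also have "\<dots> \<le> 12 * (real k * p) powr (- 1/4)"
    unfolding transfer
  proof (cases "\<exists>v. circuit V M v \<and> \<delta> * real n < real (card (supp V v))")
    case True
    then obtain v where v: "left_kernel V M v" "\<delta> * real n < real (card (supp V v))"
      by (auto simp: circuit_def)
    have kv: "k \<le> card (supp V v)" using v(2) h k(3) by linarith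
    have "?q \<le>
        prob (bern V p) {x. (\<Sum>t\<in>V. v t * (a t * of_bool (x t))) = 0}"
      by (rule prob_mono) (rule bordered_orthogonal[OF Msym _ v(1)])
    also have "\<dots> \<le> 12 / sqrt (real k * p)" by (rule prob_linear_le[OF fV p a0 k(1) kv])
    also have "\<dots> = 12 * (real k * p) powr (- 1/2)"
      by (rule divide_sqrt_powr) (use k(4) in linarith)
    also have "\<dots> \<le> 12 * (real k * p) powr (- 1/4)" using k(4) by (intro mult_left_mono powr_mono) auto
    finally show "?q \<le> 12 * (real k * p) powr (- 1/4)" .
  next
    case False
    then have circ: "real (card (supp V v)) \<le> \<delta> * real n" if "circuit V M v" for v
      using that by force
    have "n - 1 \<le> card V" using cV by simp
    from many_large_unit_solutions[OF fV Msym typl[folded V_def M_def] this n circ]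
    obtain u G where G: "G \<subseteq> V" "real n / 2 \<le> real (card G)"
      and u: "\<forall>j\<in>G. solves_unit V M j (u j) \<and> \<delta> * real n < real (card (supp V (u j)))" by blast
    have hG: "h \<le> card G"
    proof -
      have "real h \<le> real n / 2" using h(2) by (simp add: \<delta>_def)
      then show ?thesis using G(2) by linarith
    qed
    have hu: "4 * h \<le> card (supp V (u j))" if "j \<in> G" for j
      using bspec[OF u that] h(2) by linarith
    have "(?q)\<^sup>2 \<le> 36 / sqrt (real k * p)"
      by (rule prob_bordered_le[OF fV Msym p a0 G(1) _ _ h(1) hG hu k(1-3)]) (use u cV in auto)
    also have "\<dots> = (6 * (real k * p) powr (- 1/4))\<^sup>2"
    proof -
      have "((real k * p) powr (- 1/4))\<^sup>2 = (real k * p) powr (- 1/2)"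
        by (simp add: power2_eq_square powr_add[symmetric])
      moreover have "36 / sqrt (real k * p) = 36 * (real k * p) powr (- 1/2)"
        by (rule divide_sqrt_powr) (use k(4) in linarith)
      ultimately show ?thesis by (simp only: power_mult_distrib) simp
    qed
    finally have "?q \<le> 6 * (real k * p) powr (- 1/4)"
      by (rule power2_le_imp_le) simp
    then show "?q \<le> 12 * (real k * p) powr (- 1/4)"
      by (rule order.trans) simp
  qed
  finally show ?thesis by (simp add: D_def V_def)
qed

lemma typical_cong:
  assumes "\<And>t u. t \<in> V \<Longrightarrow> u \<in> V \<Longrightarrow> M t u = M' t u"
  shows "typical s n V M = typical s n V M'"
proof -
  have deg: "degree_in M T u = degree_in M' T u" if "T \<subseteq> V" "u \<in> V" for T u
    unfolding degree_in_def by (rule arg_cong[where f = card]) (use assms that in auto)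
  have cs: "covers_sparsely V M T r = covers_sparsely V M' T r" if "T \<subseteq> V" for T r
  proof -
    have "single_cols V M T = single_cols V M' T" "double_cols V M T = double_cols V M' T"
      using deg[OF that] by (auto simp: single_cols_def double_cols_def)
    then show ?thesis by (simp add: covers_sparsely_def)
  qed
  have sums: "(\<Sum>t\<in>T. v t * M t u) = (\<Sum>t\<in>T. v t * M' t u)" if "T \<subseteq> V" "u \<in> V" for T u v
    using assms that by (intro sum.cong) auto
  have nd: "nearly_dependent V M T = nearly_dependent V M' T" if "T \<subseteq> V" for T
    unfolding nearly_dependent_def using sums[OF that] by (metis DiffD1)
  have "small_dependent_rows s V M = small_dependent_rows s V M'"
    unfolding small_dependent_rows_def using cs nd by (intro arg_cong[where f = Union]) auto
  then show ?thesis unfolding typical_def using cs nd by auto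
qed

lemma prob_kernel_at_index_le:
  assumes i: "i < n" and n: "n \<ge> 10"
    and sym: "\<And>t u. w t u = w u t" and nz: "\<And>t u. t < n \<Longrightarrow> u < n \<Longrightarrow> t \<noteq> u \<Longrightarrow> w t u \<noteq> 0"
    and p: "0 < p" "p \<le> 1/2"
    and h: "0 < h" "4 * real h \<le> \<delta> * real n" and k: "0 < k" "k * n \<le> h * h" "2 * k \<le> h" "1 \<le> real k * p"
    and typl: "prob (bern (edges n) p) {\<xi>. \<not> typical s n ({..<n} - {i}) (wmat w \<xi>)} \<le> e"
  shows "prob (bern (edges n) p) {\<xi>. \<exists>v. left_kernel {..<n} (wmat w \<xi>) v \<and> v i \<noteq> 0} \<le>
    e + 12 * (real k * p) powr (- 1/4)"
proof -
  define V where "V = {..<n} - {i}"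
  define K where "K \<xi> \<longleftrightarrow> (\<exists>v. left_kernel {..<n} (wmat w \<xi>) v \<and> v i \<noteq> 0)" for \<xi>
  define C where "C \<xi> \<longleftrightarrow> typical s n V (wmat w \<xi>)" for \<xi>
  let ?P = "bern (edges n) p" and ?b = "12 * (real k * p) powr (- 1/4)"
  have C_inv: "C (override_on f g (col_edges V i)) = C f" for f g
  proof -
    have "wmat w (override_on f g (col_edges V i)) t u = wmat w f t u" if "t \<in> V" "u \<in> V" for t u
    proof -
      have "edge t u \<notin> col_edges V i" using that by (intro edge_notin_col_edges) (auto simp: V_def)
      then show ?thesis by (simp add: wmat_def override_on_def)
    qed
    then have eq: "\<And>t u. t \<in> V \<Longrightarrow> u \<in> V \<Longrightarrow> wmat w (override_on f g (col_edges V i)) t u = wmat w f t u" by blast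
    show ?thesis unfolding C_def by (rule typical_cong) (rule eq)
  qed
  have "prob ?P {\<xi>. C \<xi> \<and> K \<xi>} \<le> ?b * prob ?P {\<xi>. C \<xi>}"
  proof (rule prob_step[of _ "col_edges V i"])
    show "col_edges V i \<subseteq> edges n" using i by (intro col_edges_subset) (auto simp: V_def)
    fix f assume "C f"
    then show "prob (bern (col_edges V i) p) {g. K (override_on f g (col_edges V i))} \<le> ?b"
      unfolding K_def V_def C_def by (intro prob_new_row_le[OF i n sym nz p h k])
  qed (use C_inv in auto)
  also have "\<dots> \<le> ?b" by (intro mult_left_le) auto
  finally have CK: "prob ?P {\<xi>. C \<xi> \<and> K \<xi>} \<le> ?b" .
  have "prob ?P {\<xi>. K \<xi>} \<le> prob ?P {\<xi>. \<not> C \<xi> \<or> (C \<xi> \<and> K \<xi>)}" by (rule prob_mono) blast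
  also have "\<dots> \<le> prob ?P {\<xi>. \<not> C \<xi>} + prob ?P {\<xi>. C \<xi> \<and> K \<xi>}" by (rule prob_disj_le)
  also have "\<dots> \<le> e + ?b" using typl CK by (intro add_mono) (auto simp: C_def V_def)
  finally show ?thesis by (simp add: K_def)
qed

section \<open>Large kernel vectors and the conclusion\<close>

definition large_kernel_vector :: "nat \<Rightarrow> (nat \<Rightarrow> nat \<Rightarrow> complex) \<Rightarrow> bool" where
  "large_kernel_vector n M \<longleftrightarrow> (\<exists>v. left_kernel {..<n} M v \<and> \<delta> * real n < real (card (supp {..<n} v)))"

lemma prob_large_kernel_vector_le:
  assumes n: "n > 0" and b: "\<And>i. i < n \<Longrightarrow> prob P {\<xi>. \<exists>v. left_kernel {..<n} (wmat w \<xi>) v \<and> v i \<noteq> 0} \<le> b"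
  shows "prob P {\<xi>. large_kernel_vector n (wmat w \<xi>)} \<le> b / \<delta>"
proof -
  let ?K = "\<lambda>i \<xi>. \<exists>v. left_kernel {..<n} (wmat w \<xi>) v \<and> v i \<noteq> 0"
  have "\<delta> * real n * prob P {\<xi>. large_kernel_vector n (wmat w \<xi>)}
      \<le> (\<Sum>i<n. 1 * prob P {\<xi>. ?K i \<xi>})"
  proof (rule prob_weighted_markov)
    fix \<xi> assume "large_kernel_vector n (wmat w \<xi>)"
    then obtain v where v: "left_kernel {..<n} (wmat w \<xi>) v" "\<delta> * real n < real (card (supp {..<n} v))"
      unfolding large_kernel_vector_def by blast
    have "real (card (supp {..<n} v)) = (\<Sum>i\<in>supp {..<n} v. 1)" by simp
    also have "\<dots> = (\<Sum>i\<in>supp {..<n} v. 1 * of_bool (?K i \<xi>))"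
      using v(1) by (intro sum.cong) (auto simp: supp_def)
    also have "\<dots> \<le> (\<Sum>i<n. 1 * of_bool (?K i \<xi>))" by (rule sum_mono2) (auto simp: supp_def)
    finally show "\<delta> * real n \<le> (\<Sum>i<n. 1 * of_bool (?K i \<xi>))" using v(2) by linarith
  qed auto
  also have "\<dots> \<le> (\<Sum>i<n. b)" using b by (intro sum_mono) auto
  also have "\<dots> = real n * b" by simp
  finally show ?thesis using n by (simp add: \<delta>_def field_simps)
qed

text \<open>The witness is a circuit inside the dependent set. Absence of large kernel vectors and
  the first clause of \<open>typical\<close> make it shorter than \<open>s\<close>; the third clause
  denies it \<open>card T\<close> doubly touched columns, and it has no singly touched ones, so it
  is non-expanding.\<close>

lemma typical_imp_conclusion:
  assumes s: "s > 0" and dim: "dim_row Q = n" "dim_col Q = n"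
    and Q: "\<And>i j. i < n \<Longrightarrow> j < n \<Longrightarrow> Q $$ (i, j) = M i j"
    and tp: "typical s n {..<n} M"
    and large: "\<not> large_kernel_vector n M"
    and dep: "dependent_rows Q S"
  shows "\<exists>T\<subseteq>S. card T \<le> s - 1 \<and> non_expanding Q T"
proof -
  obtain a where S: "S \<subseteq> {..<n}" and a: "\<exists>i\<in>S. a i \<noteq> 0" "\<forall>j<n. (\<Sum>i\<in>S. a i * Q $$ (i, j)) = 0"
    using dep by (auto simp: dependent_rows_def dim)
  define v where "v i = (if i \<in> S then a i else 0)" for i
  have sub: "supp {..<n} v \<subseteq> S" by (auto simp: supp_def v_def split: if_splits)
  have "(\<Sum>t<n. v t * M t j) = 0" if "j < n" for j
  proof -
    have "(\<Sum>t<n. v t * M t j) = (\<Sum>t\<in>S. v t * M t j)" by (rule sum_supp) (use sub S in auto)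
    also have "\<dots> = (\<Sum>i\<in>S. a i * Q $$ (i, j))" using S that by (intro sum.cong) (auto simp: v_def Q subset_iff)
    finally show ?thesis using a(2) that by simp
  qed
  then have "left_kernel {..<n} M v" by (simp add: left_kernel_def)
  moreover obtain i where "i \<in> S" "a i \<noteq> 0" using a(1) by blast
  moreover from this have "i \<in> supp {..<n} v" using S by (auto simp: supp_def v_def)
  ultimately obtain v' where v': "circuit {..<n} M v'" "supp {..<n} v' \<subseteq> supp {..<n} v"
    using exists_circuit[of "{..<n}" M v i] by blast
  define T where "T = supp {..<n} v'"
  have T: "T \<subseteq> {..<n}" "finite T" by (auto simp: T_def supp_def)
  have "T \<noteq> {}" using v'(1) unfolding circuit_def T_def by blast
  note props = circuit_properties[OF finite_lessThan v'(1), folded T_def]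
  have "left_kernel {..<n} M v'" using v'(1) unfolding circuit_def by blast
  then have "real (card T) \<le> \<delta> * real n" 
    using large unfolding T_def large_kernel_vector_def by force
  then have "\<not> s \<le> card T" using tp T(1) props unfolding typical_def by blast
  then have cT: "0 < card T" "card T < s" using T \<open>T \<noteq> {}\<close> by (auto simp: card_gt_0_iff)
  then have "\<not> covers_sparsely {..<n} M T (card T)" using tp T(1) props(1) unfolding typical_def by blast
  from dependent_rows_few_cols[OF finite_lessThan T(2) props(2) this]
  have "card {u\<in>{..<n}. \<exists>t\<in>T. M t u \<noteq> 0} < card T" .
  moreover have "{j. j < dim_col Q \<and> (\<exists>i\<in>T. Q $$ (i, j) \<noteq> 0)} = {u\<in>{..<n}. \<exists>t\<in>T. M t u \<noteq> 0}"
    using T(1) Q by (auto simp: dim subset_iff)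
  ultimately have "non_expanding Q T" using T(1) by (simp add: non_expanding_def dim)
  moreover have "T \<subseteq> S" using v'(2) sub by (auto simp: T_def)
  ultimately show ?thesis using cT by (intro exI[of _ T]) auto
qed

lemma masked_mat_eq_wmat:
  assumes "dim_row W = n" "dim_col W = n" "i < n" "j < n"
  shows "masked_mat W \<xi> $$ (i, j) = wmat (\<lambda>t u. W $$ edge t u) \<xi> i j"
  using assms by (simp add: masked_mat_def wmat_def edge_def)

theorem theorem1p4:
  fixes s :: nat and c :: real and p :: "nat \<Rightarrow> real"
  assumes "s > 0" and "c > 1 / real s"
    and "\<forall>\<^sub>F n in sequentially. c * ln (real n) / real n < p n \<and> p n < 1 / 2"
  shows "\<exists>\<epsilon> :: nat \<Rightarrow> real.
     \<epsilon> \<in> O(\<lambda>n. 1 / ln (ln (real n)) powr (1 / 4)) \<and> \<epsilon> \<in> o(\<lambda>_. 1) \<and>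
     (\<forall>\<^sub>F n in sequentially. \<forall>W \<in> admissible_weights n.
        measure_pmf.prob (Q_pmf W (p n))
          {Q. \<forall>S. dependent_rows Q S \<longrightarrow>
                 (\<exists>T\<subseteq>S. card T \<le> s - 1 \<and> non_expanding Q T)} \<ge> 1 - \<epsilon> n)"
proof -
  have c0: "c > 0" using assms(1,2) by (auto intro: less_trans[of 0 "1 / real s" c])
  \<comment> \<open>Below, \<open>k\<close> is \<open>\<delta>^2 * n / 64\<close> rounded down; half
    of that is a safe lower bound for large \<open>n\<close>.\<close>
  define \<kappa> where "\<kappa> = \<delta>\<^sup>2 / 128"
  have \<kappa>: "\<kappa> > 0" by (simp add: \<kappa>_def \<delta>_def)
  \<comment> \<open>The first 1 pays for the whole matrix not being typical. The quotient by
    \<open>\<delta>\<close> averages over the deleted index: an atypical minor plus the bound for a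
    new row.\<close>
  define C where "C = 1 + (1 + 12 * (\<kappa> * c) powr (- 1/4)) / \<delta>"
  define \<epsilon> where "\<epsilon> n = C * ln (real n) powr (- 1/4)" for n
  have C0: "C > 0" by (simp add: C_def \<delta>_def add_pos_nonneg)
  have bigo: "\<epsilon> \<in> O(\<lambda>n. 1 / ln (ln (real n)) powr (1 / 4))"
    unfolding \<epsilon>_def using C0 by real_asymp
  have smallo: "\<epsilon> \<in> o(\<lambda>_. 1)"
    unfolding \<epsilon>_def using C0 by real_asymp
  have "\<forall>\<^sub>F n::nat in sequentially. \<kappa> * c * ln (real n) \<ge> 1" using \<kappa> c0 by real_asymp
  moreover have "\<forall>\<^sub>F n::nat in sequentially. \<delta>\<^sup>2 / 64 * real n \<ge> 2" unfolding \<delta>_def by real_asymp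
  ultimately have main: "\<forall>\<^sub>F n in sequentially. \<forall>W \<in> admissible_weights n.
        prob (Q_pmf W (p n))
          {Q. \<forall>S. dependent_rows Q S \<longrightarrow> (\<exists>T\<subseteq>S. card T \<le> s - 1 \<and> non_expanding Q T)} \<ge> 1 - \<epsilon> n"
    using typical_whp[OF assms(1,2)] assms(3) eventually_ge_at_top[of 10]
  proof eventually_elim
    case (elim n)
    show ?case
    proof
      fix W assume W: "W \<in> admissible_weights n"
      define q where "q = p n"
      define w where "w t u = W $$ edge t u" for t u
      have dimW: "dim_row W = n" "dim_col W = n"
        and Wnz: "\<And>i j. i < n \<Longrightarrow> j < n \<Longrightarrow> i \<noteq> j \<Longrightarrow> W $$ (i, j) \<noteq> 0"
        using W by (auto simp: admissible_weights_def)
      have n: "real n \<ge> 10" using elim(5) by simp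
      have q: "c * ln (real n) / real n < q" "q \<le> 1/2" using elim(4) by (auto simp: q_def)
      have "0 \<le> c * ln (real n) / real n" using c0 n by simp
      then have q0: "q > 0" using q by linarith
      have wsym: "w t u = w u t" for t u by (simp add: w_def edge_def min.commute max.commute)
      have wnz: "w t u \<noteq> 0" if "t < n" "u < n" "t \<noteq> u" for t u
        unfolding w_def edge_def using that by (intro Wnz) (auto simp: min_def max_def)
      \<comment> \<open>\<open>4 * h \<le> \<delta> * n\<close> fits the supports of the unit
        solutions. As \<open>h \<ge> \<delta> * n / 8\<close> after rounding,
        \<open>k * n \<le> (\<delta> * n / 8)^2 \<le> h * h\<close>.\<close>
      define h where "h = nat \<lfloor>\<delta> * real n / 4\<rfloor>"
      define k where "k = nat \<lfloor>\<delta>\<^sup>2 * real n / 64\<rfloor>"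
      have dn: "\<delta> > 0" "\<delta> \<le> 1" by (auto simp: \<delta>_def)
      have floor: "real (nat \<lfloor>x\<rfloor>) \<le> x" "x < real (nat \<lfloor>x\<rfloor>) + 1" if "0 \<le> x" for x :: real
        using that by linarith+
      have d1: "\<delta>\<^sup>2 \<le> \<delta>" using dn by (simp add: power2_eq_square mult_left_le)
      have dd: "\<delta>\<^sup>2 * real n \<le> \<delta> * real n" using d1 by (intro mult_right_mono) auto
      have d2: "\<delta>\<^sup>2 * real n \<ge> 128" using elim(2) by simp
      have h: "real h \<le> \<delta> * real n / 4" "\<delta> * real n / 4 < real h + 1"
        unfolding h_def using dn by (intro floor; simp)+
      have k: "real k \<le> \<delta>\<^sup>2 * real n / 64" "\<delta>\<^sup>2 * real n / 64 < real k + 1"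
        unfolding k_def by (intro floor; simp)+
      have h8: "\<delta> * real n / 8 \<le> real h" using h(2) d2 dd by linarith
      have k128: "\<kappa> * real n \<le> real k" unfolding \<kappa>_def using k(2) d2 by linarith
      have hk: "0 < h" "4 * real h \<le> \<delta> * real n" "0 < k" "2 * k \<le> h"
        using h h8 k k128 d2 dd by linarith+
      have kn: "k * n \<le> h * h"
      proof -
        have "real k * real n \<le> \<delta>\<^sup>2 * real n / 64 * real n" using k(1) by (intro mult_right_mono) auto
        also have "\<dots> = (\<delta> * real n / 8) * (\<delta> * real n / 8)" by (simp add: power2_eq_square)
        also have "\<dots> \<le> real h * real h" using h8 dn by (intro mult_mono) auto
        finally show ?thesis by (simp flip: of_nat_mult)
      qed
      have kq: "\<kappa> * c * ln (real n) \<le> real k * q"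
      proof -
        have "\<kappa> * c * ln (real n) = \<kappa> * real n * (c * ln (real n) / real n)" using n by simp
        also have "\<dots> \<le> real k * q"
          using k128 q(1) \<open>0 \<le> c * ln (real n) / real n\<close> \<kappa> by (intro mult_mono) auto
        finally show ?thesis .
      qed
      have kq1: "1 \<le> real k * q" using kq elim(1) by linarith
      define e where "e = ln (real n) powr (- 1/4)"
      have typl: "prob (bern (edges n) q) {\<xi>. \<not> typical s n V (wmat w \<xi>)} \<le> e"
        if "V \<subseteq> {..<n}" "n - 1 \<le> card V" for V
        unfolding e_def by (rule elim(3)[rule_format]) (use that q wnz in auto)
      let ?P = "bern (edges n) q"
      define b where "b = 12 * (\<kappa> * c) powr (- 1/4) * e"
      have "12 * (real k * q) powr (- 1/4) \<le> 12 * (\<kappa> * c * ln (real n)) powr (- 1/4)"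
        using kq elim(1) by (intro mult_left_mono powr_mono2') auto
      also have "\<dots> = b" using \<kappa> c0 n by (simp add: b_def e_def powr_mult)
      finally have kb: "12 * (real k * q) powr (- 1/4) \<le> b" .
      have "prob ?P {\<xi>. \<exists>v. left_kernel {..<n} (wmat w \<xi>) v \<and> v i \<noteq> 0} \<le> e + b" if i: "i < n" for i
      proof -
        have "n - 1 \<le> card ({..<n} - {i})" using i by simp
        then have "prob ?P {\<xi>. \<not> typical s n ({..<n} - {i}) (wmat w \<xi>)} \<le> e" by (intro typl) auto
        from prob_kernel_at_index_le[OF i elim(5) wsym wnz q0 q(2) hk(1-3) kn hk(4) kq1 this]
        show ?thesis using kb by linarith
      qed
      then have large: "prob ?P {\<xi>. large_kernel_vector n (wmat w \<xi>)} \<le> (e + b) / \<delta>"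
        using n by (intro prob_large_kernel_vector_le) auto
      define Good where "Good Q \<longleftrightarrow> (\<forall>S. dependent_rows Q S \<longrightarrow> (\<exists>T\<subseteq>S. card T \<le> s - 1 \<and> non_expanding Q T))" for Q
      have "prob ?P {\<xi>. \<not> Good (masked_mat W \<xi>)} \<le> prob ?P {\<xi>. \<not> typical s n {..<n} (wmat w \<xi>) \<or>
          large_kernel_vector n (wmat w \<xi>)}"
      proof (rule prob_mono, rule ccontr)
        fix \<xi> assume bad: "\<not> Good (masked_mat W \<xi>)"
          and "\<not> (\<not> typical s n {..<n} (wmat w \<xi>) \<or>
            large_kernel_vector n (wmat w \<xi>))"
        then have "typical s n {..<n} (wmat w \<xi>)" "\<not> large_kernel_vector n (wmat w \<xi>)" by auto
        moreover have "dim_row (masked_mat W \<xi>) = n" "dim_col (masked_mat W \<xi>) = n"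
          by (simp_all add: masked_mat_def dimW)
        moreover have "masked_mat W \<xi> $$ (i, j) = wmat w \<xi> i j" if "i < n" "j < n" for i j
          unfolding w_def by (rule masked_mat_eq_wmat[OF dimW that])
        ultimately have "Good (masked_mat W \<xi>)"
          unfolding Good_def using typical_imp_conclusion[OF assms(1)] by blast
        then show False using bad by contradiction
      qed
      also have "\<dots> \<le> prob ?P {\<xi>. \<not> typical s n {..<n} (wmat w \<xi>)} +
          prob ?P {\<xi>. large_kernel_vector n (wmat w \<xi>)}"
        by (rule prob_disj_le)
      also have "\<dots> \<le> e + (e + b) / \<delta>" by (intro add_mono typl large) auto
      also have "\<dots> = \<epsilon> n" using dn by (simp add: \<epsilon>_def C_def b_def e_def field_simps)
      finally have bad: "prob ?P {\<xi>. \<not> Good (masked_mat W \<xi>)} \<le> \<epsilon> n" .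
      have "prob (Q_pmf W (p n)) {Q. Good Q} = prob ?P {\<xi>. Good (masked_mat W \<xi>)}"
        unfolding Q_pmf_def q_def edges_def dimW by (simp add: vimage_def)
      also have "\<dots> = 1 - prob ?P {\<xi>. \<not> Good (masked_mat W \<xi>)}"
      proof -
        have "{\<xi>. \<not> Good (masked_mat W \<xi>)} = UNIV - {\<xi>. Good (masked_mat W \<xi>)}" by auto
        then show ?thesis using measure_pmf.prob_compl[of "{\<xi>. Good (masked_mat W \<xi>)}" ?P] by simp
      qed
      finally have "1 - \<epsilon> n \<le> prob (Q_pmf W (p n)) {Q. Good Q}" using bad by linarith
      then show "1 - \<epsilon> n \<le> prob (Q_pmf W (p n))
          {Q. \<forall>S. dependent_rows Q S \<longrightarrow> (\<exists>T\<subseteq>S. card T \<le> s - 1 \<and> non_expanding Q T)}"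
        by (simp add: Good_def)
    qed
  qed
  show ?thesis using bigo smallo main by blast
qed

end
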